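(* Let $(M,F)$ be a connected $n$-dimensional homogeneous Finsler space with isotropic S-curvature, i.e. ${\bf S}=(n+1)c(x)F$ for some scalar function $c$ on $M$. Suppose that $F$ has non-positive flag curvature if $n=2$, and negative flag curvature if $n>2$. Then $F$ is Riemannian or locally Minkowskian.
   Context: A Finsler metric on a smooth manifold $M$ is a function $F:TM\to[0,\infty)$, smooth on $TM_0=TM\setminus\{0\}$, positively homogeneous of degree one in $y$, whose fundamental tensor $g_{ij}(x,y)=\frac12\frac{\partial^2F^2}{\partial y^i\partial y^j}$ is positive definite. In standard local coordinates $(x^i,y^i)$ the spray coefficients are $G^i=\frac14 g^{il}\big(\frac{\partial^2F^2}{\partial x^k\partial y^l}y^k-\frac{\partial F^2}{\partial x^l}\big)$. The Riemann curvature is $R_y(u)=R^i_{\ k}(y)u^k\partial_i$ with $R^i_{\ k}=2\frac{\partial G^i}{\partial x^k}-y^j\frac{\partial^2G^i}{\partial x^j\partial y^k}+2G^j\frac{\partial^2G^i}{\partial y^j\partial y^k}-\frac{\partial G^i}{\partial y^j}\frac{\partial G^j}{\partial y^k}$, and the flag curvature of a flag $P=\mathrm{span}\{y,u\}\subset T_xM$ with flagpole $y$ is $K(x,y,P)=\frac{g_y(u,R_y(u))}{g_y(y,y)g_y(u,u)-g_y(y,u)^2}$. The Busemann–Hausdorff volume density is $\sigma_F(x)=\mathrm{Vol}(\mathbb B^n)/\mathrm{Vol}\{(y^i)\in\mathbb R^n: F(y^i\partial_i|_x)<1\}$, and the S-curvature is ${\bf S}(x,y)=\frac{\partial G^i}{\partial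 y^i}(x,y)-y^i\frac{\partial}{\partial x^i}\ln\sigma_F(x)$. $(M,F)$ is homogeneous if its group of isometries acts transitively on $M$. $F$ is Riemannian if $g_{ij}$ does not depend on $y$; $F$ is locally Minkowskian if around every point there are local coordinates in which $F$ depends only on $y$. *)

theory Defs
  imports "HOL-Analysis.Analysis"
begin

definition pd :: "'a::real_normed_vector \<Rightarrow> ('a \<Rightarrow> real) \<Rightarrow> 'a \<Rightarrow> real" where
  "pd v f x = frechet_derivative f (at x) v"

fun pds :: "'a::real_normed_vector list \<Rightarrow> ('a \<Rightarrow> real) \<Rightarrow> 'a \<Rightarrow> real" where
  "pds [] f = f"
| "pds (v # vs) f = pd v (pds vs f)"

definition smooth_on :: "'a::euclidean_space set \<Rightarrow> ('a \<Rightarrow> real) \<Rightarrow> bool" where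
  "smooth_on S f \<longleftrightarrow> (\<forall>vs. set vs \<subseteq> Basis \<longrightarrow> pds vs f differentiable_on S)"

definition smooth_map_on :: "'a::euclidean_space set \<Rightarrow> ('a \<Rightarrow> 'b::euclidean_space) \<Rightarrow> bool" where
  "smooth_map_on S f \<longleftrightarrow> (\<forall>b\<in>Basis. smooth_on S (\<lambda>x. f x \<bullet> b))"

type_synonym ('m, 'n) chart = "'m set \<times> ('m \<Rightarrow> real^'n)"

definition is_chart :: "('m::topological_space, 'n::finite) chart \<Rightarrow> bool" where
  "is_chart c \<longleftrightarrow> open (fst c) \<and> open (snd c ` fst c) \<and>
     homeomorphism (fst c) (snd c ` fst c) (snd c) (inv_into (fst c) (snd c))"

definition cinv :: "('m, 'n::finite) chart \<Rightarrow> real^'n \<Rightarrow> 'm" where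
  "cinv c = inv_into (fst c) (snd c)"

definition smooth_compat :: "('m, 'n::finite) chart \<Rightarrow> ('m, 'n) chart \<Rightarrow> bool" where
  "smooth_compat c d \<longleftrightarrow> smooth_map_on (snd c ` (fst c \<inter> fst d)) (snd d \<circ> cinv c)"

definition smooth_atlas :: "('m::topological_space, 'n::finite) chart set \<Rightarrow> bool" where
  "smooth_atlas A \<longleftrightarrow> (\<forall>c\<in>A. is_chart c) \<and> (\<Union>(fst ` A) = UNIV) \<and>
     (\<forall>c\<in>A. \<forall>d\<in>A. smooth_compat c d)"

definition trans_map :: "('m, 'n::finite) chart \<Rightarrow> ('m, 'n) chart \<Rightarrow> real^'n \<Rightarrow> real^'n" where
  "trans_map c d = snd d \<circ> cinv c"

definition dtrans :: "('m, 'n::finite) chart \<Rightarrow> ('m, 'n) chart \<Rightarrow> 'm \<Rightarrow> real^'n \<Rightarrow> real^'n" where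
  "dtrans c d p y = frechet_derivative (trans_map c d) (at (snd c p)) y"

text \<open>A function on the tangent bundle is represented by its coordinate expressions:
  F c p y is the value of F at the tangent vector at p (p in the domain of chart c)
  with components y with respect to the coordinate basis of c.\<close>

type_synonym ('m, 'n) tbfun = "('m, 'n) chart \<Rightarrow> 'm \<Rightarrow> real^'n \<Rightarrow> real"

definition Floc :: "('m, 'n::finite) tbfun \<Rightarrow> ('m, 'n) chart \<Rightarrow> (real^'n) \<times> (real^'n) \<Rightarrow> real" where
  "Floc F c z = F c (cinv c (fst z)) (snd z)"

definition Lsq :: "('m, 'n::finite) tbfun \<Rightarrow> ('m, 'n) chart \<Rightarrow> (real^'n) \<times> (real^'n) \<Rightarrow> real" where
  "Lsq F c z = (Floc F c z)^2"

definition DX :: "'n::finite \<Rightarrow> ((real^'n) \<times> (real^'n) \<Rightarrow> real) \<Rightarrow> (real^'n) \<times> (real^'n) \<Rightarrow> real" where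
  "DX i h = pd (axis i 1, 0) h"

definition DY :: "'n::finite \<Rightarrow> ((real^'n) \<times> (real^'n) \<Rightarrow> real) \<Rightarrow> (real^'n) \<times> (real^'n) \<Rightarrow> real" where
  "DY i h = pd (0, axis i 1) h"

definition gten :: "('m, 'n::finite) tbfun \<Rightarrow> ('m, 'n) chart \<Rightarrow> 'n \<Rightarrow> 'n \<Rightarrow> (real^'n) \<times> (real^'n) \<Rightarrow> real" where
  "gten F c i j z = 1/2 * DY i (DY j (Lsq F c)) z"

definition gform :: "('m, 'n::finite) tbfun \<Rightarrow> ('m, 'n) chart \<Rightarrow> (real^'n) \<times> (real^'n) \<Rightarrow> real^'n \<Rightarrow> real^'n \<Rightarrow> real" where
  "gform F c z u v = (\<Sum>i\<in>UNIV. \<Sum>j\<in>UNIV. gten F c i j z * u$i * v$j)"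

definition ginv :: "('m, 'n::finite) tbfun \<Rightarrow> ('m, 'n) chart \<Rightarrow> (real^'n) \<times> (real^'n) \<Rightarrow> real^'n^'n" where
  "ginv F c z = matrix_inv (\<chi> i j. gten F c i j z)"

definition spray :: "('m, 'n::finite) tbfun \<Rightarrow> ('m, 'n) chart \<Rightarrow> 'n \<Rightarrow> (real^'n) \<times> (real^'n) \<Rightarrow> real" where
  "spray F c i z = 1/4 * (\<Sum>l\<in>UNIV. ginv F c z $ i $ l *
      ((\<Sum>k\<in>UNIV. DX k (DY l (Lsq F c)) z * snd z $ k) - DX l (Lsq F c) z))"

definition riem :: "('m, 'n::finite) tbfun \<Rightarrow> ('m, 'n) chart \<Rightarrow> 'n \<Rightarrow> 'n \<Rightarrow> (real^'n) \<times> (real^'n) \<Rightarrow> real" where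
  "riem F c i k z =
     2 * DX k (spray F c i) z
     - (\<Sum>j\<in>UNIV. snd z $ j * DX j (DY k (spray F c i)) z)
     + 2 * (\<Sum>j\<in>UNIV. spray F c j z * DY j (DY k (spray F c i)) z)
     - (\<Sum>j\<in>UNIV. DY j (spray F c i) z * DY k (spray F c j) z)"

definition riem_op :: "('m, 'n::finite) tbfun \<Rightarrow> ('m, 'n) chart \<Rightarrow> (real^'n) \<times> (real^'n) \<Rightarrow> real^'n \<Rightarrow> real^'n" where
  "riem_op F c z u = (\<chi> i. \<Sum>k\<in>UNIV. riem F c i k z * u$k)"

definition flag_curv :: "('m, 'n::finite) tbfun \<Rightarrow> ('m, 'n) chart \<Rightarrow> real^'n \<Rightarrow> real^'n \<Rightarrow> real^'n \<Rightarrow> real" where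
  "flag_curv F c x y u =
     gform F c (x, y) u (riem_op F c (x, y) u) /
     (gform F c (x, y) y y * gform F c (x, y) u u - (gform F c (x, y) y u)^2)"

definition sigmaBH :: "('m, 'n::finite) tbfun \<Rightarrow> ('m, 'n) chart \<Rightarrow> real^'n \<Rightarrow> real" where
  "sigmaBH F c x = measure lebesgue (ball (0::real^'n) 1) / measure lebesgue {y. Floc F c (x, y) < 1}"

definition Scurv :: "('m, 'n::finite) tbfun \<Rightarrow> ('m, 'n) chart \<Rightarrow> (real^'n) \<times> (real^'n) \<Rightarrow> real" where
  "Scurv F c z = (\<Sum>i\<in>UNIV. DY i (spray F c i) z)
      - (\<Sum>i\<in>UNIV. snd z $ i * pd (axis i 1) (\<lambda>x. ln (sigmaBH F c x)) (fst z))"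

definition finsler :: "('m::topological_space, 'n::finite) chart set \<Rightarrow> ('m, 'n) tbfun \<Rightarrow> bool" where
  "finsler A F \<longleftrightarrow> smooth_atlas A \<and>
     (\<forall>c\<in>A. \<forall>d\<in>A. \<forall>p\<in>fst c \<inter> fst d. \<forall>y. F d p (dtrans c d p y) = F c p y) \<and>
     (\<forall>c\<in>A. \<forall>p\<in>fst c. \<forall>y. F c p y \<ge> 0) \<and>
     (\<forall>c\<in>A. \<forall>p\<in>fst c. \<forall>y. \<forall>t>0. F c p (t *\<^sub>R y) = t * F c p y) \<and>
     (\<forall>c\<in>A. smooth_on (snd c ` fst c \<times> (UNIV - {0})) (Floc F c)) \<and>
     (\<forall>c\<in>A. \<forall>x\<in>snd c ` fst c. \<forall>y. y \<noteq> 0 \<longrightarrow> (\<forall>v. v \<noteq> 0 \<longrightarrow> gform F c (x, y) v v > 0))"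

definition diffeo :: "('m::topological_space, 'n::finite) chart set \<Rightarrow> ('m \<Rightarrow> 'm) \<Rightarrow> bool" where
  "diffeo A \<psi> \<longleftrightarrow> bij \<psi> \<and> continuous_on UNIV \<psi> \<and> continuous_on UNIV (inv \<psi>) \<and>
     (\<forall>c\<in>A. \<forall>d\<in>A. smooth_map_on (snd c ` (fst c \<inter> \<psi> -` fst d)) (snd d \<circ> \<psi> \<circ> cinv c)) \<and>
     (\<forall>c\<in>A. \<forall>d\<in>A. smooth_map_on (snd c ` (fst c \<inter> inv \<psi> -` fst d)) (snd d \<circ> inv \<psi> \<circ> cinv c))"

definition isometry :: "('m::topological_space, 'n::finite) chart set \<Rightarrow> ('m, 'n) tbfun \<Rightarrow> ('m \<Rightarrow> 'm) \<Rightarrow> bool" where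
  "isometry A F \<psi> \<longleftrightarrow> diffeo A \<psi> \<and>
     (\<forall>c\<in>A. \<forall>d\<in>A. \<forall>p\<in>fst c. \<psi> p \<in> fst d \<longrightarrow> (\<forall>y.
        F d (\<psi> p) (frechet_derivative (snd d \<circ> \<psi> \<circ> cinv c) (at (snd c p)) y) = F c p y))"

definition homogeneous :: "('m::topological_space, 'n::finite) chart set \<Rightarrow> ('m, 'n) tbfun \<Rightarrow> bool" where
  "homogeneous A F \<longleftrightarrow> (\<forall>p q. \<exists>\<psi>. isometry A F \<psi> \<and> \<psi> p = q)"

definition isotropic_S :: "('m::topological_space, 'n::finite) chart set \<Rightarrow> ('m, 'n) tbfun \<Rightarrow> bool" where
  "isotropic_S A F \<longleftrightarrow> (\<exists>cf :: 'm \<Rightarrow> real. \<forall>c\<in>A. \<forall>x\<in>snd c ` fst c. \<forall>y. y \<noteq> 0 \<longrightarrow>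
      Scurv F c (x, y) = (real CARD('n) + 1) * cf (cinv c x) * Floc F c (x, y))"

definition flag_curv_le0 :: "('m::topological_space, 'n::finite) chart set \<Rightarrow> ('m, 'n) tbfun \<Rightarrow> bool" where
  "flag_curv_le0 A F \<longleftrightarrow> (\<forall>c\<in>A. \<forall>x\<in>snd c ` fst c. \<forall>y u. y \<noteq> 0 \<longrightarrow> u \<notin> span {y} \<longrightarrow>
      flag_curv F c x y u \<le> 0)"

definition flag_curv_lt0 :: "('m::topological_space, 'n::finite) chart set \<Rightarrow> ('m, 'n) tbfun \<Rightarrow> bool" where
  "flag_curv_lt0 A F \<longleftrightarrow> (\<forall>c\<in>A. \<forall>x\<in>snd c ` fst c. \<forall>y u. y \<noteq> 0 \<longrightarrow> u \<notin> span {y} \<longrightarrow>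
      flag_curv F c x y u < 0)"

definition riemannian :: "('m::topological_space, 'n::finite) chart set \<Rightarrow> ('m, 'n) tbfun \<Rightarrow> bool" where
  "riemannian A F \<longleftrightarrow> (\<forall>c\<in>A. \<forall>x\<in>snd c ` fst c. \<forall>y y' i j. y \<noteq> 0 \<longrightarrow> y' \<noteq> 0 \<longrightarrow>
      gten F c i j (x, y) = gten F c i j (x, y'))"

definition locally_minkowskian :: "('m::topological_space, 'n::finite) chart set \<Rightarrow> ('m, 'n) tbfun \<Rightarrow> bool" where
  "locally_minkowskian A F \<longleftrightarrow> (\<forall>p. \<exists>e :: ('m, 'n) chart. p \<in> fst e \<and> is_chart e \<and>
      (\<forall>c\<in>A. smooth_compat e c \<and> smooth_compat c e) \<and>
      (\<forall>q1\<in>fst e. \<forall>q2\<in>fst e. \<forall>c1\<in>A. \<forall>c2\<in>A. \<forall>y. q1 \<in> fst c1 \<longrightarrow> q2 \<in> fst c2 \<longrightarrow>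
         F c1 q1 (dtrans e c1 q1 y) = F c2 q2 (dtrans e c2 q2 y)))"

end

theory Submission
  imports Defs
begin

text \<open>
  Let \<open>\<tau>\<close> be the distortion, \<open>I\<close> its fibre derivative (the mean Cartan torsion) and \<open>D\<close> the derivative
  along the geodesic spray, so that \<open>S = D \<tau>\<close>. By homogeneity an isometry-invariant function on the unit sphere bundle
  attains its maximum over every point, and there its spray derivative vanishes; applied to \<open>\<tau>\<close>,
  this turns isotropic S-curvature into \<open>S = 0\<close>. Commuting \<open>D\<close> with the coordinate fields then yields the
  Jacobi-type equation \<open>I'' + R I = 0\<close>. Hence \<open>\<phi> = |I|\<^sup>2\<close>, scaled to degree \<open>0\<close>, satisfies
  \<open>D (D \<phi>) = 2 |I'|\<^sup>2 - 2 g (I, R I) \<ge> 0\<close>, and maximizing \<open>\<plusminus> D \<phi> + \<epsilon> \<phi>\<close> on the unit sphere bundle and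
  letting \<open>\<epsilon>\<close> tend to \<open>0\<close> gives \<open>D \<phi> = 0\<close> without any completeness or geodesic flow. So \<open>I' = 0\<close> and \<open>g (I, R I) = 0\<close>.

  For negative curvature \<open>I = 0\<close>, and the metric is Riemannian by Deicke's theorem, which follows by
  integrating the divergence of the gradient of \<open>g\<^sub>k\<^sub>k\<close> over a fibre. On a surface, \<open>I' = 0\<close> and \<open>S = 0\<close> make
  the metric Berwald, with \<open>F\<close> and \<open>\<tau>\<close> constant along horizontal curves. Where \<open>I \<noteq> 0\<close>, prescribing the values
  of \<open>F\<close> and \<open>\<tau>\<close> determines a parallel vector field by the inverse function theorem; the fibre
  differentials of \<open>F\<^sup>2\<close> and \<open>\<tau>\<close> along it are closed 1-forms, and their primitives are coordinates in which
  \<open>F\<close> does not depend on the point.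
\<close>

section \<open>Smooth functions\<close>

lemma pd_has_derivative:
  assumes "f differentiable (at x)"
  shows "(f has_derivative (\<lambda>v. pd v f x)) (at x)"
  using assms unfolding pd_def frechet_derivative_works .

lemma pd_eqI: "(f has_derivative f') (at x) \<Longrightarrow> pd v f x = f' v"
  unfolding pd_def by (metis frechet_derivative_at)

lemma has_derivative_cong_open:
  assumes "open S" "x \<in> S" "\<And>y. y \<in> S \<Longrightarrow> f y = g y"
  shows "(f has_derivative D) (at x) \<longleftrightarrow> (g has_derivative D) (at x)"
  using has_derivative_transform_within_open[of f D x UNIV S g]
    has_derivative_transform_within_open[of g D x UNIV S f] assms by auto

lemma pd_cong_open:
  assumes "open S" "x \<in> S" "\<And>y. y \<in> S \<Longrightarrow> f y = g y"
  shows "pd v f x = pd v g x"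
  unfolding pd_def frechet_derivative_def using has_derivative_cong_open[OF assms] by simp

lemma differentiable_cong_open:
  assumes "open S" "x \<in> S" "\<And>y. y \<in> S \<Longrightarrow> f y = g y" "f differentiable (at x)"
  shows "g differentiable (at x)"
  using has_derivative_cong_open[of S x f g] assms unfolding differentiable_def by blast

lemma pd_const [simp]: "pd v (\<lambda>x. k) x = 0"
  by (rule pd_eqI[where f'="\<lambda>_. 0", simplified]) auto

lemma pd_add:
  assumes "f differentiable (at x)" "g differentiable (at x)"
  shows "pd v (\<lambda>x. f x + g x) x = pd v f x + pd v g x"
  by (rule pd_eqI) (intro has_derivative_add pd_has_derivative assms)

lemma pd_diff:
  assumes "f differentiable (at x)" "g differentiable (at x)"
  shows "pd v (\<lambda>x. f x - g x) x = pd v f x - pd v g x"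
  by (rule pd_eqI) (intro has_derivative_diff pd_has_derivative assms)

lemma pd_mult:
  assumes "f differentiable (at x)" "g differentiable (at x)"
  shows "pd v (\<lambda>x. f x * g x) x = pd v f x * g x + f x * pd v g x"
  using pd_eqI[OF has_derivative_mult[OF assms[THEN pd_has_derivative]]] by (simp add: add.commute)

lemma pd_cmult:
  assumes "f differentiable (at x)"
  shows "pd v (\<lambda>x. k * f x) x = k * pd v f x"
  using pd_mult[OF _ assms, of "\<lambda>_. k"] by simp

lemma pd_sum:
  assumes "\<And>i. i \<in> I \<Longrightarrow> f i differentiable (at x)"
  shows "pd v (\<lambda>x. \<Sum>i\<in>I. f i x) x = (\<Sum>i\<in>I. pd v (f i) x)"
  by (rule pd_eqI) (intro has_derivative_sum pd_has_derivative assms)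

lemma pd_inverse:
  assumes "f differentiable (at x)" "f x \<noteq> 0"
  shows "pd v (\<lambda>x. inverse (f x)) x = - (pd v f x * inverse (f x) * inverse (f x))"
  by (rule pd_eqI[OF has_derivative_eq_rhs[OF Deriv.has_derivative_inverse[OF assms(2) pd_has_derivative[OF assms(1)]]]])
     (auto simp: fun_eq_iff)

lemma pd_ln:
  assumes "f differentiable (at x)" "f x > 0"
  shows "pd v (\<lambda>x. ln (f x)) x = pd v f x * inverse (f x)"
  by (rule pd_eqI[OF has_derivative_eq_rhs[OF has_derivative_ln[OF assms(2) pd_has_derivative[OF assms(1)]]]])
     (auto simp: fun_eq_iff divide_inverse)

lemma linear_pd: "f differentiable (at x) \<Longrightarrow> linear (\<lambda>v. pd v f x)"
  by (rule has_derivative_linear[OF pd_has_derivative])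

lemma pd_zero_direction: "f differentiable (at x) \<Longrightarrow> pd 0 f x = 0"
  by (rule linear_0[OF linear_pd])

lemma pd_Basis_expansion:
  fixes x :: "'a::euclidean_space"
  assumes "f differentiable (at x)"
  shows "pd v f x = (\<Sum>b\<in>Basis. (v \<bullet> b) * pd b f x)"
proof -
  note lin = linear_pd[OF assms]
  have "pd v f x = pd (\<Sum>b\<in>Basis. (v \<bullet> b) *\<^sub>R b) f x" by (simp add: euclidean_representation)
  then show ?thesis by (simp add: linear_sum[OF lin] linear_cmul[OF lin])
qed

lemma pd_chain:
  assumes "(\<phi> has_derivative D) (at x)" "h differentiable (at (\<phi> x))"
  shows "pd v (\<lambda>x. h (\<phi> x)) x = pd (D v) h (\<phi> x)"
  using pd_eqI[OF has_derivative_compose[OF assms(1) pd_has_derivative[OF assms(2)]]] .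

lemma differentiable_chain:
  fixes h :: "'b::real_normed_vector \<Rightarrow> real"
  assumes "(\<phi> has_derivative D) (at x)" "h differentiable (at (\<phi> x))"
  shows "(\<lambda>x. h (\<phi> x)) differentiable (at x)"
  using has_derivative_compose[OF assms(1) pd_has_derivative[OF assms(2)]] unfolding differentiable_def by blast

lemma smooth_on_imp_differentiable:
  assumes "smooth_on S f" "open S" "x \<in> S"
  shows "f differentiable (at x)"
proof -
  have "pds [] f differentiable_on S" using assms(1) unfolding smooth_on_def by (metis empty_set empty_subsetI)
  then show ?thesis using assms(2,3) by (simp add: differentiable_on_eq_differentiable_at)
qed

lemma smooth_on_imp_continuous_on:
  assumes "smooth_on S f" "open S"
  shows "continuous_on S f"
  using assms by (simp add: continuous_at_imp_continuous_on differentiable_imp_continuous_within smooth_on_imp_differentiable)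

lemma smooth_on_pd:
  assumes "smooth_on S f" "b \<in> Basis"
  shows "smooth_on S (pd b f)"
  unfolding smooth_on_def
proof (intro allI impI)
  fix vs assume "set vs \<subseteq> (Basis::'a set)"
  then have "pds (vs @ [b]) f differentiable_on S"
    using assms unfolding smooth_on_def by (metis Un_least empty_set empty_subsetI insert_subset list.simps(15) set_append)
  moreover have "pds (vs @ [b]) f = pds vs (pd b f)" by (induction vs) auto
  ultimately show "pds vs (pd b f) differentiable_on S" by simp
qed

lemma smooth_on_subset: "smooth_on S f \<Longrightarrow> T \<subseteq> S \<Longrightarrow> smooth_on T f"
  using differentiable_on_subset unfolding smooth_on_def by blast

lemma smooth_on_coinduct [consumes 2, case_names differentiable pd]:
  assumes "open S" "P f"
    and diff: "\<And>f x. P f \<Longrightarrow> x \<in> S \<Longrightarrow> f differentiable (at x)"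
    and closed: "\<And>f b. P f \<Longrightarrow> b \<in> Basis \<Longrightarrow> \<exists>g. P g \<and> (\<forall>x\<in>S. pd b f x = g x)"
  shows "smooth_on S f"
  unfolding smooth_on_def
proof (intro allI impI)
  fix vs :: "'a list" assume vs: "set vs \<subseteq> Basis"
  have "\<exists>g. P g \<and> (\<forall>x\<in>S. pds vs f x = g x)" using vs
  proof (induction vs)
    case Nil
    then show ?case using \<open>P f\<close> by auto
  next
    case (Cons v vs)
    then obtain g where g: "P g" "\<forall>x\<in>S. pds vs f x = g x" by auto
    moreover obtain k where "P k" "\<forall>x\<in>S. pd v g x = k x" using closed[OF g(1), of v] Cons.prems by auto
    ultimately show ?case using pd_cong_open[OF \<open>open S\<close>, of _ "pds vs f" g v] by fastforce
  qed
  then obtain g where "P g" "\<forall>x\<in>S. pds vs f x = g x" by auto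
  then have "pds vs f differentiable (at x)" if "x \<in> S" for x
    using differentiable_cong_open[OF \<open>open S\<close> that, of g "pds vs f"] diff that by auto
  then show "pds vs f differentiable_on S" by (simp add: differentiable_on_eq_differentiable_at \<open>open S\<close>)
qed

lemma smooth_on_cong:
  assumes "open S" "smooth_on S f" "\<And>x. x \<in> S \<Longrightarrow> f x = g x"
  shows "smooth_on S g"
proof (rule smooth_on_coinduct[where P="\<lambda>g. \<exists>f. smooth_on S f \<and> (\<forall>x\<in>S. f x = g x)"])
  show "\<exists>f. smooth_on S f \<and> (\<forall>x\<in>S. f x = g x)" using assms by auto
next
  fix g x assume "\<exists>f. smooth_on S f \<and> (\<forall>x\<in>S. f x = g x)" "x \<in> S"
  then show "g differentiable (at x)"
    using differentiable_cong_open[OF assms(1)] smooth_on_imp_differentiable assms(1) by metis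
next
  fix g and b :: 'a assume "\<exists>f. smooth_on S f \<and> (\<forall>x\<in>S. f x = g x)" "b \<in> Basis"
  then show "\<exists>k. (\<exists>f. smooth_on S f \<and> (\<forall>x\<in>S. f x = k x)) \<and> (\<forall>x\<in>S. pd b g x = k x)"
    using pd_cong_open[OF assms(1)] smooth_on_pd by metis
qed fact

lemma smooth_onI_pd:
  assumes "open S" "\<And>x. x \<in> S \<Longrightarrow> f differentiable (at x)"
    and "\<And>b. b \<in> Basis \<Longrightarrow> smooth_on S (pd b f)"
  shows "smooth_on S f"
proof (rule smooth_on_coinduct[where P="\<lambda>h. h = f \<or> smooth_on S h"])
  show "h differentiable (at x)" if "h = f \<or> smooth_on S h" "x \<in> S" for h x
    using that assms smooth_on_imp_differentiable by blast
  show "\<exists>g. (g = f \<or> smooth_on S g) \<and> (\<forall>x\<in>S. pd b h x = g x)" if "h = f \<or> smooth_on S h" "b \<in> Basis" for h b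
    using that assms smooth_on_pd by blast
qed (use assms in auto)

lemma smooth_on_const: "open S \<Longrightarrow> smooth_on S (\<lambda>_. k)"
  by (rule smooth_on_coinduct[where P="\<lambda>f. \<exists>k. f = (\<lambda>_. k)"]) auto

lemma smooth_on_bounded_linear:
  assumes "open S" "bounded_linear f"
  shows "smooth_on S f"
proof (rule smooth_onI_pd[OF assms(1)])
  show "f differentiable (at x)" for x using bounded_linear_imp_differentiable[OF assms(2)] .
  have "pd b f = (\<lambda>_. f b)" for b
    using pd_eqI[OF bounded_linear_imp_has_derivative[OF assms(2)]] by blast
  then show "smooth_on S (pd b f)" for b using smooth_on_const[OF assms(1)] by simp
qed

lemma smooth_map_on_ident: "open S \<Longrightarrow> smooth_map_on S (\<lambda>x. x)"
  unfolding smooth_map_on_def by (simp add: smooth_on_bounded_linear bounded_linear_inner_left)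

lemma smooth_map_on_subset: "smooth_map_on S f \<Longrightarrow> T \<subseteq> S \<Longrightarrow> smooth_map_on T f"
  unfolding smooth_map_on_def using smooth_on_subset by blast

lemma smooth_map_on_has_derivative:
  assumes "smooth_map_on S \<phi>" "open S" "x \<in> S"
  shows "(\<phi> has_derivative (\<lambda>v. \<Sum>b\<in>Basis. pd v (\<lambda>x. \<phi> x \<bullet> b) x *\<^sub>R b)) (at x)"
proof (subst has_derivative_componentwise_within, intro ballI)
  fix b :: 'b assume b: "b \<in> Basis"
  have "((\<lambda>x. \<phi> x \<bullet> b) has_derivative (\<lambda>v. pd v (\<lambda>x. \<phi> x \<bullet> b) x)) (at x)"
    using assms b smooth_on_imp_differentiable[OF _ assms(2,3)]
    by (intro pd_has_derivative) (auto simp: smooth_map_on_def)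
  then show "((\<lambda>x. \<phi> x \<bullet> b) has_derivative (\<lambda>v. (\<Sum>b\<in>Basis. pd v (\<lambda>x. \<phi> x \<bullet> b) x *\<^sub>R b) \<bullet> b)) (at x)"
    using b by (simp add: inner_sum_left inner_Basis if_distrib sum.delta cong: if_cong)
qed

lemma smooth_map_on_imp_differentiable:
  "smooth_map_on S \<phi> \<Longrightarrow> open S \<Longrightarrow> x \<in> S \<Longrightarrow> \<phi> differentiable (at x)"
  using smooth_map_on_has_derivative unfolding differentiable_def by blast

lemma pd_compose_Basis:
  assumes "smooth_map_on S \<phi>" "open S" "x \<in> S" "h differentiable (at (\<phi> x))"
  shows "pd v (\<lambda>x. h (\<phi> x)) x = (\<Sum>b\<in>Basis. pd b h (\<phi> x) * pd v (\<lambda>x. \<phi> x \<bullet> b) x)"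
proof -
  let ?D = "\<lambda>v. \<Sum>b\<in>Basis. pd v (\<lambda>x. \<phi> x \<bullet> b) x *\<^sub>R b"
  have "pd v (\<lambda>x. h (\<phi> x)) x = pd (?D v) h (\<phi> x)"
    by (rule pd_chain[OF smooth_map_on_has_derivative[OF assms(1-3)] assms(4)])
  also have "\<dots> = (\<Sum>b\<in>Basis. (?D v \<bullet> b) * pd b h (\<phi> x))" by (rule pd_Basis_expansion[OF assms(4)])
  also have "\<dots> = (\<Sum>b\<in>Basis. pd b h (\<phi> x) * pd v (\<lambda>x. \<phi> x \<bullet> b) x)"
    by (intro sum.cong refl) (simp add: inner_sum_left inner_Basis if_distrib sum.delta cong: if_cong)
  finally show ?thesis .
qed

text \<open>Sums, products and composites of smooth functions are smooth because the algebra generated by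
  smooth functions and pullbacks of smooth functions is closed under partial derivatives.\<close>

inductive pullback_algebra :: "'a::euclidean_space set \<Rightarrow> 'b::euclidean_space set \<Rightarrow> ('a \<Rightarrow> 'b) \<Rightarrow> ('a \<Rightarrow> real) \<Rightarrow> bool"
  for S T \<phi> where
  smooth: "smooth_on S f \<Longrightarrow> pullback_algebra S T \<phi> f"
| pullback: "smooth_on T h \<Longrightarrow> pullback_algebra S T \<phi> (\<lambda>x. h (\<phi> x))"
| add: "pullback_algebra S T \<phi> f \<Longrightarrow> pullback_algebra S T \<phi> g \<Longrightarrow> pullback_algebra S T \<phi> (\<lambda>x. f x + g x)"
| mult: "pullback_algebra S T \<phi> f \<Longrightarrow> pullback_algebra S T \<phi> g \<Longrightarrow> pullback_algebra S T \<phi> (\<lambda>x. f x * g x)"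

lemma pullback_algebra_sum:
  assumes "open S" "\<And>i. i \<in> I \<Longrightarrow> pullback_algebra S T \<phi> (f i)"
  shows "pullback_algebra S T \<phi> (\<lambda>x. \<Sum>i\<in>I. f i x)"
  using assms
  by (induction I rule: infinite_finite_induct)
     (auto intro: pullback_algebra.add pullback_algebra.smooth smooth_on_const)

lemma pullback_algebra_pd:
  assumes S: "open S" and T: "open T" and \<phi>: "smooth_map_on S \<phi>" "\<phi> ` S \<subseteq> T"
    and "pullback_algebra S T \<phi> f"
  shows "(\<forall>x\<in>S. f differentiable (at x)) \<and> (\<forall>b\<in>Basis. \<exists>g. pullback_algebra S T \<phi> g \<and> (\<forall>x\<in>S. pd b f x = g x))"
  using assms(5)
proof (induction rule: pullback_algebra.induct)
  case (smooth f)
  then show ?case using smooth_on_imp_differentiable[OF _ S] smooth_on_pd pullback_algebra.smooth by blast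
next
  case (pullback h)
  have h: "h differentiable (at (\<phi> x))" if "x \<in> S" for x
    using smooth_on_imp_differentiable[OF pullback T] \<phi>(2) that by blast
  have "pullback_algebra S T \<phi> (\<lambda>x. \<Sum>c\<in>Basis. pd c h (\<phi> x) * pd b (\<lambda>x. \<phi> x \<bullet> c) x)" if "b \<in> Basis" for b
    using \<phi>(1) that pullback unfolding smooth_map_on_def
    by (intro pullback_algebra_sum S pullback_algebra.mult)
       (auto intro: pullback_algebra.smooth pullback_algebra.pullback smooth_on_pd)
  then show ?case
    using pd_compose_Basis[OF \<phi>(1) S] differentiable_chain[OF smooth_map_on_has_derivative[OF \<phi>(1) S]] h by blast
next
  case (add f g)
  show ?case
  proof (intro conjI ballI)
    fix b :: 'a assume "b \<in> Basis"
    then obtain f' g' where "pullback_algebra S T \<phi> f'" "\<forall>x\<in>S. pd b f x = f' x"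
      "pullback_algebra S T \<phi> g'" "\<forall>x\<in>S. pd b g x = g' x" using add.IH by metis
    then show "\<exists>h. pullback_algebra S T \<phi> h \<and> (\<forall>x\<in>S. pd b (\<lambda>x. f x + g x) x = h x)"
      using add.IH by (intro exI[of _ "\<lambda>x. f' x + g' x"]) (auto simp: pd_add intro: pullback_algebra.add)
  qed (use add.IH in auto)
next
  case (mult f g)
  show ?case
  proof (intro conjI ballI)
    fix b :: 'a assume "b \<in> Basis"
    then obtain f' g' where "pullback_algebra S T \<phi> f'" "\<forall>x\<in>S. pd b f x = f' x"
      "pullback_algebra S T \<phi> g'" "\<forall>x\<in>S. pd b g x = g' x" using mult.IH by metis
    then show "\<exists>h. pullback_algebra S T \<phi> h \<and> (\<forall>x\<in>S. pd b (\<lambda>x. f x * g x) x = h x)"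
      using mult.IH mult.hyps
      by (intro exI[of _ "\<lambda>x. f' x * g x + f x * g' x"])
         (auto simp: pd_mult intro!: pullback_algebra.add pullback_algebra.mult)
  qed (use mult.IH in auto)
qed

lemma smooth_on_pullback_algebra:
  assumes "open S" "open T" "smooth_map_on S \<phi>" "\<phi> ` S \<subseteq> T" "pullback_algebra S T \<phi> f"
  shows "smooth_on S f"
  by (rule smooth_on_coinduct[of S "pullback_algebra S T \<phi>"]) (use assms pullback_algebra_pd in blast)+

lemma smooth_on_compose:
  assumes "open S" "open T" "smooth_map_on S \<phi>" "\<And>x. x \<in> S \<Longrightarrow> \<phi> x \<in> T" "smooth_on T h"
  shows "smooth_on S (\<lambda>x. h (\<phi> x))"
  by (rule smooth_on_pullback_algebra[of S T \<phi>]) (use assms in \<open>auto intro: pullback_algebra.pullback\<close>)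

lemma smooth_on_add: "open S \<Longrightarrow> smooth_on S f \<Longrightarrow> smooth_on S g \<Longrightarrow> smooth_on S (\<lambda>x. f x + g x)"
  by (rule smooth_on_pullback_algebra[of S S "\<lambda>x. x"])
     (auto intro: pullback_algebra.intros smooth_map_on_ident)

lemma smooth_on_mult: "open S \<Longrightarrow> smooth_on S f \<Longrightarrow> smooth_on S g \<Longrightarrow> smooth_on S (\<lambda>x. f x * g x)"
  by (rule smooth_on_pullback_algebra[of S S "\<lambda>x. x"])
     (auto intro: pullback_algebra.intros smooth_map_on_ident)

lemma smooth_on_cmult: "open S \<Longrightarrow> smooth_on S f \<Longrightarrow> smooth_on S (\<lambda>x. k * f x)"
  by (intro smooth_on_mult smooth_on_const)

lemma smooth_on_diff: "open S \<Longrightarrow> smooth_on S f \<Longrightarrow> smooth_on S g \<Longrightarrow> smooth_on S (\<lambda>x. f x - g x)"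
  using smooth_on_add[of S f "\<lambda>x. (-1) * g x"] smooth_on_cmult[of S g "-1"] by simp

lemma smooth_on_sum:
  assumes "open S" "\<And>i. i \<in> I \<Longrightarrow> smooth_on S (f i)"
  shows "smooth_on S (\<lambda>x. \<Sum>i\<in>I. f i x)"
  using assms by (induction I rule: infinite_finite_induct) (auto intro: smooth_on_add smooth_on_const)

lemma smooth_on_prod:
  assumes "open S" "\<And>i. i \<in> I \<Longrightarrow> smooth_on S (f i)"
  shows "smooth_on S (\<lambda>x. \<Prod>i\<in>I. f i x)"
  using assms by (induction I rule: infinite_finite_induct) (auto intro: smooth_on_mult smooth_on_const)

lemma smooth_on_power: "open S \<Longrightarrow> smooth_on S f \<Longrightarrow> smooth_on S (\<lambda>x. f x ^ k)"
  by (induction k) (auto intro: smooth_on_mult smooth_on_const)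

lemma smooth_map_on_real_iff: "smooth_map_on S f \<longleftrightarrow> smooth_on S (f :: 'a::euclidean_space \<Rightarrow> real)"
  by (simp add: smooth_map_on_def)

lemma smooth_on_inverse_real: "smooth_on {t::real. t \<noteq> 0} inverse"
proof (rule smooth_on_coinduct[where P="\<lambda>f. \<exists>c n. f = (\<lambda>t. c * inverse t ^ n)"])
  show "open {t::real. t \<noteq> 0}" by (simp add: open_Collect_neq)
  show "\<exists>c n. inverse = (\<lambda>t::real. c * inverse t ^ n)" by (intro exI[of _ 1]) simp
next
  fix f :: "real \<Rightarrow> real" and t :: real assume "\<exists>c n. f = (\<lambda>t. c * inverse t ^ n)" "t \<in> {t. t \<noteq> 0}"
  then show "f differentiable (at t)" by auto
next
  fix f :: "real \<Rightarrow> real" and b :: real assume "\<exists>c n. f = (\<lambda>t. c * inverse t ^ n)" and b: "b \<in> Basis"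
  then obtain c n where f: "f = (\<lambda>t. c * inverse t ^ n)" by blast
  have "pd b f t = - (c * real n) * inverse t ^ (Suc n)" if "t \<noteq> 0" for t
  proof -
    have "(f has_derivative (\<lambda>s. - (c * real n) * inverse t ^ (Suc n) * s)) (at t)"
      unfolding f using that
      by (auto intro!: derivative_eq_intros simp: fun_eq_iff) (cases n; simp add: field_simps)
    then show ?thesis using b pd_eqI by fastforce
  qed
  then show "\<exists>g. (\<exists>c n. g = (\<lambda>t. c * inverse t ^ n)) \<and> (\<forall>t\<in>{t. t \<noteq> 0}. pd b f t = g t)"
    by (intro exI[of _ "\<lambda>t. - (c * real n) * inverse t ^ (Suc n)"]) blast
qed

lemma smooth_on_inverse:
  assumes "open S" "smooth_on S f" "\<And>x. x \<in> S \<Longrightarrow> f x \<noteq> 0"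
  shows "smooth_on S (\<lambda>x. inverse (f x))"
  by (rule smooth_on_compose[OF assms(1) _ _ _ smooth_on_inverse_real])
     (use assms in \<open>auto simp: smooth_map_on_real_iff open_Collect_neq\<close>)

lemma smooth_on_divide:
  "open S \<Longrightarrow> smooth_on S f \<Longrightarrow> smooth_on S g \<Longrightarrow> (\<And>x. x \<in> S \<Longrightarrow> g x \<noteq> 0) \<Longrightarrow> smooth_on S (\<lambda>x. f x / g x)"
  unfolding divide_inverse by (intro smooth_on_mult smooth_on_inverse)

lemma smooth_on_ln_real: "smooth_on {0::real<..} ln"
proof (rule smooth_onI_pd)
  show ln: "ln differentiable (at t)" if "t \<in> {0::real<..}" for t
    using that by (auto intro!: derivative_intros simp: differentiable_def intro: has_derivative_ln[OF _ has_derivative_ident])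
  fix b :: real assume b: "b \<in> Basis"
  have "smooth_on {0<..} (inverse :: real \<Rightarrow> real)" by (rule smooth_on_subset[OF smooth_on_inverse_real]) auto
  then show "smooth_on {0<..} (pd b ln)"
  proof (rule smooth_on_cong[rotated])
    show "inverse t = pd b ln t" if "t \<in> {0<..}" for t
      using pd_ln[of "\<lambda>t. t" t b] pd_eqI[OF has_derivative_ident, of b t] that b by simp
  qed simp
qed simp

lemma smooth_on_ln:
  assumes "open S" "smooth_on S f" "\<And>x. x \<in> S \<Longrightarrow> f x > 0"
  shows "smooth_on S (\<lambda>x. ln (f x))"
  by (rule smooth_on_compose[OF assms(1) open_greaterThan _ _ smooth_on_ln_real])
     (use assms in \<open>auto simp: smooth_map_on_real_iff\<close>)

lemma smooth_map_on_compose: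
  assumes "open S" "open T" "smooth_map_on S \<phi>" "\<And>x. x \<in> S \<Longrightarrow> \<phi> x \<in> T" "smooth_map_on T h"
  shows "smooth_map_on S (\<lambda>x. h (\<phi> x))"
  using smooth_on_compose[OF assms(1-4)] assms(5) unfolding smooth_map_on_def by blast

lemma smooth_map_on_cong:
  assumes "open S" "smooth_map_on S f" "\<And>x. x \<in> S \<Longrightarrow> f x = g x"
  shows "smooth_map_on S g"
  using smooth_on_cong[OF assms(1)] assms unfolding smooth_map_on_def by (metis (no_types, lifting))

lemma smooth_on_compose_if_derivative_of_value:
  fixes \<phi> :: "'a::euclidean_space \<Rightarrow> 'b::euclidean_space"
  assumes S: "open S" and T: "open T" and \<phi>T: "\<And>x. x \<in> S \<Longrightarrow> \<phi> x \<in> T"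
    and \<phi>: "\<And>x. x \<in> S \<Longrightarrow> (\<phi> has_derivative (\<lambda>v. A v (\<phi> x))) (at x)"
    and A: "\<And>b c. b \<in> Basis \<Longrightarrow> c \<in> Basis \<Longrightarrow> smooth_on T (\<lambda>y. A b y \<bullet> c)"
    and h: "smooth_on T h"
  shows "smooth_on S (\<lambda>x. h (\<phi> x))"
proof (rule smooth_on_coinduct[OF S, where P="\<lambda>f. \<exists>h. smooth_on T h \<and> f = (\<lambda>x. h (\<phi> x))"])
  fix f x assume "\<exists>h. smooth_on T h \<and> f = (\<lambda>x. h (\<phi> x))" "x \<in> S"
  then show "f differentiable (at x)"
    using differentiable_chain[OF \<phi>] smooth_on_imp_differentiable[OF _ T \<phi>T] by blast
next
  fix f and b :: 'a assume "\<exists>h. smooth_on T h \<and> f = (\<lambda>x. h (\<phi> x))" and b: "b \<in> Basis"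
  then obtain h where h: "smooth_on T h" "f = (\<lambda>x. h (\<phi> x))" by blast
  define k where "k y = (\<Sum>c\<in>Basis. (A b y \<bullet> c) * pd c h y)" for y
  have "smooth_on T k"
    unfolding k_def by (intro smooth_on_sum smooth_on_mult T A b smooth_on_pd[OF h(1)])
  moreover have "pd b f x = k (\<phi> x)" if "x \<in> S" for x
    unfolding h(2) pd_chain[OF \<phi>[OF that] smooth_on_imp_differentiable[OF h(1) T \<phi>T[OF that]]] k_def
    by (rule pd_Basis_expansion[OF smooth_on_imp_differentiable[OF h(1) T \<phi>T[OF that]]])
  ultimately show "\<exists>g. (\<exists>h. smooth_on T h \<and> g = (\<lambda>x. h (\<phi> x))) \<and> (\<forall>x\<in>S. pd b f x = g x)" by blast
qed (use h in blast)

lemma pd_mvt: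
  assumes "0 < h" "\<And>s. 0 \<le> s \<Longrightarrow> s \<le> h \<Longrightarrow> f differentiable (at (x + s *\<^sub>R u))"
  obtains s where "0 < s" "s < h" "f (x + h *\<^sub>R u) - f x = h * pd u f (x + s *\<^sub>R u)"
proof -
  have "((\<lambda>s. f (x + s *\<^sub>R u)) has_derivative (\<lambda>r. r * pd u f (x + s *\<^sub>R u))) (at s)"
    if "0 \<le> s" "s \<le> h" for s
  proof -
    have "((\<lambda>s. x + s *\<^sub>R u) has_derivative (\<lambda>r. r *\<^sub>R u)) (at s)" by (auto intro!: derivative_eq_intros)
    from has_derivative_compose[OF this pd_has_derivative[OF assms(2)[OF that]]] show ?thesis
      by (rule has_derivative_eq_rhs) (simp add: linear_cmul[OF linear_pd[OF assms(2)[OF that]]])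
  qed
  then have "\<exists>s\<in>{0<..<h}. f (x + h *\<^sub>R u) - f (x + 0 *\<^sub>R u) = (h - 0) * pd u f (x + s *\<^sub>R u)"
    by (intro mvt_simple assms(1)) (auto intro: has_derivative_at_withinI)
  then show ?thesis using that by auto
qed

lemma mixed_difference_mvt:
  fixes f :: "'a::euclidean_space \<Rightarrow> real"
  assumes S: "open S" "smooth_on S f" and u: "u \<in> Basis" and v: "v \<in> Basis"
    and ball: "ball x d \<subseteq> S" and h: "0 < h" "2 * h < d"
  shows "\<exists>y\<in>ball x d. f (x + h *\<^sub>R u + h *\<^sub>R v) - f (x + h *\<^sub>R u) - f (x + h *\<^sub>R v) + f x = h * h * pd v (pd u f) y"
proof -
  have in_ball: "x + s *\<^sub>R u + t *\<^sub>R v \<in> ball x d" if "0 \<le> s" "s \<le> h" "0 \<le> t" "t \<le> h" for s t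
  proof -
    have "norm (s *\<^sub>R u + t *\<^sub>R v) \<le> s + t"
      using norm_triangle_ineq[of "s *\<^sub>R u" "t *\<^sub>R v"] that u v by simp
    moreover have "dist x (x + s *\<^sub>R u + t *\<^sub>R v) = norm (s *\<^sub>R u + t *\<^sub>R v)"
      by (subst dist_commute) (simp add: dist_norm add.assoc)
    ultimately show ?thesis using that h(2) by simp
  qed
  have diff_f: "f differentiable (at (x + s *\<^sub>R u + t *\<^sub>R v))"
    and diff_pd: "pd u f differentiable (at (x + s *\<^sub>R u + t *\<^sub>R v))" if "0 \<le> s" "s \<le> h" "0 \<le> t" "t \<le> h" for s t
    using smooth_on_imp_differentiable[OF _ S(1)] smooth_on_pd[OF S(2) u] S(2) in_ball[OF that] ball by blast+
  have shift: "((\<lambda>x. x + h *\<^sub>R v) has_derivative (\<lambda>w. w)) (at y)" for y by (auto intro!: derivative_eq_intros)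
  have d: "(\<lambda>x. f (x + h *\<^sub>R v)) differentiable (at (x + s *\<^sub>R u))" "f differentiable (at (x + s *\<^sub>R u))"
    if "0 \<le> s" "s \<le> h" for s
    using differentiable_chain[OF shift, of f] diff_f[OF that, of h] diff_f[OF that, of 0] h(1) by auto
  obtain s where s: "0 < s" "s < h" "(f (x + h *\<^sub>R u + h *\<^sub>R v) - f (x + h *\<^sub>R u)) - (f (x + h *\<^sub>R v) - f x)
      = h * pd u (\<lambda>x. f (x + h *\<^sub>R v) - f x) (x + s *\<^sub>R u)"
    by (rule pd_mvt[OF h(1), of "\<lambda>x. f (x + h *\<^sub>R v) - f x" x u]) (auto intro: differentiable_diff d)
  then have "pd u (\<lambda>x. f (x + h *\<^sub>R v) - f x) (x + s *\<^sub>R u) = pd u f (x + s *\<^sub>R u + h *\<^sub>R v) - pd u f (x + s *\<^sub>R u)"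
    using d pd_chain[OF shift, of f "x + s *\<^sub>R u" u] diff_f[of s h] h(1) by (simp add: pd_diff)
  moreover obtain t where "0 < t" "t < h"
    "pd u f (x + s *\<^sub>R u + h *\<^sub>R v) - pd u f (x + s *\<^sub>R u) = h * pd v (pd u f) (x + s *\<^sub>R u + t *\<^sub>R v)"
    by (rule pd_mvt[OF h(1), of "pd u f" "x + s *\<^sub>R u" v]) (use diff_pd s in auto)
  ultimately show ?thesis using s in_ball[of s t] by (intro bexI[of _ "x + s *\<^sub>R u + t *\<^sub>R v"]) auto
qed

lemma pd_commute:
  fixes f :: "'a::euclidean_space \<Rightarrow> real"
  assumes S: "open S" "smooth_on S f" "x \<in> S" and u: "u \<in> Basis" and v: "v \<in> Basis"
  shows "pd u (pd v f) x = pd v (pd u f) x"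
proof (rule ccontr)
  assume "pd u (pd v f) x \<noteq> pd v (pd u f) x"
  then have pos: "0 < \<bar>pd u (pd v f) x - pd v (pd u f) x\<bar> / 2" (is "0 < ?\<epsilon>") by simp
  have "\<forall>\<^sub>F y in nhds x. dist (pd a (pd b f) y) (pd a (pd b f) x) < ?\<epsilon>" if "a \<in> Basis" "b \<in> Basis" for a b
  proof -
    have "isCont (pd a (pd b f)) x"
      using smooth_on_imp_differentiable[OF smooth_on_pd[OF smooth_on_pd] S(1,3)] S(2) that
        differentiable_imp_continuous_within by blast
    then show ?thesis unfolding isCont_def tendsto_at_iff_tendsto_nhds by (rule tendstoD[OF _ pos])
  qed
  then have "\<forall>\<^sub>F y in nhds x. dist (pd u (pd v f) y) (pd u (pd v f) x) < ?\<epsilon> \<and> dist (pd v (pd u f) y) (pd v (pd u f) x) < ?\<epsilon> \<and> y \<in> S"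
    using S u v by (intro eventually_conj eventually_nhds_in_open)
  then obtain d where "d > 0" and d: "\<And>y. dist y x < d \<Longrightarrow> dist (pd u (pd v f) y) (pd u (pd v f) x) < ?\<epsilon>"
    "\<And>y. dist y x < d \<Longrightarrow> dist (pd v (pd u f) y) (pd v (pd u f) x) < ?\<epsilon>" "\<And>y. dist y x < d \<Longrightarrow> y \<in> S"
    unfolding eventually_nhds_metric by metis
  have ball: "ball x d \<subseteq> S" using d(3) by (auto simp: dist_commute)
  define h where "h = d / 3"
  have h: "0 < h" "2 * h < d" using \<open>d > 0\<close> by (auto simp: h_def)
  obtain y where y: "y \<in> ball x d"
    "f (x + h *\<^sub>R u + h *\<^sub>R v) - f (x + h *\<^sub>R u) - f (x + h *\<^sub>R v) + f x = h * h * pd v (pd u f) y"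
    using mixed_difference_mvt[OF S(1,2) u v ball h] by blast
  obtain y' where y': "y' \<in> ball x d"
    "f (x + h *\<^sub>R v + h *\<^sub>R u) - f (x + h *\<^sub>R v) - f (x + h *\<^sub>R u) + f x = h * h * pd u (pd v f) y'"
    using mixed_difference_mvt[OF S(1,2) v u ball h] by blast
  have "f (x + h *\<^sub>R v + h *\<^sub>R u) = f (x + h *\<^sub>R u + h *\<^sub>R v)" by (simp add: ac_simps)
  then have "h * h * pd v (pd u f) y = h * h * pd u (pd v f) y'" using y(2) y'(2) by linarith
  then have "pd v (pd u f) y = pd u (pd v f) y'" using h by simp
  moreover have "\<bar>pd u (pd v f) y' - pd u (pd v f) x\<bar> < ?\<epsilon>" "\<bar>pd v (pd u f) y - pd v (pd u f) x\<bar> < ?\<epsilon>"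
    using d(1)[of y'] d(2)[of y] y(1) y'(1) by (simp_all add: dist_commute[of x] dist_real_def)
  ultimately show False by argo
qed

lemma pd_pd_vector_field:
  fixes f :: "'a::euclidean_space \<Rightarrow> real"
  assumes S: "open S" "smooth_on S f" "x \<in> S" and b: "b \<in> Basis" and V: "(V has_derivative V') (at x)"
  shows "pd b (\<lambda>x. pd (V x) f x) x = pd (V x) (pd b f) x + pd (V' b) f x"
proof -
  note f = smooth_on_imp_differentiable[OF S(2,1)]
  note pd_f = smooth_on_imp_differentiable[OF smooth_on_pd[OF S(2)] S(1,3)]
  have V_c: "((\<lambda>x. V x \<bullet> c) has_derivative (\<lambda>v. V' v \<bullet> c)) (at x)" for c
    by (rule has_derivative_inner_left[OF V])
  then have diff_V: "(\<lambda>x. V x \<bullet> c) differentiable (at x)" for c unfolding differentiable_def by blast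
  have "pd b (\<lambda>x. pd (V x) f x) x = pd b (\<lambda>x. \<Sum>c\<in>Basis. (V x \<bullet> c) * pd c f x) x"
    by (rule pd_cong_open[OF S(1,3) pd_Basis_expansion[OF f]])
  also have "\<dots> = (\<Sum>c\<in>Basis. pd b (\<lambda>x. (V x \<bullet> c) * pd c f x) x)"
    by (rule pd_sum) (intro differentiable_mult diff_V pd_f)
  also have "\<dots> = (\<Sum>c\<in>Basis. (V' b \<bullet> c) * pd c f x + (V x \<bullet> c) * pd c (pd b f) x)"
    using pd_eqI[OF V_c] by (intro sum.cong refl) (simp add: pd_mult diff_V pd_f pd_commute[OF S b])
  also have "\<dots> = pd (V x) (pd b f) x + pd (V' b) f x"
    unfolding sum.distrib using pd_Basis_expansion[OF f[OF S(3)], of "V' b"] pd_Basis_expansion[OF pd_f[OF b], of "V x"]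
    by simp
  finally show ?thesis .
qed

section \<open>Matrices\<close>

lemma
  fixes A :: "real^'n^'n"
  assumes "invertible A"
  shows matrix_inv_right: "A ** matrix_inv A = mat 1" and matrix_inv_left: "matrix_inv A ** A = mat 1"
  using someI_ex[of "\<lambda>B. A ** B = mat 1 \<and> B ** A = mat 1"] assms
  unfolding matrix_inv_def invertible_def by auto

lemma matrix_add_rdistrib:
  fixes A B :: "real^'n^'m"
  shows "(A + B) ** C = A ** C + B ** C"
  by (simp add: matrix_matrix_mult_def vec_eq_iff distrib_right sum.distrib)

lemma matrix_inv_unique:
  fixes A :: "real^'n^'n"
  assumes "A ** B = mat 1"
  shows "matrix_inv A = B"
proof -
  have "invertible A" using assms invertible_right_inverse by blast
  then have "matrix_inv A ** (A ** B) = B" by (simp add: matrix_mul_assoc matrix_inv_left)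
  then show ?thesis by (simp add: assms)
qed

lemma matrix_inv_vector_mult [simp]:
  fixes A :: "real^'n^'n"
  assumes "invertible A"
  shows "matrix_inv A *v (A *v x) = x" and "A *v (matrix_inv A *v x) = x"
  using assms by (simp_all add: matrix_vector_mul_assoc matrix_inv_left matrix_inv_right)

lemma matrix_inv_transpose:
  fixes A :: "real^'n^'n"
  assumes "invertible A"
  shows "matrix_inv (transpose A) = transpose (matrix_inv A)"
  by (rule matrix_inv_unique) (simp add: matrix_inv_left assms transpose_mat flip: matrix_transpose_mul)

lemma inner_matrix_inv_congruence:
  fixes B G :: "real^'n^'n"
  assumes "invertible B" "invertible G"
  shows "(transpose B *v a) \<bullet> (matrix_inv (transpose B ** G ** B) *v (transpose B *v b)) = a \<bullet> (matrix_inv G *v b)"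
proof -
  have "(transpose B ** G ** B) ** (matrix_inv B ** matrix_inv G ** transpose (matrix_inv B))
      = transpose B ** (G ** ((B ** matrix_inv B) ** matrix_inv G)) ** transpose (matrix_inv B)"
    by (simp only: matrix_mul_assoc)
  also have "\<dots> = transpose (matrix_inv B ** B)"
    by (simp add: matrix_inv_right assms matrix_transpose_mul)
  also have "\<dots> = mat 1" by (simp add: matrix_inv_left assms transpose_mat)
  finally have "matrix_inv (transpose B ** G ** B) = matrix_inv B ** matrix_inv G ** transpose (matrix_inv B)"
    by (rule matrix_inv_unique)
  then have "matrix_inv (transpose B ** G ** B) *v (transpose B *v b)
      = matrix_inv B *v (matrix_inv G *v (transpose (B ** matrix_inv B) *v b))"
    by (simp only: matrix_vector_mul_assoc matrix_transpose_mul matrix_mul_assoc)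
  also have "\<dots> = matrix_inv B *v (matrix_inv G *v b)"
    by (simp add: matrix_inv_right assms transpose_mat)
  finally show ?thesis by (simp add: dot_lmul_matrix assms)
qed

lemma invertible_if_kernel_trivial:
  fixes A :: "real^'n^'n"
  assumes "\<And>v. A *v v = 0 \<Longrightarrow> v = 0"
  shows "invertible A"
  unfolding invertible_left_inverse matrix_left_invertible_ker using assms by blast

lemma invertible_if_posdef:
  fixes A :: "real^'n^'n"
  assumes "\<And>v. v \<noteq> 0 \<Longrightarrow> v \<bullet> (A *v v) > 0"
  shows "invertible A"
  using assms by (intro invertible_if_kernel_trivial) force

lemma posdef_matrix_inv:
  fixes A :: "real^'n^'n"
  assumes posdef: "\<And>v. v \<noteq> 0 \<Longrightarrow> v \<bullet> (A *v v) > 0" and v: "v \<noteq> 0"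
  shows "v \<bullet> (matrix_inv A *v v) > 0"
proof -
  have v_eq: "A *v (matrix_inv A *v v) = v" by (simp add: invertible_if_posdef posdef)
  then have "matrix_inv A *v v \<noteq> 0" using v by force
  from posdef[OF this] show ?thesis by (simp add: v_eq inner_commute)
qed

lemma matrix_inv_cramer:
  fixes A :: "real^'n^'n"
  assumes "det A \<noteq> 0"
  shows "matrix_inv A $ i $ j = det (\<chi> k l. if l = i then (if k = j then 1 else 0) else A $ k $ l) / det A"
proof -
  have inv: "invertible A" using assms invertible_det_nz by blast
  have "A *v (\<chi> l. matrix_inv A $ l $ j) = (\<chi> k. if k = j then 1 else 0)"
    using arg_cong[OF matrix_inv_right[OF inv], of "\<lambda>B. \<chi> k. B $ k $ j"]
    by (simp add: matrix_vector_mult_def matrix_matrix_mult_def mat_def)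
  then have "(\<chi> l. matrix_inv A $ l $ j) = (\<chi> k. det (\<chi> i l. if l = k then (\<chi> k. if k = j then 1 else 0) $ i else A $ i $ l) / det A)"
    by (simp only: cramer[OF assms])
  from arg_cong[OF this, of "\<lambda>v. v $ i"] show ?thesis by (simp add: if_distrib cong: if_cong)
qed

lemma det_replace_row:
  fixes A :: "real^'n^'n"
  assumes "invertible A"
  shows "det (\<chi> k. if k = i then r else A $ k) = (\<Sum>j\<in>UNIV. r $ j * matrix_inv A $ j $ i) * det A"
proof -
  define c where "c = r v* matrix_inv A"
  have "r = c v* A" by (simp add: c_def vector_matrix_mul_assoc matrix_inv_left assms)
  also have "\<dots> = (\<Sum>i\<in>UNIV. c $ i *s row i A)"
    by (simp add: vec_eq_iff vector_matrix_mult_def row_def mult.commute)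
  finally have "(\<chi> k. if k = i then r else A $ k) = (\<chi> k. if k = i then (\<Sum>i\<in>UNIV. c $ i *s row i A) else row k A)"
    by (simp add: vec_eq_iff row_def)
  then have "det (\<chi> k. if k = i then r else A $ k) = c $ i * det A"
    by (simp only: cramer_lemma_transpose)
  then show ?thesis by (simp add: c_def vector_matrix_mult_def mult.commute)
qed

definition posdef_on :: "'i set \<Rightarrow> ('i \<Rightarrow> 'i \<Rightarrow> real) \<Rightarrow> bool" where
  "posdef_on S K \<longleftrightarrow> (\<forall>i j. K i j = K j i) \<and>
     (\<forall>x. (\<exists>i\<in>S. x i \<noteq> 0) \<longrightarrow> (\<Sum>i\<in>S. \<Sum>j\<in>S. K i j * x i * x j) > 0)"

lemma quadratic_form_insert:
  fixes K :: "'i \<Rightarrow> 'i \<Rightarrow> real"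
  assumes "finite S" "s \<notin> S" "\<And>i j. K i j = K j i"
  shows "(\<Sum>i\<in>insert s S. \<Sum>j\<in>insert s S. K i j * x i * x j)
    = K s s * x s * x s + 2 * x s * (\<Sum>j\<in>S. K s j * x j) + (\<Sum>i\<in>S. \<Sum>j\<in>S. K i j * x i * x j)"
proof -
  have "(\<Sum>i\<in>S. K i s * x i * x s) = x s * (\<Sum>j\<in>S. K s j * x j)"
    unfolding sum_distrib_left by (intro sum.cong refl) (simp add: assms(3)[of _ s] mult_ac)
  moreover have "(\<Sum>j\<in>S. K s j * x s * x j) = x s * (\<Sum>j\<in>S. K s j * x j)"
    unfolding sum_distrib_left by (intro sum.cong refl) (simp add: mult_ac)
  ultimately show ?thesis using assms(1,2) by (simp add: sum.distrib)
qed

lemma posdef_on_insertD: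
  assumes "finite S" "s \<notin> S" and K: "posdef_on (insert s S) K"
  shows "K s s > 0" and "posdef_on S (\<lambda>i j. K i j - K s i * K s j / K s s)"
proof -
  have sym: "K i j = K j i" for i j using K by (auto simp: posdef_on_def)
  have pos: "0 < K s s * x s * x s + 2 * x s * (\<Sum>j\<in>S. K s j * x j) + (\<Sum>i\<in>S. \<Sum>j\<in>S. K i j * x i * x j)"
    if "\<exists>i\<in>insert s S. x i \<noteq> 0" for x
    using K that unfolding posdef_on_def quadratic_form_insert[OF assms(1,2) sym] by blast
  have "(\<Sum>j\<in>S. K s j * (if j = s then 1 else 0)) = 0"
    "(\<Sum>i\<in>S. \<Sum>j\<in>S. K i j * (if i = s then 1 else 0) * (if j = s then 1 else 0)) = 0"
    using assms(2) by (auto intro!: sum.neutral)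
  then show Kss: "K s s > 0" using pos[of "\<lambda>i. if i = s then 1 else 0"] by auto
  have "(\<Sum>i\<in>S. \<Sum>j\<in>S. (K i j - K s i * K s j / K s s) * x i * x j) > 0" if x: "\<exists>i\<in>S. x i \<noteq> 0" for x
  proof -
    define B where "B = (\<Sum>j\<in>S. K s j * x j)"
    define x' where "x' = x(s := - B / K s s)"
    have x'_S: "(\<Sum>j\<in>S. K s j * x' j) = B" "(\<Sum>i\<in>S. \<Sum>j\<in>S. K i j * x' i * x' j) = (\<Sum>i\<in>S. \<Sum>j\<in>S. K i j * x i * x j)"
      unfolding B_def x'_def using assms(2) by (auto intro!: sum.cong)
    have "\<exists>i\<in>insert s S. x' i \<noteq> 0" using x assms(2) by (auto simp: x'_def)
    from pos[OF this] have "0 < K s s * x' s * x' s + 2 * x' s * B + (\<Sum>i\<in>S. \<Sum>j\<in>S. K i j * x i * x j)"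
      unfolding x'_S .
    also have "\<dots> = (\<Sum>i\<in>S. \<Sum>j\<in>S. K i j * x i * x j) - B * B / K s s"
      using Kss by (simp add: x'_def field_simps)
    also have "B * B / K s s = (\<Sum>i\<in>S. \<Sum>j\<in>S. K s i * K s j / K s s * x i * x j)"
      unfolding B_def sum_product sum_divide_distrib by (intro sum.cong refl) (simp add: field_simps)
    finally show ?thesis by (simp add: left_diff_distrib sum_subtractf)
  qed
  then show "posdef_on S (\<lambda>i j. K i j - K s i * K s j / K s s)"
    unfolding posdef_on_def using sym by (simp add: mult.commute)
qed

lemma cholesky_decomposition:
  assumes "finite S" "posdef_on S K"
  shows "\<exists>p. \<forall>i\<in>S. \<forall>j\<in>S. K i j = (\<Sum>m\<in>S. p m i * p m j)"
  using assms
proof (induction S arbitrary: K rule: finite_induct)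
  case empty
  then show ?case by simp
next
  case (insert s S)
  note Kss = posdef_on_insertD(1)[OF insert.hyps insert.prems]
  have sym: "K i j = K j i" for i j using insert.prems by (auto simp: posdef_on_def)
  obtain p where p: "\<forall>i\<in>S. \<forall>j\<in>S. K i j - K s i * K s j / K s s = (\<Sum>m\<in>S. p m i * p m j)"
    using insert.IH[OF posdef_on_insertD(2)[OF insert.hyps insert.prems]] by blast
  define q where "q = (\<lambda>m i. if m = s then K s i / sqrt (K s s) else if i = s then 0 else p m i)"
  have "K i j = (\<Sum>m\<in>insert s S. q m i * q m j)" if "i \<in> insert s S" "j \<in> insert s S" for i j
  proof -
    have "K s i / sqrt (K s s) * (K s j / sqrt (K s s)) = K s i * K s j / K s s"
      using Kss by (simp add: field_simps)
    then have "(\<Sum>m\<in>insert s S. q m i * q m j) = K s i * K s j / K s s + (\<Sum>m\<in>S. q m i * q m j)"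
      using insert.hyps by (simp add: q_def)
    moreover have "(\<Sum>m\<in>S. q m i * q m j) = (if i = s \<or> j = s then 0 else \<Sum>m\<in>S. p m i * p m j)"
      using insert.hyps by (auto simp: q_def intro!: sum.cong sum.neutral)
    ultimately have q_sum: "(\<Sum>m\<in>insert s S. q m i * q m j)
        = K s i * K s j / K s s + (if i = s \<or> j = s then 0 else \<Sum>m\<in>S. p m i * p m j)" by simp
    consider "i = s" | "j = s" | "i \<in> S" "j \<in> S" "i \<noteq> s" "j \<noteq> s" using \<open>i \<in> insert s S\<close> \<open>j \<in> insert s S\<close> by blast
    then show ?thesis
      unfolding q_sum
    proof cases
      case 3
      then have "K i j - K s i * K s j / K s s = (\<Sum>m\<in>S. p m i * p m j)" using p by blast
      then show "K i j = K s i * K s j / K s s + (if i = s \<or> j = s then 0 else \<Sum>m\<in>S. p m i * p m j)"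
        using 3(3,4) by simp
    qed (use Kss sym[of i s] in simp_all)
  qed
  then show ?case by blast
qed

lemma posdef_matrix_factorization:
  fixes H :: "real^'n^'n"
  assumes "transpose H = H" "\<And>v. v \<noteq> 0 \<Longrightarrow> v \<bullet> (H *v v) > 0"
  obtains P :: "real^'n^'n" where "H = transpose P ** P"
proof -
  have "posdef_on UNIV (\<lambda>i j. H $ i $ j)"
    unfolding posdef_on_def
  proof (intro conjI allI impI)
    show "H $ i $ j = H $ j $ i" for i j
      using arg_cong[OF assms(1), of "\<lambda>B. B $ j $ i"] by (simp add: transpose_def)
    fix x :: "'n \<Rightarrow> real" assume "\<exists>i\<in>UNIV. x i \<noteq> 0"
    then have "(\<chi> i. x i) \<noteq> 0" by (auto simp: vec_eq_iff)
    from assms(2)[OF this] show "(\<Sum>i\<in>UNIV. \<Sum>j\<in>UNIV. H $ i $ j * x i * x j) > 0"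
      by (simp add: inner_vec_def matrix_vector_mult_def sum_distrib_left mult_ac)
  qed
  then obtain p :: "'n \<Rightarrow> 'n \<Rightarrow> real" where "\<And>i j. H $ i $ j = (\<Sum>m\<in>UNIV. p m i * p m j)"
    using cholesky_decomposition[of UNIV "\<lambda>i j. H $ i $ j"] by auto
  then have "H = transpose (\<chi> m i. p m i) ** (\<chi> m i. p m i)"
    by (simp add: vec_eq_iff matrix_matrix_mult_def transpose_def)
  then show ?thesis by (rule that)
qed

lemma trace_transpose: "trace (transpose A) = trace A"
  by (simp add: trace_def transpose_def)

lemma trace_mult_transpose:
  fixes T :: "real^'n^'n"
  shows "trace (T ** transpose T) = (\<Sum>i\<in>UNIV. \<Sum>j\<in>UNIV. (T $ i $ j)\<^sup>2)"
  by (simp add: trace_def matrix_matrix_mult_def transpose_def power2_eq_square)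

lemma
  fixes H A :: "real^'n^'n"
  assumes H: "transpose H = H" "\<And>v. v \<noteq> 0 \<Longrightarrow> v \<bullet> (H *v v) > 0" and A: "transpose A = A"
  shows trace_posdef_mult_symmetric_nonneg: "trace (H ** A ** (H ** A)) \<ge> 0"
    and trace_posdef_mult_symmetric_eq_0: "trace (H ** A ** (H ** A)) = 0 \<Longrightarrow> A = 0"
proof -
  obtain P :: "real^'n^'n" where P: "H = transpose P ** P" by (rule posdef_matrix_factorization[OF H])
  define T where "T = P ** A ** transpose P"
  have "trace (H ** A ** (H ** A)) = trace (transpose P ** (P ** A ** transpose P ** P ** A))"
    unfolding P by (simp add: matrix_mul_assoc)
  also have "\<dots> = trace (T ** T)"
    unfolding T_def by (subst trace_mul_sym) (simp add: matrix_mul_assoc)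
  also have "\<dots> = trace (T ** transpose T)"
    unfolding T_def by (simp add: matrix_transpose_mul A matrix_mul_assoc)
  finally have trace_eq: "trace (H ** A ** (H ** A)) = (\<Sum>i\<in>UNIV. \<Sum>j\<in>UNIV. (T $ i $ j)\<^sup>2)"
    unfolding trace_mult_transpose .
  then show "trace (H ** A ** (H ** A)) \<ge> 0" by (simp add: sum_nonneg)
  assume "trace (H ** A ** (H ** A)) = 0"
  then have "T = 0" unfolding trace_eq by (simp add: sum_nonneg_eq_0_iff sum_nonneg vec_eq_iff)
  moreover have "H ** A ** H = transpose P ** T ** P" unfolding P T_def by (simp add: matrix_mul_assoc)
  ultimately have HAH: "H ** A ** H = 0" by simp
  have "A = matrix_inv H ** (H ** A ** H) ** matrix_inv H"
    using invertible_if_posdef[OF H(2)] by (metis matrix_inv_left matrix_inv_right matrix_mul_assoc matrix_mul_lid matrix_mul_rid)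
  then show "A = 0" by (simp add: HAH)
qed

section \<open>Differential calculus of vectors and matrices\<close>

lemma has_derivative_vecI:
  fixes f :: "'a::real_normed_vector \<Rightarrow> real^'n"
  assumes "\<And>k. ((\<lambda>x. f x $ k) has_derivative (\<lambda>h. f' h $ k)) (at x)"
  shows "(f has_derivative f') (at x)"
proof (subst has_derivative_componentwise_within, intro ballI)
  fix b :: "real^'n" assume "b \<in> Basis"
  then obtain k where "b = axis k 1" by (auto simp: Basis_vec_def)
  then show "((\<lambda>x. f x \<bullet> b) has_derivative (\<lambda>x. f' x \<bullet> b)) (at x)"
    using assms[of k] by (simp add: inner_axis)
qed

lemma smooth_map_on_vec_iff:
  fixes f :: "'a::euclidean_space \<Rightarrow> real^'n"
  shows "smooth_map_on S f \<longleftrightarrow> (\<forall>k. smooth_on S (\<lambda>x. f x $ k))"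
  unfolding smooth_map_on_def by (auto simp: Basis_vec_def inner_axis)

lemma pd_axis_expansion:
  assumes "f differentiable (at x)"
  shows "pd v f x = (\<Sum>k\<in>UNIV. v $ k * pd (axis k 1) f (x::real^'n))"
proof -
  note lin = linear_pd[OF assms]
  have "v = (\<Sum>k\<in>UNIV. v $ k *\<^sub>R axis k 1)" by (simp add: basis_expansion flip: scalar_mult_eq_scaleR)
  then have "pd v f x = pd (\<Sum>k\<in>UNIV. v $ k *\<^sub>R axis k 1) f x" by simp
  then show ?thesis by (simp add: linear_sum[OF lin] linear_cmul[OF lin])
qed

definition vpd :: "'a::real_normed_vector \<Rightarrow> ('a \<Rightarrow> real^'n) \<Rightarrow> 'a \<Rightarrow> real^'n" where
  "vpd v A x = (\<chi> i. pd v (\<lambda>x. A x $ i) x)"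

definition mpd :: "'a::real_normed_vector \<Rightarrow> ('a \<Rightarrow> real^'n^'m) \<Rightarrow> 'a \<Rightarrow> real^'n^'m" where
  "mpd v M x = (\<chi> i j. pd v (\<lambda>x. M x $ i $ j) x)"

lemma vpd_nth [simp]: "vpd v A x $ i = pd v (\<lambda>x. A x $ i) x"
  by (simp add: vpd_def)

lemma mpd_nth [simp]: "mpd v M x $ i $ j = pd v (\<lambda>x. M x $ i $ j) x"
  by (simp add: mpd_def)

lemma has_derivative_vpd:
  assumes "\<And>i. (\<lambda>x. A x $ i) differentiable (at x)"
  shows "(A has_derivative (\<lambda>v. vpd v A x)) (at x)"
  by (rule has_derivative_vecI) (simp add: pd_has_derivative assms)

lemma pd_inner:
  assumes "\<And>i. (\<lambda>x. A x $ i) differentiable (at x)" "\<And>i. (\<lambda>x. B x $ i) differentiable (at x)"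
  shows "pd v (\<lambda>x. A x \<bullet> B x) x = vpd v A x \<bullet> B x + A x \<bullet> vpd v B x"
  unfolding inner_vec_def using assms by (simp add: pd_sum pd_mult sum.distrib)

lemma vpd_matrix_vector_mult:
  assumes "\<And>i j. (\<lambda>x. M x $ i $ j) differentiable (at x)" "\<And>i. (\<lambda>x. A x $ i) differentiable (at x)"
  shows "vpd v (\<lambda>x. M x *v A x) x = mpd v M x *v A x + M x *v vpd v A x"
  unfolding matrix_vector_mult_def using assms by (simp add: vec_eq_iff pd_sum pd_mult sum.distrib)

lemma mpd_matrix_mult:
  assumes "\<And>i j. (\<lambda>x. M x $ i $ j) differentiable (at x)" "\<And>i j. (\<lambda>x. B x $ i $ j) differentiable (at x)"
  shows "mpd v (\<lambda>x. M x ** B x) x = mpd v M x ** B x + M x ** mpd v B x"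
  unfolding matrix_matrix_mult_def using assms by (simp add: vec_eq_iff pd_sum pd_mult sum.distrib)

lemma pd_trace:
  assumes "\<And>i j. (\<lambda>x. M x $ i $ j) differentiable (at x)"
  shows "pd v (\<lambda>x. trace (M x)) x = trace (mpd v M x)"
  unfolding trace_def using assms by (simp add: pd_sum)

lemma smooth_on_det:
  fixes M :: "'a::euclidean_space \<Rightarrow> real^'n^'n"
  assumes "open S" "\<And>i j. smooth_on S (\<lambda>x. M x $ i $ j)"
  shows "smooth_on S (\<lambda>x. det (M x))"
  unfolding det_def by (intro smooth_on_sum smooth_on_mult smooth_on_prod smooth_on_const assms)

lemma smooth_on_matrix_inv:
  fixes M :: "'a::euclidean_space \<Rightarrow> real^'n^'n"
  assumes S: "open S" and M: "\<And>i j. smooth_on S (\<lambda>x. M x $ i $ j)" and inv: "\<And>x. x \<in> S \<Longrightarrow> invertible (M x)"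
  shows "smooth_on S (\<lambda>x. matrix_inv (M x) $ i $ j)"
proof (rule smooth_on_cong[OF S])
  have det: "det (M x) \<noteq> 0" if "x \<in> S" for x using inv[OF that] invertible_det_nz by blast
  have "smooth_on S (\<lambda>x. (\<chi> k l. if l = i then (if k = j then 1 else 0) else M x $ k $ l) $ a $ b)" for a b
    using M S by (cases "b = i") (auto intro: smooth_on_const)
  then show "smooth_on S (\<lambda>x. det (\<chi> k l. if l = i then (if k = j then 1 else 0) else M x $ k $ l) / det (M x))"
    by (intro smooth_on_divide smooth_on_det S M det)
  show "det (\<chi> k l. if l = i then (if k = j then 1 else 0) else M x $ k $ l) / det (M x) = matrix_inv (M x) $ i $ j"
    if "x \<in> S" for x by (simp add: matrix_inv_cramer det that)
qed

lemma mpd_matrix_inv: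
  fixes M :: "'a::euclidean_space \<Rightarrow> real^'n^'n"
  assumes S: "open S" and M: "\<And>i j. smooth_on S (\<lambda>x. M x $ i $ j)" and inv: "\<And>x. x \<in> S \<Longrightarrow> invertible (M x)"
    and x: "x \<in> S"
  shows "mpd v (\<lambda>x. matrix_inv (M x)) x = - (matrix_inv (M x) ** mpd v M x ** matrix_inv (M x))"
proof -
  let ?V = "\<lambda>x. matrix_inv (M x)"
  note diff_M = smooth_on_imp_differentiable[OF M S x]
  note diff_V = smooth_on_imp_differentiable[OF smooth_on_matrix_inv[OF S M inv] S x]
  have "pd v (\<lambda>x. (M x ** ?V x) $ k $ l) x = pd v (\<lambda>x. mat 1 $ k $ l) x" for k l
    by (rule pd_cong_open[OF S x]) (simp add: matrix_inv_right inv)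
  then have "mpd v (\<lambda>x. M x ** ?V x) x = 0" by (simp add: vec_eq_iff)
  then have "mpd v M x ** ?V x + M x ** mpd v ?V x = 0" by (simp add: mpd_matrix_mult diff_M diff_V)
  then have "?V x ** (mpd v M x ** ?V x + M x ** mpd v ?V x) = 0" by simp
  then have "?V x ** mpd v M x ** ?V x + mpd v ?V x = 0"
    by (simp add: matrix_add_ldistrib matrix_mul_assoc matrix_inv_left inv x)
  then show ?thesis by (simp add: eq_neg_iff_add_eq_0 add.commute)
qed

lemma det_replace_row_expansion:
  fixes A :: "real^'n^'n"
  shows "det (\<chi> k. if k = i then r else A $ k)
    = (\<Sum>p | p permutes UNIV. of_int (sign p) * (r $ p i * (\<Prod>j\<in>UNIV - {i}. A $ j $ p j)))"
  unfolding det_def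
proof (intro sum.cong refl arg_cong2[where f=times])
  fix p :: "'n \<Rightarrow> 'n"
  let ?R = "\<chi> k. if k = i then r else A $ k"
  have "(\<Prod>k\<in>UNIV. ?R $ k $ p k) = ?R $ i $ p i * (\<Prod>k\<in>UNIV-{i}. ?R $ k $ p k)"
    by (rule prod.remove) auto
  also have "\<dots> = r $ p i * (\<Prod>j\<in>UNIV - {i}. A $ j $ p j)" by (auto intro!: prod.cong)
  finally show "(\<Prod>k\<in>UNIV. ?R $ k $ p k) = r $ p i * (\<Prod>j\<in>UNIV - {i}. A $ j $ p j)" .
qed

lemma pd_det:
  fixes M :: "'a::euclidean_space \<Rightarrow> real^'n^'n"
  assumes M: "\<And>i j. (\<lambda>x. M x $ i $ j) differentiable (at x)" and inv: "invertible (M x)"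
  shows "(\<lambda>x. det (M x)) differentiable (at x)"
    and "pd v (\<lambda>x. det (M x)) x = det (M x) * trace (matrix_inv (M x) ** mpd v M x)"
proof -
  let ?D = "\<lambda>v. \<Sum>p | p permutes UNIV. of_int (sign p) *
    (\<Sum>i\<in>UNIV. mpd v M x $ i $ p i * (\<Prod>j\<in>UNIV - {i}. M x $ j $ p j))"
  have D: "((\<lambda>x. det (M x)) has_derivative ?D) (at x)"
    unfolding det_def mpd_nth
    by (intro has_derivative_sum has_derivative_mult_right has_derivative_prod pd_has_derivative M)
  then show "(\<lambda>x. det (M x)) differentiable (at x)" unfolding differentiable_def by blast
  have "pd v (\<lambda>x. det (M x)) x = ?D v" by (rule pd_eqI[OF D])
  also have "\<dots> = (\<Sum>i\<in>UNIV. det (\<chi> k. if k = i then mpd v M x $ i else M x $ k))"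
    unfolding det_replace_row_expansion sum_distrib_left by (subst sum.swap) simp
  also have "\<dots> = trace (mpd v M x ** matrix_inv (M x)) * det (M x)"
    unfolding det_replace_row[OF inv] by (simp add: trace_def matrix_matrix_mult_def sum_distrib_right)
  finally show "pd v (\<lambda>x. det (M x)) x = det (M x) * trace (matrix_inv (M x) ** mpd v M x)"
    using trace_mul_sym[of "mpd v M x" "matrix_inv (M x)"] by simp
qed

section \<open>Linear maps and Lebesgue measure\<close>

text \<open>The library has \<^term>\<open>measure lebesgue (f ` S) = \<bar>det (matrix f)\<bar> * measure lebesgue S\<close> only for
  well-ordered index types, because it obtains the determinant of a shear from triangularity.\<close>

definition scales_measure_by_det :: "(real^'n \<Rightarrow> real^'n) \<Rightarrow> bool" where
  "scales_measure_by_det f \<longleftrightarrow> (\<forall>S\<in>lmeasurable. f ` S \<in> lmeasurable \<and>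
     measure lebesgue (f ` S) = \<bar>det (matrix f)\<bar> * measure lebesgue S)"

lemma scales_measure_by_det_if_boxes:
  fixes f :: "real^'n \<Rightarrow> real^'n"
  assumes "linear f" "\<bar>det (matrix f)\<bar> = 1"
    and "\<And>a b. measure lebesgue (f ` cbox a b) = measure lebesgue (cbox a b)"
  shows "scales_measure_by_det f"
  unfolding scales_measure_by_det_def
proof
  fix S :: "(real^'n) set" assume "S \<in> lmeasurable"
  from measure_linear_sufficient[OF assms(1) this, of 1]
  show "f ` S \<in> lmeasurable \<and> measure lebesgue (f ` S) = \<bar>det (matrix f)\<bar> * measure lebesgue S"
    unfolding assms(2,3) mult_1 by simp
qed

lemma scales_measure_by_det_compose:
  fixes f g :: "real^'n \<Rightarrow> real^'n"
  assumes "linear f" "linear g" and f: "scales_measure_by_det f" and g: "scales_measure_by_det g"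
  shows "scales_measure_by_det (f \<circ> g)"
  unfolding scales_measure_by_det_def
proof
  fix S :: "(real^'n) set" assume "S \<in> lmeasurable"
  then have gS: "g ` S \<in> lmeasurable" "measure lebesgue (g ` S) = \<bar>det (matrix g)\<bar> * measure lebesgue S"
    using g by (auto simp: scales_measure_by_det_def)
  then have "f ` g ` S \<in> lmeasurable" "measure lebesgue (f ` g ` S) = \<bar>det (matrix f)\<bar> * measure lebesgue (g ` S)"
    using f by (auto simp: scales_measure_by_det_def)
  then show "(f \<circ> g) ` S \<in> lmeasurable \<and> measure lebesgue ((f \<circ> g) ` S) = \<bar>det (matrix (f \<circ> g))\<bar> * measure lebesgue S"
    unfolding matrix_compose[OF assms(2,1)] image_comp[symmetric] gS(2) by (simp add: abs_mult det_mul)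
qed

lemma scales_measure_by_det_singular:
  fixes f :: "real^'n \<Rightarrow> real^'n"
  assumes "linear f" "\<not> inj f"
  shows "scales_measure_by_det f"
proof -
  have "negligible (f ` S)" for S using negligible_linear_singular_image[OF assms] by blast
  moreover have "det (matrix f) = 0" using assms det_nz_iff_inj by blast
  ultimately show ?thesis unfolding scales_measure_by_det_def by (simp add: negligible_iff_measure)
qed

lemma scales_measure_by_det_swap:
  fixes m n :: "'n::finite"
  shows "scales_measure_by_det (\<lambda>x::real^'n. \<chi> i. x $ Transposition.transpose m n i)"
proof (cases "m = n")
  case True
  then show ?thesis by (simp add: scales_measure_by_det_def matrix_id[unfolded id_def])
next
  case False
  let ?\<pi> = "Transposition.transpose m n"
  let ?h = "\<lambda>x::real^'n. \<chi> i. x $ ?\<pi> i"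
  have perm: "?\<pi> permutes UNIV" by (rule permutes_swap_id) auto
  show ?thesis
  proof (rule scales_measure_by_det_if_boxes)
    show "linear ?h" by (rule linearI) (auto simp: vec_eq_iff)
    have "matrix ?h = (\<chi> i. mat 1 $ ?\<pi> i)" by (simp add: matrix_def axis_def mat_def vec_eq_iff)
    then show "\<bar>det (matrix ?h)\<bar> = 1"
      using det_permute_rows[OF perm, of "mat 1 :: real^'n^'n"] by (simp add: sign_def)
    fix a b :: "real^'n"
    have image: "?h ` cbox a b = cbox (?h a) (?h b)"
    proof (intro set_eqI iffI)
      fix y assume "y \<in> cbox (?h a) (?h b)"
      then have y: "a $ ?\<pi> i \<le> y $ i" "y $ i \<le> b $ ?\<pi> i" for i by (auto simp: mem_box_cart)
      have "?h y \<in> cbox a b" using y[of "?\<pi> i" for i] by (simp add: mem_box_cart)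
      moreover have "y = ?h (?h y)" by (simp add: vec_eq_iff)
      ultimately show "y \<in> ?h ` cbox a b" by blast
    qed (auto simp: mem_box_cart)
    show "measure lebesgue (?h ` cbox a b) = measure lebesgue (cbox a b)"
    proof (cases "cbox a b = {}")
      case False
      then have "cbox (?h a) (?h b) \<noteq> {}" using image by auto
      then show ?thesis unfolding image
        using prod.permute[OF perm, of "\<lambda>i. b $ i - a $ i"] False by (simp add: content_cbox_cart o_def)
    qed simp
  qed
qed

lemma scales_measure_by_det_shear:
  fixes m n :: "'n::finite"
  assumes "m \<noteq> n"
  shows "scales_measure_by_det (\<lambda>x::real^'n. \<chi> i. if i = m then x $ m + x $ n else x $ i)"
    (is "scales_measure_by_det ?h")
proof (rule scales_measure_by_det_if_boxes)
  show lin: "linear ?h" by (rule linearI) (auto simp: vec_eq_iff algebra_simps)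
  have "matrix ?h = (\<chi> k. if k = m then row m (mat 1) + 1 *s row n (mat 1) else row k (mat 1))"
    by (auto simp: matrix_def axis_def mat_def row_def vec_eq_iff)
  then show "\<bar>det (matrix ?h)\<bar> = 1" by (simp only: det_row_operation[OF assms]) simp
  fix a b :: "real^'n"
  show "measure lebesgue (?h ` cbox a b) = measure lebesgue (cbox a b)"
  proof (cases "cbox a b = {}")
    case False
    let ?v = "axis n (- a $ n) :: real^'n"
    have nonempty: "cbox (?v + a) (?v + b) \<noteq> {}" using False by (simp add: cbox_translation)
    have "?h ` cbox (?v + a) (?v + b) = (+) (?h ?v) ` ?h ` cbox a b"
      unfolding cbox_translation image_image by (simp add: linear_add[OF lin])
    then have "measure lebesgue (?h ` cbox a b) = measure lebesgue (?h ` cbox (?v + a) (?v + b))"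
      by (simp only: measure_translation)
    also have "\<dots> = measure lebesgue (cbox (?v + a) (?v + b))"
      by (rule measure_shear_interval[OF assms nonempty]) (simp add: axis_def)
    also have "\<dots> = measure lebesgue (cbox a b)" by (simp only: cbox_translation measure_translation)
    finally show ?thesis .
  qed simp
qed

lemma measure_linear_image_cart:
  fixes f :: "real^'n \<Rightarrow> real^'n"
  assumes "linear f" "S \<in> lmeasurable"
  shows "measure lebesgue (f ` S) = \<bar>det (matrix f)\<bar> * measure lebesgue S"
proof -
  have "scales_measure_by_det f"
  proof (rule induct_linear_elementary[OF assms(1), of scales_measure_by_det])
    fix f :: "real^'n \<Rightarrow> real^'n" and i assume f: "linear f" "\<And>x. f x $ i = 0"
    then have "\<not> surj f" by (metis one_neq_zero surjD vec_component)
    then show "scales_measure_by_det f"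
      using scales_measure_by_det_singular f(1) linear_injective_imp_surjective by blast
  next
    fix k :: "'n \<Rightarrow> real"
    have "det (matrix (\<lambda>x::real^'n. \<chi> i. k i * x $ i)) = prod k UNIV"
      by (subst det_diagonal) (auto simp: matrix_def axis_def)
    then show "scales_measure_by_det (\<lambda>x. \<chi> i. k i * x $ i)"
      unfolding scales_measure_by_det_def by (simp add: measurable_stretch measure_stretch)
  qed (use scales_measure_by_det_compose scales_measure_by_det_swap scales_measure_by_det_shear in auto)
  then show ?thesis using assms(2) unfolding scales_measure_by_det_def by blast
qed

section \<open>Integrals depending on a parameter\<close>

lemma has_derivative_integral_parameter:
  fixes f :: "'a::euclidean_space \<Rightarrow> 'b::euclidean_space \<Rightarrow> real"
  assumes "open B" "convex B" "x0 \<in> B"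
    and f: "\<And>x y. x \<in> B \<Longrightarrow> y \<in> cbox p q \<Longrightarrow> ((\<lambda>x. f x y) has_derivative (\<lambda>v. v \<bullet> W x y)) (at x)"
    and int: "\<And>x. x \<in> B \<Longrightarrow> f x integrable_on cbox p q"
    and W: "continuous_on (B \<times> cbox p q) (\<lambda>(x, y). W x y)"
  shows "((\<lambda>x. integral (cbox p q) (f x)) has_derivative (\<lambda>v. v \<bullet> integral (cbox p q) (W x0))) (at x0)"
proof -
  note bl = bounded_linear_blinfun_inner_left
  have "((\<lambda>x. integral (cbox p q) (f x)) has_derivative
      integral (cbox p q) (\<lambda>y. blinfun_inner_left (W x0 y))) (at x0 within B)"
  proof (rule leibniz_rule[OF _ int _ \<open>x0 \<in> B\<close> \<open>convex B\<close>])
    show "((\<lambda>x. f x y) has_derivative blinfun_inner_left (W x y)) (at x within B)"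
      if "x \<in> B" "y \<in> cbox p q" for x y
      using has_derivative_at_withinI[OF f[OF that]] by (simp add: blinfun_inner_left.rep_eq)
    show "continuous_on (B \<times> cbox p q) (\<lambda>(x, y). blinfun_inner_left (W x y))"
      using bounded_linear.continuous_on[OF bl W] by (simp add: case_prod_unfold)
  qed
  moreover have "W x0 integrable_on cbox p q"
    using W \<open>x0 \<in> B\<close>
    by (intro integrable_continuous) (auto intro!: continuous_on_compose2[OF W, of _ "\<lambda>y. (x0, y)", simplified] continuous_intros)
  then have "integral (cbox p q) (\<lambda>y. blinfun_inner_left (W x0 y)) = blinfun_inner_left (integral (cbox p q) (W x0))"
    using integral_linear[OF _ bl, of "W x0" "cbox p q"] by (simp add: o_def)
  ultimately show ?thesis
    using at_within_open[OF \<open>x0 \<in> B\<close> \<open>open B\<close>] by (simp add: blinfun_inner_left.rep_eq)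
qed

lemma integral_translate_compact_support:
  fixes u :: "'a::euclidean_space \<Rightarrow> real"
  assumes u: "continuous_on UNIV u" and supp: "\<And>y. y \<notin> cbox p q \<Longrightarrow> u y = 0" "\<And>y. y \<notin> cbox p q \<Longrightarrow> u (y + w) = 0"
  shows "integral (cbox p q) (\<lambda>y. u (y + w)) = integral (cbox p q) u"
proof -
  have int: "(\<lambda>y. u (y + w)) integrable_on cbox p q" for w
    by (intro integrable_continuous continuous_on_compose2[OF u] continuous_intros) auto
  have "(u has_integral integral (cbox p q) u) (cbox p q)" using int[of 0] by (simp add: integrable_integral)
  from has_integral_affinity[OF this, of 1 w]
  have "((\<lambda>y. u (y + w)) has_integral integral (cbox p q) u) ((\<lambda>y. y - w) ` cbox p q)" by simp
  then have "((\<lambda>y. u (y + w)) has_integral integral (cbox p q) u) UNIV"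
  proof (rule has_integral_on_superset)
    fix y assume "y \<notin> (\<lambda>y. y - w) ` cbox p q"
    then have "y + w \<notin> cbox p q" by (metis add_diff_cancel image_eqI)
    then show "u (y + w) = 0" by (rule supp)
  qed simp
  moreover have "((\<lambda>y. u (y + w)) has_integral integral (cbox p q) (\<lambda>y. u (y + w))) UNIV"
    by (rule has_integral_on_superset[OF integrable_integral[OF int]]) (use supp in auto)
  ultimately show ?thesis by (rule has_integral_unique[symmetric])
qed

lemma has_derivative_integral_translate:
  fixes u u' :: "'a::euclidean_space \<Rightarrow> real"
  assumes D: "\<And>y. (u has_derivative D y) (at y)" and u': "\<And>y. D y e = u' y" and cont: "continuous_on UNIV u'"
  shows "((\<lambda>t. integral (cbox p q) (\<lambda>y. u (y + t *\<^sub>R e))) has_derivative (\<lambda>s. s * integral (cbox p q) u')) (at 0)"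
proof -
  have u_cont: "continuous_on UNIV u"
    by (intro continuous_at_imp_continuous_on ballI) (rule has_derivative_continuous[OF D])
  have "((\<lambda>t. integral (cbox p q) (\<lambda>y. u (y + t *\<^sub>R e))) has_derivative
      (\<lambda>s. s \<bullet> integral (cbox p q) (\<lambda>y. u' (y + 0 *\<^sub>R e)))) (at 0)"
  proof (rule has_derivative_integral_parameter[where B="{-1<..<1}"])
    fix t :: real and y :: 'a
    have "((\<lambda>t. y + t *\<^sub>R e) has_derivative (\<lambda>s. s *\<^sub>R e)) (at t)" by (auto intro!: derivative_eq_intros)
    from has_derivative_compose[OF this D]
    show "((\<lambda>t. u (y + t *\<^sub>R e)) has_derivative (\<lambda>s. s \<bullet> u' (y + t *\<^sub>R e))) (at t)"
      by (rule has_derivative_eq_rhs) (simp add: fun_eq_iff linear_cmul[OF has_derivative_linear[OF D]] u')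
    show "(\<lambda>y. u (y + t *\<^sub>R e)) integrable_on cbox p q"
      by (intro integrable_continuous continuous_on_compose2[OF u_cont] continuous_intros) auto
  next
    show "continuous_on ({-1<..<1} \<times> cbox p q) (\<lambda>(t, y). u' (y + t *\<^sub>R e))"
      unfolding case_prod_unfold
      by (rule continuous_on_compose2[OF cont, of _ "\<lambda>p. snd p + fst p *\<^sub>R e"]) (auto intro!: continuous_intros)
  qed auto
  then show ?thesis by simp
qed

text \<open>Differentiate the translation-invariant integral \<open>t \<mapsto> \<integral> u (y + t e) dy\<close> at \<open>0\<close>.\<close>

lemma has_integral_directional_derivative_zero:
  fixes u u' :: "'a::euclidean_space \<Rightarrow> real"
  assumes D: "\<And>y. (u has_derivative D y) (at y)" and u': "\<And>y. D y e = u' y"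
    and cont: "continuous_on UNIV u'" and supp: "\<And>y. norm y > R \<Longrightarrow> u y = 0"
    and box: "cball 0 (R + norm e) \<subseteq> cbox p q"
  shows "(u' has_integral 0) (cbox p q)"
proof -
  have u_cont: "continuous_on UNIV u"
    by (intro continuous_at_imp_continuous_on ballI) (rule has_derivative_continuous[OF D])
  have supp_translate: "u (y + t *\<^sub>R e) = 0" if "t \<in> {-1<..<1}" "y \<notin> cbox p q" for t y
  proof (rule supp)
    have "norm y > R + norm e" using that box by (auto simp: subset_iff not_le)
    moreover have "norm y \<le> norm (y + t *\<^sub>R e) + norm (t *\<^sub>R e)" using norm_triangle_sub[of y "y + t *\<^sub>R e"] by simp
    moreover have "norm (t *\<^sub>R e) \<le> norm e" using that by (simp add: mult_left_le_one_le abs_le_iff)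
    ultimately show "norm (y + t *\<^sub>R e) > R" by linarith
  qed
  have "((\<lambda>t. integral (cbox p q) (\<lambda>y. u (y + t *\<^sub>R e))) has_derivative (\<lambda>s. s * integral (cbox p q) u')) (at 0)"
    by (rule has_derivative_integral_translate[OF D u' cont])
  moreover have "((\<lambda>t. integral (cbox p q) (\<lambda>y. u (y + t *\<^sub>R e))) has_derivative (\<lambda>s. 0)) (at 0)"
  proof (rule has_derivative_transform_within_open[OF has_derivative_const, where s="{-1<..<1}"])
    fix t :: real assume "t \<in> {-1<..<1}"
    then show "integral (cbox p q) u = integral (cbox p q) (\<lambda>y. u (y + t *\<^sub>R e))"
      using supp_translate[of t] supp_translate[of 0]
      by (intro integral_translate_compact_support[symmetric] u_cont) auto
  qed auto
  ultimately have "(\<lambda>s::real. s * integral (cbox p q) u') = (\<lambda>s. 0)"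
    by (rule has_derivative_unique)
  from fun_cong[OF this, of 1] have "integral (cbox p q) u' = 0" by simp
  moreover have "u' integrable_on cbox p q" by (intro integrable_continuous continuous_on_subset[OF cont]) auto
  ultimately show ?thesis by (metis integrable_integral)
qed

section \<open>Closed 1-forms and inverse functions\<close>

lemma continuous_on_derivative_if_smooth:
  fixes \<theta> :: "'a::euclidean_space \<Rightarrow> 'b::euclidean_space"
  assumes \<theta>: "smooth_map_on S \<theta>" and S: "open S" and D: "\<And>x. x \<in> S \<Longrightarrow> (\<theta> has_derivative D x) (at x)"
  shows "continuous_on (S \<times> UNIV) (\<lambda>z. D (fst z) (snd z))"
proof (rule continuous_on_eq)
  have comp: "smooth_on S (\<lambda>x. \<theta> x \<bullet> c)" if "c \<in> Basis" for c using \<theta> that unfolding smooth_map_on_def by blast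
  show "continuous_on (S \<times> UNIV) (\<lambda>z. \<Sum>c\<in>Basis. (\<Sum>b\<in>Basis. (snd z \<bullet> b) * pd b (\<lambda>x. \<theta> x \<bullet> c) (fst z)) *\<^sub>R c)"
    by (intro continuous_intros continuous_on_compose2[OF smooth_on_imp_continuous_on[OF smooth_on_pd[OF comp] S]])
       auto
  show "(\<Sum>c\<in>Basis. (\<Sum>b\<in>Basis. (snd z \<bullet> b) * pd b (\<lambda>x. \<theta> x \<bullet> c) (fst z)) *\<^sub>R c) = D (fst z) (snd z)"
    if "z \<in> S \<times> UNIV" for z
  proof -
    have x: "fst z \<in> S" using that by auto
    have "D (fst z) = (\<lambda>v. \<Sum>c\<in>Basis. pd v (\<lambda>x. \<theta> x \<bullet> c) (fst z) *\<^sub>R c)"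
      by (rule has_derivative_unique[OF D[OF x] smooth_map_on_has_derivative[OF \<theta> S x]])
    then show ?thesis
      using pd_Basis_expansion[OF smooth_on_imp_differentiable[OF comp S x], of _ "snd z"] by simp
  qed
qed

lemma derivative_symmetric_if_closed:
  fixes \<theta> :: "'a::euclidean_space \<Rightarrow> 'a"
  assumes D: "(\<theta> has_derivative D) (at x)"
    and closed: "\<And>b c. b \<in> Basis \<Longrightarrow> c \<in> Basis \<Longrightarrow> pd b (\<lambda>x. \<theta> x \<bullet> c) x = pd c (\<lambda>x. \<theta> x \<bullet> b) x"
  shows "D v \<bullet> w = D w \<bullet> v"
proof -
  interpret D: linear D by (rule has_derivative_linear[OF D])
  have bilinear_expansion: "D v \<bullet> w = (\<Sum>b\<in>Basis. \<Sum>c\<in>Basis. (v \<bullet> b) * (w \<bullet> c) * (D b \<bullet> c))" for v w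
  proof -
    have "D v = D (\<Sum>b\<in>Basis. (v \<bullet> b) *\<^sub>R b)" by (simp add: euclidean_representation)
    also have "\<dots> = (\<Sum>b\<in>Basis. (v \<bullet> b) *\<^sub>R D b)" by (simp add: D.sum D.scale)
    finally have "D v \<bullet> w = (\<Sum>b\<in>Basis. (v \<bullet> b) * (D b \<bullet> w))" by (simp add: inner_sum_left)
    also have "\<dots> = (\<Sum>b\<in>Basis. (v \<bullet> b) * (\<Sum>c\<in>Basis. (D b \<bullet> c) * (w \<bullet> c)))"
      by (intro sum.cong refl arg_cong2[where f=times] euclidean_inner)
    finally show ?thesis by (simp add: sum_distrib_left mult_ac)
  qed

  have "D b \<bullet> c = D c \<bullet> b" if "b \<in> Basis" "c \<in> Basis" for b c
    using closed[OF that] pd_eqI[OF has_derivative_inner_left[OF D]] by simp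
  then show ?thesis
    unfolding bilinear_expansion[of v w] bilinear_expansion[of w v]
    by (subst sum.swap) (simp add: mult_ac)
qed

definition ray :: "'a::real_vector \<Rightarrow> 'a \<Rightarrow> real \<Rightarrow> 'a" where
  "ray x0 x t = x0 + t *\<^sub>R (x - x0)"

lemma ray_in_ball:
  fixes x0 x :: "'a::real_normed_vector"
  assumes "x \<in> ball x0 r" "t \<in> {0..1}"
  shows "ray x0 x t \<in> ball x0 r"
proof -
  have "dist x0 (ray x0 x t) = t * dist x0 x" using assms by (simp add: ray_def dist_norm norm_minus_commute)
  also have "\<dots> \<le> dist x0 x" using assms by (simp add: mult_left_le_one_le)
  finally show ?thesis using assms by simp
qed

lemma has_integral_ray_derivative:
  fixes \<theta> :: "'a::euclidean_space \<Rightarrow> 'b::euclidean_space"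
  assumes D: "\<And>x. x \<in> ball x0 r \<Longrightarrow> (\<theta> has_derivative D x) (at x)" and x: "x \<in> ball x0 r"
  shows "((\<lambda>t. t *\<^sub>R D (ray x0 x t) (x - x0) + \<theta> (ray x0 x t)) has_integral \<theta> x) {0..1}"
proof -
  let ?P = "ray x0 x"
  have "((\<lambda>t. t *\<^sub>R D (?P t) (x - x0) + \<theta> (?P t)) has_integral 1 *\<^sub>R \<theta> (?P 1) - 0 *\<^sub>R \<theta> (?P 0)) {0..1}"
  proof (rule fundamental_theorem_of_calculus)
    fix t :: real assume t: "t \<in> {0..1}"
    note D_P = D[OF ray_in_ball[OF x t]]
    have "(?P has_derivative (\<lambda>s. s *\<^sub>R (x - x0))) (at t)"
      unfolding ray_def[abs_def] by (auto intro!: derivative_eq_intros)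
    from has_derivative_scaleR[OF has_derivative_ident has_derivative_compose[OF this D_P]]
    have "((\<lambda>t. t *\<^sub>R \<theta> (?P t)) has_derivative (\<lambda>s. s *\<^sub>R (t *\<^sub>R D (?P t) (x - x0) + \<theta> (?P t)))) (at t)"
      by (rule has_derivative_eq_rhs)
         (simp add: fun_eq_iff linear_cmul[OF has_derivative_linear[OF D_P]] scaleR_add_right)
    then show "((\<lambda>t. t *\<^sub>R \<theta> (?P t)) has_vector_derivative t *\<^sub>R D (?P t) (x - x0) + \<theta> (?P t)) (at t within {0..1})"
      unfolding has_vector_derivative_def by (rule has_derivative_at_withinI)
  qed simp
  then show ?thesis by (simp add: ray_def)
qed

lemma has_derivative_ray_integrand:
  fixes \<theta> :: "'a::euclidean_space \<Rightarrow> 'a"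
  assumes D: "(\<theta> has_derivative D) (at (ray x0 x t))"
    and closed: "\<And>b c. b \<in> Basis \<Longrightarrow> c \<in> Basis \<Longrightarrow> pd b (\<lambda>x. \<theta> x \<bullet> c) (ray x0 x t) = pd c (\<lambda>x. \<theta> x \<bullet> b) (ray x0 x t)"
  shows "((\<lambda>x. \<theta> (ray x0 x t) \<bullet> (x - x0)) has_derivative (\<lambda>v. v \<bullet> (t *\<^sub>R D (x - x0) + \<theta> (ray x0 x t)))) (at x)"
proof -
  have "((\<lambda>x. ray x0 x t) has_derivative (\<lambda>v. t *\<^sub>R v)) (at x)"
    unfolding ray_def by (auto intro!: derivative_eq_intros)
  from has_derivative_compose[OF this D]
  have "((\<lambda>x. \<theta> (ray x0 x t)) has_derivative (\<lambda>v. D (t *\<^sub>R v))) (at x)" .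
  moreover have "((\<lambda>x. x - x0) has_derivative (\<lambda>v. v)) (at x)" by (auto intro!: derivative_eq_intros)
  ultimately have "((\<lambda>x. \<theta> (ray x0 x t) \<bullet> (x - x0)) has_derivative (\<lambda>v. \<theta> (ray x0 x t) \<bullet> v + D (t *\<^sub>R v) \<bullet> (x - x0))) (at x)"
    by (rule has_derivative_inner)
  moreover have "\<theta> (ray x0 x t) \<bullet> v + D (t *\<^sub>R v) \<bullet> (x - x0) = v \<bullet> (t *\<^sub>R D (x - x0) + \<theta> (ray x0 x t))" for v
    using derivative_symmetric_if_closed[OF D closed, of v "x - x0"]
    by (simp add: inner_add_right linear_cmul[OF has_derivative_linear[OF D]] inner_commute)
  ultimately show ?thesis by simp
qed

lemma poincare_lemma:
  fixes \<theta> :: "'a::euclidean_space \<Rightarrow> 'a"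
  assumes \<theta>: "smooth_map_on (ball x0 r) \<theta>"
    and closed: "\<And>x b c. x \<in> ball x0 r \<Longrightarrow> b \<in> Basis \<Longrightarrow> c \<in> Basis \<Longrightarrow>
      pd b (\<lambda>x. \<theta> x \<bullet> c) x = pd c (\<lambda>x. \<theta> x \<bullet> b) x"
  obtains f where "\<And>x. x \<in> ball x0 r \<Longrightarrow> (f has_derivative (\<lambda>v. v \<bullet> \<theta> x)) (at x)"
proof -
  let ?B = "ball x0 r"
  define D where "D x = frechet_derivative \<theta> (at x)" for x
  have D: "(\<theta> has_derivative D x) (at x)" if "x \<in> ?B" for x
    using smooth_map_on_imp_differentiable[OF \<theta> open_ball that] unfolding D_def frechet_derivative_works .
  have \<theta>_cont: "continuous_on ?B \<theta>"
    using D by (intro continuous_at_imp_continuous_on ballI) (blast intro: has_derivative_continuous)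
  define W where "W x t = t *\<^sub>R D (ray x0 x t) (x - x0) + \<theta> (ray x0 x t)" for x t
  define f where "f x = integral (cbox 0 1) (\<lambda>t. \<theta> (ray x0 x t) \<bullet> (x - x0))" for x
  have "(f has_derivative (\<lambda>v. v \<bullet> \<theta> x)) (at x)" if x: "x \<in> ?B" for x
  proof -
    have "(f has_derivative (\<lambda>v. v \<bullet> integral (cbox 0 1) (W x))) (at x)"
      unfolding f_def
    proof (rule has_derivative_integral_parameter[OF open_ball convex_ball x])
      show "((\<lambda>x. \<theta> (ray x0 x t) \<bullet> (x - x0)) has_derivative (\<lambda>v. v \<bullet> W x t)) (at x)"
        if "x \<in> ?B" "t \<in> cbox 0 1" for x t
        unfolding W_def using ray_in_ball that by (intro has_derivative_ray_integrand D closed) auto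
      show "(\<lambda>t. \<theta> (ray x0 x t) \<bullet> (x - x0)) integrable_on cbox 0 1" if "x \<in> ?B" for x
        using ray_in_ball[OF that] unfolding ray_def
        by (intro integrable_continuous continuous_on_inner continuous_on_compose2[OF \<theta>_cont] continuous_intros) auto
      show "continuous_on (?B \<times> cbox 0 1) (\<lambda>(x, t). W x t)"
        using ray_in_ball[of _ x0 r] unfolding W_def ray_def case_prod_unfold
        by (intro continuous_on_add continuous_on_scaleR continuous_on_compose2[OF \<theta>_cont]
            continuous_on_compose2[OF continuous_on_derivative_if_smooth[OF \<theta> open_ball D],
              of _ "\<lambda>z. (x0 + snd z *\<^sub>R (fst z - x0), fst z - x0)", simplified] continuous_intros) auto
    qed
    then show ?thesis
      using integral_unique[OF has_integral_ray_derivative[OF D x]] unfolding W_def by simp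
  qed
  then show ?thesis by (rule that)
qed

lemma local_inverse_function:
  fixes f :: "'a::euclidean_space \<Rightarrow> 'a"
  assumes S: "open S" and f: "smooth_map_on S f" and x0: "x0 \<in> S"
    and D: "\<And>x. x \<in> S \<Longrightarrow> (f has_derivative D x) (at x)" and inj: "inj (D x0)"
  obtains S' V g where "open S'" "S' \<subseteq> S" "x0 \<in> S'" "open V" "f x0 \<in> V" "homeomorphism S' V f g"
    "\<forall>y\<in>V. g differentiable (at y)" "\<forall>x\<in>S'. inj (D x)"
proof -
  have apply_D: "blinfun_apply (Blinfun (D x)) = D x" if "x \<in> S" for x
    using bounded_linear_Blinfun_apply[OF has_derivative_bounded_linear[OF D[OF that]]] .
  have cont: "continuous_on S (\<lambda>x. Blinfun (D x))"
  proof (rule continuous_on_blinfun_componentwise)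
    fix i :: 'a
    have "continuous_on S (\<lambda>x. D x i)"
      by (rule continuous_on_compose2[OF continuous_on_derivative_if_smooth[OF f S D], of _ "\<lambda>x. (x, i)", simplified])
         (auto intro!: continuous_intros)
    then show "continuous_on S (\<lambda>x. blinfun_apply (Blinfun (D x)) i)"
      by (rule continuous_on_eq) (simp add: apply_D)
  qed
  obtain h where h: "linear h" "h \<circ> D x0 = id"
    using linear_injective_left_inverse[OF has_derivative_linear[OF D[OF x0]] inj] by blast
  have "Blinfun h o\<^sub>L Blinfun (D x0) = id_blinfun"
    using h(1) fun_cong[OF h(2)]
    by (intro blinfun_eqI) (simp add: apply_D[OF x0] bounded_linear_Blinfun_apply linear_conv_bounded_linear)
  then obtain S' V g g' where r: "open S'" "S' \<subseteq> S" "x0 \<in> S'" "open V" "f x0 \<in> V" "homeomorphism S' V f g"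
    "\<And>y. y \<in> V \<Longrightarrow> (g has_derivative (g' y)) (at y)" "\<And>y. y \<in> V \<Longrightarrow> bij (blinfun_apply (Blinfun (D (g y))))"
    using inverse_function_theorem[OF S _ cont x0, of f "Blinfun h"] D apply_D by metis
  show ?thesis
  proof (rule that[OF r(1-6)])
    show "\<forall>y\<in>V. g differentiable (at y)" using r(7) unfolding differentiable_def by blast
    show "\<forall>x\<in>S'. inj (D x)"
    proof
      fix x assume x: "x \<in> S'"
      then have "f x \<in> V" "g (f x) = x" using r(6) unfolding homeomorphism_def by auto
      then show "inj (D x)" using r(8)[of "f x"] apply_D[of x] x r(2) by (auto simp: bij_def)
    qed
  qed
qed

lemma smooth_map_on_if_smooth_derivative:
  fixes f :: "real^'n \<Rightarrow> real^'n"
  assumes S: "open S" and f: "\<And>x. x \<in> S \<Longrightarrow> (f has_derivative (\<lambda>v. E x *v v)) (at x)"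
    and E: "\<And>i j. smooth_on S (\<lambda>x. E x $ i $ j)"
  shows "smooth_map_on S f"
  unfolding smooth_map_on_vec_iff
proof (intro allI, rule smooth_onI_pd[OF S])
  have f_comp: "((\<lambda>x. f x $ a) has_derivative (\<lambda>v. (E x *v v) $ a)) (at x)" if "x \<in> S" for a x
    using bounded_linear.has_derivative[OF bounded_linear_vec_nth f[OF that]] .
  show "(\<lambda>x. f x $ a) differentiable (at x)" if "x \<in> S" for a x
    using f_comp[OF that] unfolding differentiable_def by blast
  fix a and b :: "real^'n"
  have "smooth_on S (\<lambda>x. (E x *v b) $ a)"
    unfolding matrix_vector_mult_def by (simp add: smooth_on_sum smooth_on_mult smooth_on_const S E)
  then show "smooth_on S (pd b (\<lambda>x. f x $ a))"
    by (rule smooth_on_cong[OF S]) (use pd_eqI[OF f_comp] in simp)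
qed

lemma smooth_local_inverse_function:
  fixes f :: "real^'n \<Rightarrow> real^'n"
  assumes S: "open S" "x0 \<in> S" and f: "\<And>x. x \<in> S \<Longrightarrow> (f has_derivative (\<lambda>v. E x *v v)) (at x)"
    and E: "\<And>i j. smooth_on S (\<lambda>x. E x $ i $ j)" and inv: "\<And>x. x \<in> S \<Longrightarrow> invertible (E x)"
  obtains W V g where "open W" "x0 \<in> W" "W \<subseteq> S" "open V" "homeomorphism W V f g" "smooth_map_on S f" "smooth_map_on V g"
proof -
  have f_smooth: "smooth_map_on S f" using S(1) f E by (rule smooth_map_on_if_smooth_derivative)
  have inj: "inj (\<lambda>v. E x0 *v v)"
    using matrix_inv_vector_mult(1)[OF inv[OF S(2)]] by (rule inj_on_inverseI)
  obtain W V g where WV: "open W" "W \<subseteq> S" "x0 \<in> W" "open V" "f x0 \<in> V" "homeomorphism W V f g"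
    and g_diff: "\<forall>y\<in>V. g differentiable (at y)" and "\<forall>x\<in>W. inj (\<lambda>v. E x *v v)"
    by (rule local_inverse_function[OF S(1) f_smooth S(2) f inj])
  have gW: "g y \<in> W" "f (g y) = y" if "y \<in> V" for y using WV(6) that unfolding homeomorphism_def by auto
  have g: "(g has_derivative (\<lambda>b. matrix_inv (E (g y)) *v b)) (at y)" if y: "y \<in> V" for y
  proof -
    obtain g' where g': "(g has_derivative g') (at y)" using g_diff y unfolding differentiable_def by blast
    have gS: "g y \<in> S" using gW[OF y] WV(2) by blast
    have "((\<lambda>y. y) has_derivative (\<lambda>b. E (g y) *v g' b)) (at y)"
      by (rule has_derivative_transform_within_open[OF has_derivative_compose[OF g' f[OF gS]] WV(4) y]) (simp add: gW)
    then have "(\<lambda>b. E (g y) *v g' b) = (\<lambda>b. b)" using has_derivative_unique has_derivative_ident by blast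
    then have "g' b = matrix_inv (E (g y)) *v b" for b
      using matrix_inv_vector_mult(1)[OF inv[OF gS], of "g' b"] by metis
    then show ?thesis using g' by presburger
  qed
  have inv_smooth: "smooth_on W (\<lambda>x. (matrix_inv (E x) *v b) \<bullet> c)" for b c
    unfolding inner_vec_def matrix_vector_mult_def
    using smooth_on_matrix_inv[OF S(1) E inv]
    by (simp, intro smooth_on_sum smooth_on_mult smooth_on_const WV(1)) (blast intro: smooth_on_subset[OF _ WV(2)])
  have "smooth_on V (\<lambda>y. g y $ k)" for k
    by (rule smooth_on_compose_if_derivative_of_value[OF WV(4,1) gW(1) g inv_smooth, where h="\<lambda>x. x $ k"])
       (auto intro: smooth_on_bounded_linear[OF WV(1) bounded_linear_vec_nth])
  then show ?thesis using that[OF WV(1,3,2,4,6) f_smooth] unfolding smooth_map_on_vec_iff by blast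
qed

lemma
  fixes Q :: "'a::euclidean_space \<times> (real^'n) \<Rightarrow> real^'n"
  assumes S: "open S" and Q: "\<And>i. smooth_on S (\<lambda>z. Q z $ i)"
  shows smooth_map_on_fst_pair: "smooth_map_on S (\<lambda>z. (fst z, Q z))"
    and fst_pair_has_derivative: "z \<in> S \<Longrightarrow> ((\<lambda>z. (fst z, Q z)) has_derivative (\<lambda>v. (fst v, vpd v Q z))) (at z)"
    and inj_fst_pair_derivative_iff:
      "z \<in> S \<Longrightarrow> inj (\<lambda>v. (fst v, vpd v Q z)) \<longleftrightarrow> (\<forall>m. vpd (0, m) Q z = 0 \<longrightarrow> m = 0)"
proof -
  show "smooth_map_on S (\<lambda>z. (fst z, Q z))"
    unfolding smooth_map_on_def
  proof
    fix b :: "'a \<times> (real^'n)"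
    have "(\<lambda>z. (fst z, Q z) \<bullet> b) = (\<lambda>z. fst z \<bullet> fst b + (\<Sum>i\<in>UNIV. Q z $ i * snd b $ i))"
      by (simp add: inner_prod_def inner_vec_def fun_eq_iff)
    moreover have "smooth_on S (\<lambda>z. fst z \<bullet> fst b)"
      by (rule smooth_on_bounded_linear[OF S bounded_linear_compose[OF bounded_linear_inner_left bounded_linear_fst]])
    ultimately show "smooth_on S (\<lambda>z. (fst z, Q z) \<bullet> b)"
      by (simp add: smooth_on_add smooth_on_sum smooth_on_mult smooth_on_const S Q)
  qed
  assume z: "z \<in> S"
  show D: "((\<lambda>z. (fst z, Q z)) has_derivative (\<lambda>v. (fst v, vpd v Q z))) (at z)"
    by (intro has_derivative_Pair has_derivative_vpd smooth_on_imp_differentiable[OF Q S z])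
       (auto intro!: derivative_eq_intros)
  show "inj (\<lambda>v. (fst v, vpd v Q z)) \<longleftrightarrow> (\<forall>m. vpd (0, m) Q z = 0 \<longrightarrow> m = 0)"
    unfolding linear_injective_0[OF has_derivative_linear[OF D]] by (auto simp: prod_eq_iff)
qed

lemma implicit_function:
  fixes Q :: "'a::euclidean_space \<times> (real^'n) \<Rightarrow> real^'n"
  assumes S: "open S" "(x0, y0) \<in> S" and Q: "\<And>i. smooth_on S (\<lambda>z. Q z $ i)"
    and inj: "\<And>m. vpd (0, m) Q (x0, y0) = 0 \<Longrightarrow> m = 0"
  obtains X e where "open X" "x0 \<in> X" "\<And>x. x \<in> X \<Longrightarrow> (x, e x) \<in> S" "\<And>x. x \<in> X \<Longrightarrow> Q (x, e x) = Q (x0, y0)"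
    "\<And>x. x \<in> X \<Longrightarrow> e differentiable (at x)" "\<And>x m. x \<in> X \<Longrightarrow> vpd (0, m) Q (x, e x) = 0 \<Longrightarrow> m = 0"
proof -
  let ?\<Phi> = "\<lambda>z. (fst z, Q z)" and ?D = "\<lambda>z v. (fst v, vpd v Q z)"
  note \<Phi>_smooth = smooth_map_on_fst_pair[OF S(1) Q] and \<Phi>_D = fst_pair_has_derivative[OF S(1) Q]
    and inj_iff = inj_fst_pair_derivative_iff[OF S(1) Q]
  have inj0: "inj (?D (x0, y0))" using inj inj_iff[OF S(2)] by blast
  obtain S' V g where "open S'" and S': "S' \<subseteq> S" "(x0, y0) \<in> S'" "open V" "?\<Phi> (x0, y0) \<in> V" "homeomorphism S' V ?\<Phi> g"
    and g_diff: "\<forall>y\<in>V. g differentiable (at y)" and D_inj: "\<forall>z\<in>S'. inj (?D z)"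
    by (rule local_inverse_function[OF S(1) \<Phi>_smooth S(2) \<Phi>_D inj0])
  define w where "w = Q (x0, y0)"
  define X where "X = (\<lambda>x. (x, w)) -` V"
  define e where "e x = snd (g (x, w))" for x
  have e: "(x, e x) \<in> S'" "Q (x, e x) = w" if "x \<in> X" for x
  proof -
    have "g (x, w) \<in> S'" "?\<Phi> (g (x, w)) = (x, w)" using S'(5) that unfolding homeomorphism_def X_def by auto
    moreover from this(2) have "g (x, w) = (x, e x)" "Q (g (x, w)) = w" by (auto simp: e_def prod_eq_iff)
    ultimately show "(x, e x) \<in> S'" "Q (x, e x) = w" by simp_all
  qed
  show ?thesis
  proof (rule that[of X e])
    show "open X" unfolding X_def by (intro continuous_open_vimage S'(3)) (auto intro!: continuous_intros)
    show "x0 \<in> X" using S'(4) by (simp add: X_def w_def)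
    fix x assume x: "x \<in> X"
    show "(x, e x) \<in> S" "Q (x, e x) = Q (x0, y0)" using e[OF x] S'(1) by (auto simp: w_def)
    obtain g' where g': "(g has_derivative g') (at (x, w))"
      using g_diff x unfolding X_def differentiable_def by blast
    have "((\<lambda>x. (x, w)) has_derivative (\<lambda>v. (v, 0))) (at x)" by (auto intro!: derivative_eq_intros)
    from has_derivative_snd[OF has_derivative_compose[OF this g']]
    show "e differentiable (at x)" unfolding e_def[abs_def] differentiable_def by blast
    show "m = 0" if "vpd (0, m) Q (x, e x) = 0" for m
      using D_inj e(1)[OF x] inj_iff S'(1) that by blast
  qed
qed

section \<open>The geodesic spray in a chart\<close>

lemma Basis_axis_pair [simp]:
  "(axis i (1::real), 0) \<in> Basis" "(0, axis i (1::real)) \<in> Basis"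
  by (auto simp: Basis_prod_def axis_in_Basis_iff)

definition grad_x :: "((real^'n) \<times> (real^'n) \<Rightarrow> real) \<Rightarrow> (real^'n) \<times> (real^'n) \<Rightarrow> real^'n" where
  "grad_x f z = (\<chi> k. DX k f z)"

definition grad_y :: "((real^'n) \<times> (real^'n) \<Rightarrow> real) \<Rightarrow> (real^'n) \<times> (real^'n) \<Rightarrow> real^'n" where
  "grad_y f z = (\<chi> k. DY k f z)"

lemma grad_nth [simp]: "grad_x f z $ k = DX k f z" "grad_y f z $ k = DY k f z"
  by (simp_all add: grad_x_def grad_y_def)

lemma pd_pair:
  assumes "f differentiable (at z)"
  shows "pd (a, b) f z = a \<bullet> grad_x f z + b \<bullet> grad_y f z"
proof -
  note lin = linear_pd[OF assms]
  have expand: "(\<Sum>k\<in>UNIV. v $ k *\<^sub>R axis k 1) = v" for v :: "real^'n"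
    by (simp add: basis_expansion flip: scalar_mult_eq_scaleR)
  have "(a, b) = (\<Sum>k\<in>UNIV. a $ k *\<^sub>R (axis k 1, 0)) + (\<Sum>k\<in>UNIV. b $ k *\<^sub>R (0, axis k 1))"
    by (simp add: prod_eq_iff fst_sum snd_sum expand)
  then have "pd (a, b) f z = pd ((\<Sum>k\<in>UNIV. a $ k *\<^sub>R (axis k 1, 0)) + (\<Sum>k\<in>UNIV. b $ k *\<^sub>R (0, axis k 1))) f z"
    by simp
  also have "\<dots> = (\<Sum>k\<in>UNIV. a $ k * pd (axis k 1, 0) f z) + (\<Sum>k\<in>UNIV. b $ k * pd (0, axis k 1) f z)"
    unfolding linear_add[OF lin] linear_sum[OF lin] linear_cmul[OF lin] by simp
  finally show ?thesis by (simp add: inner_vec_def DX_def DY_def)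
qed

lemma bounded_linear_snd_nth: "bounded_linear (\<lambda>z::(real^'n) \<times> (real^'n). snd z $ k)"
  by (rule bounded_linear_compose[OF bounded_linear_vec_nth bounded_linear_snd])

lemma pd_snd_nth: "pd v (\<lambda>z::(real^'n) \<times> (real^'n). snd z $ k) z = snd v $ k"
  by (rule pd_eqI[OF bounded_linear_imp_has_derivative[OF bounded_linear_snd_nth]])

locale finsler_chart =
  fixes F :: "('m, 'n::finite) tbfun" and c :: "('m, 'n) chart"
  assumes open_U: "open (snd c ` fst c)"
    and F_nonneg: "x \<in> snd c ` fst c \<Longrightarrow> Floc F c (x, y) \<ge> 0"
    and F_scale: "x \<in> snd c ` fst c \<Longrightarrow> t > 0 \<Longrightarrow> Floc F c (x, t *\<^sub>R y) = t * Floc F c (x, y)"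
    and smooth_F: "smooth_on (snd c ` fst c \<times> (UNIV - {0})) (Floc F c)"
    and gform_pos: "x \<in> snd c ` fst c \<Longrightarrow> y \<noteq> 0 \<Longrightarrow> v \<noteq> 0 \<Longrightarrow> gform F c (x, y) v v > 0"
begin

abbreviation "U \<equiv> snd c ` fst c"
abbreviation "TU0 \<equiv> U \<times> (UNIV - {0::real^'n})"
abbreviation "smooth \<equiv> smooth_on TU0"
abbreviation "L \<equiv> Lsq F c"
abbreviation "G \<equiv> spray F c"
abbreviation "g \<equiv> gten F c"
abbreviation "N i j \<equiv> DY i (G j)"

lemma TU0_iff: "z \<in> TU0 \<longleftrightarrow> fst z \<in> U \<and> snd z \<noteq> 0"
  by (cases z) auto

lemma open_TU0: "open TU0"
  by (intro open_Times open_U open_Diff) auto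

lemmas smooth_arith =
  smooth_on_const[OF open_TU0] smooth_on_add[OF open_TU0] smooth_on_diff[OF open_TU0] smooth_on_mult[OF open_TU0]
  smooth_on_sum[OF open_TU0] smooth_on_power[OF open_TU0] smooth_on_inverse[OF open_TU0]

lemma smooth_imp_differentiable: "smooth f \<Longrightarrow> z \<in> TU0 \<Longrightarrow> f differentiable (at z)"
  using smooth_on_imp_differentiable open_TU0 by blast

lemma smooth_imp_continuous_on: "smooth f \<Longrightarrow> continuous_on TU0 f"
  using smooth_on_imp_continuous_on open_TU0 by blast

lemma smooth_DX: "smooth f \<Longrightarrow> smooth (DX i f)" and smooth_DY: "smooth f \<Longrightarrow> smooth (DY i f)"
  unfolding DX_def DY_def by (auto intro: smooth_on_pd)

lemma smooth_snd_nth: "smooth (\<lambda>z. snd z $ k)"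
  by (rule smooth_on_bounded_linear[OF open_TU0 bounded_linear_snd_nth])

lemma smooth_L: "smooth L"
  unfolding Lsq_def[abs_def] by (intro smooth_arith smooth_F)

lemma smooth_g: "smooth (g i j)"
  unfolding gten_def[abs_def] by (intro smooth_arith smooth_DY smooth_L)

lemma DX_DY_commute: "smooth f \<Longrightarrow> z \<in> TU0 \<Longrightarrow> DX i (DY j f) z = DY j (DX i f) z"
  and DY_DY_commute: "smooth f \<Longrightarrow> z \<in> TU0 \<Longrightarrow> DY i (DY j f) z = DY j (DY i f) z"
  unfolding DX_def DY_def using pd_commute[OF open_TU0] by auto

lemma pd_cong: "(\<And>z. z \<in> TU0 \<Longrightarrow> f z = h z) \<Longrightarrow> z \<in> TU0 \<Longrightarrow> pd v f z = pd v h z"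
  by (rule pd_cong_open[OF open_TU0]; blast)

lemma DX_cong: "(\<And>z. z \<in> TU0 \<Longrightarrow> f z = h z) \<Longrightarrow> z \<in> TU0 \<Longrightarrow> DX i f z = DX i h z"
  and DY_cong: "(\<And>z. z \<in> TU0 \<Longrightarrow> f z = h z) \<Longrightarrow> z \<in> TU0 \<Longrightarrow> DY i f z = DY i h z"
  unfolding DX_def DY_def by (rule pd_cong; blast)+

subsection \<open>The fundamental tensor\<close>

lemma g_sym: "z \<in> TU0 \<Longrightarrow> g i j z = g j i z"
  unfolding gten_def using DY_DY_commute[OF smooth_L] by simp

definition gmat :: "(real^'n) \<times> (real^'n) \<Rightarrow> real^'n^'n" where
  "gmat z = (\<chi> i j. g i j z)"

lemma gmat_nth [simp]: "gmat z $ i $ j = g i j z"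
  by (simp add: gmat_def)

lemma gform_eq: "gform F c z u v = u \<bullet> (gmat z *v v)"
  by (simp add: gform_def inner_vec_def matrix_vector_mult_def sum_distrib_left mult_ac)

lemma gmat_posdef: "z \<in> TU0 \<Longrightarrow> v \<noteq> 0 \<Longrightarrow> v \<bullet> (gmat z *v v) > 0"
  using gform_pos[of "fst z" "snd z" v] by (simp add: gform_eq TU0_iff)

lemma transpose_gmat: "z \<in> TU0 \<Longrightarrow> transpose (gmat z) = gmat z"
  by (simp add: transpose_def vec_eq_iff g_sym)

lemma gmat_invertible: "z \<in> TU0 \<Longrightarrow> invertible (gmat z)"
  by (rule invertible_if_posdef[OF gmat_posdef])

lemma det_gmat_nonzero: "z \<in> TU0 \<Longrightarrow> det (gmat z) \<noteq> 0"
  using gmat_invertible invertible_det_nz by blast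

lemma smooth_gmat: "smooth (\<lambda>z. gmat z $ i $ j)"
  using smooth_g by simp

lemma differentiable_gmat: "z \<in> TU0 \<Longrightarrow> (\<lambda>z. gmat z $ i $ j) differentiable (at z)"
  by (rule smooth_imp_differentiable[OF smooth_gmat])

lemma ginv_eq: "ginv F c = (\<lambda>z. matrix_inv (gmat z))"
  by (simp add: ginv_def gmat_def fun_eq_iff)

lemma smooth_ginv: "smooth (\<lambda>z. ginv F c z $ i $ j)"
  unfolding ginv_eq by (rule smooth_on_matrix_inv[OF open_TU0 smooth_gmat gmat_invertible])

lemma gmat_ginv: "z \<in> TU0 \<Longrightarrow> gmat z ** ginv F c z = mat 1"
  and ginv_gmat: "z \<in> TU0 \<Longrightarrow> ginv F c z ** gmat z = mat 1"
  by (simp_all add: ginv_eq gmat_invertible matrix_inv_right matrix_inv_left)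

lemma transpose_ginv: "z \<in> TU0 \<Longrightarrow> transpose (ginv F c z) = ginv F c z"
  unfolding ginv_eq by (metis gmat_invertible matrix_inv_transpose transpose_gmat)

lemma ginv_sym:
  assumes "z \<in> TU0"
  shows "ginv F c z $ i $ j = ginv F c z $ j $ i"
  using arg_cong[OF transpose_ginv[OF assms], of "\<lambda>B. B $ j $ i"] by (simp add: transpose_def)

lemma ginv_posdef: "z \<in> TU0 \<Longrightarrow> v \<noteq> 0 \<Longrightarrow> v \<bullet> (ginv F c z *v v) > 0"
  unfolding ginv_eq by (rule posdef_matrix_inv[OF gmat_posdef])

lemma mpd_ginv:
  assumes "z \<in> TU0"
  shows "mpd v (ginv F c) z = - (ginv F c z ** mpd v gmat z ** ginv F c z)"
  unfolding ginv_eq by (rule mpd_matrix_inv[OF open_TU0 smooth_gmat gmat_invertible assms])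

lemma smooth_G: "smooth (G i)"
  unfolding spray_def[abs_def] by (intro smooth_arith smooth_ginv smooth_snd_nth smooth_DX smooth_DY smooth_L)

lemma smooth_N: "smooth (N i j)"
  by (intro smooth_DY smooth_G)

subsection \<open>Homogeneity\<close>

definition homogeneous_deg :: "real \<Rightarrow> ((real^'n) \<times> (real^'n) \<Rightarrow> real) \<Rightarrow> bool" where
  "homogeneous_deg r f \<longleftrightarrow> (\<forall>x\<in>U. \<forall>y. y \<noteq> 0 \<longrightarrow> (\<forall>t>0. f (x, t *\<^sub>R y) = t powr r * f (x, y)))"

lemma homogeneous_degD:
  "homogeneous_deg r f \<Longrightarrow> x \<in> U \<Longrightarrow> y \<noteq> 0 \<Longrightarrow> t > 0 \<Longrightarrow> f (x, t *\<^sub>R y) = t powr r * f (x, y)"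
  by (auto simp: homogeneous_deg_def)

lemma pd_homogeneous:
  assumes f: "smooth f" "homogeneous_deg r f" and x: "x \<in> U" "y \<noteq> 0" and t: "t > 0"
  shows "pd (a, t *\<^sub>R b) f (x, t *\<^sub>R y) = t powr r * pd (a, b) f (x, y)"
proof -
  have z: "(x, y) \<in> TU0" "(x, t *\<^sub>R y) \<in> TU0" using x t by auto
  have dilation: "((\<lambda>z. (fst z, t *\<^sub>R snd z)) has_derivative (\<lambda>v. (fst v, t *\<^sub>R snd v))) (at (x, y))"
    by (auto intro!: derivative_eq_intros)
  have "pd (a, b) (\<lambda>z. f (fst z, t *\<^sub>R snd z)) (x, y) = pd (a, t *\<^sub>R b) f (x, t *\<^sub>R y)"
    using pd_chain[OF dilation, of f "(a,b)"] smooth_imp_differentiable[OF f(1) z(2)] by simp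
  moreover have "pd (a, b) (\<lambda>z. f (fst z, t *\<^sub>R snd z)) (x, y) = pd (a, b) (\<lambda>z. t powr r * f z) (x, y)"
    by (rule pd_cong[OF _ z(1)]) (use homogeneous_degD[OF f(2) _ _ t] in \<open>auto simp: TU0_iff\<close>)
  ultimately show ?thesis using pd_cmult[OF smooth_imp_differentiable[OF f(1) z(1)]] by simp
qed

lemma homogeneous_DX: "smooth f \<Longrightarrow> homogeneous_deg r f \<Longrightarrow> homogeneous_deg r (DX i f)"
  unfolding homogeneous_deg_def[of _ "DX i f"] using pd_homogeneous[of f r _ _ _ _ 0] by (simp add: DX_def)

lemma homogeneous_DY:
  assumes "smooth f" "homogeneous_deg r f"
  shows "homogeneous_deg (r - 1) (DY i f)"
  unfolding homogeneous_deg_def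
proof (intro ballI allI impI)
  fix x y :: "real^'n" and t :: real assume x: "x \<in> U" "y \<noteq> 0" and t: "t > 0"
  have z: "(x, t *\<^sub>R y) \<in> TU0" using x t by auto
  have "t * DY i f (x, t *\<^sub>R y) = pd (0, t *\<^sub>R axis i 1) f (x, t *\<^sub>R y)"
    using linear_cmul[OF linear_pd[OF smooth_imp_differentiable[OF assms(1) z]], of t "(0, axis i 1)"]
    by (simp add: DY_def)
  also have "\<dots> = t powr r * DY i f (x, y)"
    unfolding DY_def by (rule pd_homogeneous[OF assms x t])
  finally show "DY i f (x, t *\<^sub>R y) = t powr (r - 1) * DY i f (x, y)"
    using t by (simp add: powr_diff field_simps)
qed

lemma euler_homogeneous:
  assumes "smooth f" "homogeneous_deg r f" "z \<in> TU0"
  shows "snd z \<bullet> grad_y f z = r * f z"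
proof -
  obtain x y where z: "z = (x, y)" "x \<in> U" "y \<noteq> 0" using assms(3) by auto
  have diff: "f differentiable (at (x, 1 *\<^sub>R y))" using smooth_imp_differentiable[OF assms(1,3)] z by simp
  have "((\<lambda>t::real. (x, t *\<^sub>R y)) has_derivative (\<lambda>s. (0, s *\<^sub>R y))) (at 1)"
    by (auto intro!: derivative_eq_intros)
  from has_derivative_compose[OF this pd_has_derivative[OF diff]]
  have "((\<lambda>t. f (x, t *\<^sub>R y)) has_derivative (\<lambda>s. pd (0, s *\<^sub>R y) f (x, y))) (at 1)" by simp
  moreover have "(\<lambda>s. pd (0, s *\<^sub>R y) f (x, y)) = times (pd (0, y) f (x, y))"
    using linear_cmul[OF linear_pd[OF diff], of _ "(0, y)"] by (auto simp: fun_eq_iff)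
  ultimately have "((\<lambda>t. f (x, t *\<^sub>R y)) has_real_derivative pd (0, y) f (x, y)) (at 1)"
    by (simp add: has_field_derivative_def)
  moreover have "((\<lambda>t. t powr r * f (x, y)) has_real_derivative r * f (x, y)) (at 1)"
    by (auto intro!: derivative_eq_intros)
  then have "((\<lambda>t. f (x, t *\<^sub>R y)) has_real_derivative r * f (x, y)) (at 1)"
    by (rule has_field_derivative_transform_within_open[where S="{0<..}"])
       (use homogeneous_degD[OF assms(2) z(2,3)] in auto)
  ultimately have "pd (0, y) f (x, y) = r * f (x, y)" by (rule DERIV_unique)
  then show ?thesis using pd_pair[OF smooth_imp_differentiable[OF assms(1,3)], of 0 y] z by simp
qed

lemma homogeneous_mult:
  "homogeneous_deg r f \<Longrightarrow> homogeneous_deg s h \<Longrightarrow> homogeneous_deg (r + s) (\<lambda>z. f z * h z)"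
  unfolding homogeneous_deg_def by (auto simp: powr_add)

lemma homogeneous_cmult: "homogeneous_deg r f \<Longrightarrow> homogeneous_deg r (\<lambda>z. k * f z)"
  unfolding homogeneous_deg_def by auto

lemma homogeneous_sum:
  "(\<And>i. i \<in> I \<Longrightarrow> homogeneous_deg r (f i)) \<Longrightarrow> homogeneous_deg r (\<lambda>z. \<Sum>i\<in>I. f i z)"
  unfolding homogeneous_deg_def by (auto simp: sum_distrib_left)

lemma homogeneous_add: "homogeneous_deg r f \<Longrightarrow> homogeneous_deg r h \<Longrightarrow> homogeneous_deg r (\<lambda>z. f z + h z)"
  unfolding homogeneous_deg_def by (auto simp: distrib_left)

lemma homogeneous_diff: "homogeneous_deg r f \<Longrightarrow> homogeneous_deg r h \<Longrightarrow> homogeneous_deg r (\<lambda>z. f z - h z)"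
  unfolding homogeneous_deg_def by (auto simp: right_diff_distrib)

lemma homogeneous_snd_nth: "homogeneous_deg 1 (\<lambda>z. snd z $ k)"
  unfolding homogeneous_deg_def by auto

lemma homogeneous_F: "homogeneous_deg 1 (Floc F c)"
  unfolding homogeneous_deg_def by (auto simp: F_scale)

lemma homogeneous_L: "homogeneous_deg 2 L"
  using homogeneous_mult[OF homogeneous_F homogeneous_F] unfolding Lsq_def[abs_def] by (simp add: power2_eq_square)

lemma homogeneous_DY_L: "homogeneous_deg 1 (DY i L)"
  using homogeneous_DY[OF smooth_L homogeneous_L] by simp

lemma homogeneous_g: "homogeneous_deg 0 (g i j)"
  unfolding gten_def[abs_def] using homogeneous_DY[OF smooth_DY[OF smooth_L] homogeneous_DY_L]
  by (intro homogeneous_cmult) simp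

lemma gmat_scale: "x \<in> U \<Longrightarrow> y \<noteq> 0 \<Longrightarrow> t > 0 \<Longrightarrow> gmat (x, t *\<^sub>R y) = gmat (x, y)"
  using homogeneous_degD[OF homogeneous_g] by (simp add: gmat_def)

lemma homogeneous_ginv: "homogeneous_deg 0 (\<lambda>z. ginv F c z $ i $ j)"
  unfolding homogeneous_deg_def ginv_eq by (auto simp: gmat_scale)

lemma homogeneous_G: "homogeneous_deg 2 (G i)"
proof -
  have "homogeneous_deg (0 + 2) (\<lambda>z. ginv F c z $ i $ l * ((\<Sum>k\<in>UNIV. DX k (DY l L) z * snd z $ k) - DX l L z))" for l
  proof (intro homogeneous_mult homogeneous_ginv homogeneous_diff homogeneous_sum)
    show "homogeneous_deg 2 (\<lambda>z. DX k (DY l L) z * snd z $ k)" for k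
      using homogeneous_mult[OF homogeneous_DX[OF smooth_DY[OF smooth_L] homogeneous_DY_L] homogeneous_snd_nth] by simp
    show "homogeneous_deg 2 (DX l L)" by (intro homogeneous_DX smooth_L homogeneous_L)
  qed
  then show ?thesis unfolding spray_def[abs_def] by (intro homogeneous_cmult homogeneous_sum) simp
qed

lemma homogeneous_N: "homogeneous_deg 1 (N i j)"
  using homogeneous_DY[OF smooth_G homogeneous_G] by simp

lemma gmat_mult_snd:
  assumes "z \<in> TU0"
  shows "gmat z *v snd z = (1/2) *\<^sub>R grad_y L z"
proof -
  have "(gmat z *v snd z) $ i = 1/2 * (snd z \<bullet> grad_y (DY i L) z)" for i
    unfolding matrix_vector_mult_def inner_vec_def gmat_def gten_def
    using DY_DY_commute[OF smooth_L assms, of i] by (simp add: sum_distrib_left mult_ac)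
  then show ?thesis
    using euler_homogeneous[OF smooth_DY[OF smooth_L] homogeneous_DY_L assms] by (simp add: vec_eq_iff)
qed

lemma grad_y_L_snd: "z \<in> TU0 \<Longrightarrow> snd z \<bullet> grad_y L z = 2 * L z"
  using euler_homogeneous[OF smooth_L homogeneous_L] by simp

lemma L_pos:
  assumes "z \<in> TU0"
  shows "L z > 0"
proof -
  have "snd z \<bullet> (gmat z *v snd z) = L z"
    unfolding gmat_mult_snd[OF assms] using grad_y_L_snd[OF assms] by simp
  then show ?thesis using gmat_posdef[OF assms, of "snd z"] assms by (simp add: TU0_iff)
qed

lemma F_pos: "z \<in> TU0 \<Longrightarrow> Floc F c z > 0"
  using L_pos[of z] F_nonneg[of "fst z" "snd z"] unfolding Lsq_def by (cases z) (auto simp: less_le)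

lemma F_zero: "x \<in> U \<Longrightarrow> Floc F c (x, 0) = 0"
  using F_scale[of x 2 0] by simp

lemma L_zero: "x \<in> U \<Longrightarrow> L (x, 0) = 0"
  by (simp add: Lsq_def F_zero)

subsection \<open>The spray as a vector field\<close>

definition Gvec :: "(real^'n) \<times> (real^'n) \<Rightarrow> real^'n" where
  "Gvec z = (\<chi> k. G k z)"

definition Nmat :: "(real^'n) \<times> (real^'n) \<Rightarrow> real^'n^'n" where
  "Nmat z = (\<chi> i j. N i j z)"

definition spray_vec :: "(real^'n) \<times> (real^'n) \<Rightarrow> (real^'n) \<times> (real^'n)" where
  "spray_vec z = (snd z, - 2 *\<^sub>R Gvec z)"

definition spray_deriv :: "((real^'n) \<times> (real^'n) \<Rightarrow> real) \<Rightarrow> (real^'n) \<times> (real^'n) \<Rightarrow> real" where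
  "spray_deriv f z = pd (spray_vec z) f z"

lemma vpd_Gvec_eq:
  "vpd (0, axis i 1) Gvec z = Nmat z $ i" "vpd (axis i 1, 0) Gvec z = (\<chi> j. DX i (G j) z)"
  by (simp_all add: Gvec_def Nmat_def vec_eq_iff DX_def DY_def)

lemma spray_deriv_eq:
  "f differentiable (at z) \<Longrightarrow> spray_deriv f z = snd z \<bullet> grad_x f z - 2 * (Gvec z \<bullet> grad_y f z)"
  unfolding spray_deriv_def spray_vec_def by (simp add: pd_pair)

lemma smooth_spray_deriv:
  assumes f: "smooth f"
  shows "smooth (spray_deriv f)"
proof (rule smooth_on_cong[OF open_TU0])
  show "smooth (\<lambda>z. snd z \<bullet> grad_x f z - 2 * (Gvec z \<bullet> grad_y f z))"
    unfolding inner_vec_def Gvec_def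
    by (simp, intro smooth_arith smooth_snd_nth smooth_DX smooth_DY smooth_G f)
qed (simp add: spray_deriv_eq smooth_imp_differentiable f)

lemma homogeneous_spray_deriv:
  assumes f: "smooth f" "homogeneous_deg r f"
  shows "homogeneous_deg (r + 1) (spray_deriv f)"
proof -
  have "homogeneous_deg (1 + r) (\<lambda>z. snd z $ k * DX k f z)" for k
    by (intro homogeneous_mult homogeneous_snd_nth homogeneous_DX f)
  moreover have "homogeneous_deg (2 + (r - 1)) (\<lambda>z. G k z * DY k f z)" for k
    by (intro homogeneous_mult homogeneous_G homogeneous_DY f)
  ultimately have "homogeneous_deg (r + 1) (\<lambda>z. snd z \<bullet> grad_x f z - 2 * (Gvec z \<bullet> grad_y f z))"
    unfolding inner_vec_def Gvec_def
    by (simp, intro homogeneous_diff homogeneous_cmult homogeneous_sum) (simp_all add: add.commute)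
  then show ?thesis
    unfolding homogeneous_deg_def by (auto simp: spray_deriv_eq smooth_imp_differentiable f)
qed

lemma spray_deriv_cong: "(\<And>z. z \<in> TU0 \<Longrightarrow> f z = h z) \<Longrightarrow> z \<in> TU0 \<Longrightarrow> spray_deriv f z = spray_deriv h z"
  unfolding spray_deriv_def by (rule pd_cong)

lemma spray_deriv_mult:
  "smooth f \<Longrightarrow> smooth h \<Longrightarrow> z \<in> TU0 \<Longrightarrow> spray_deriv (\<lambda>z. f z * h z) z = spray_deriv f z * h z + f z * spray_deriv h z"
  unfolding spray_deriv_def by (simp add: smooth_imp_differentiable pd_mult)

lemma spray_vec_has_derivative:
  assumes "z \<in> TU0"
  shows "(spray_vec has_derivative (\<lambda>v. (snd v, - 2 *\<^sub>R vpd v Gvec z))) (at z)"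
  unfolding spray_vec_def[abs_def]
  by (intro has_derivative_Pair has_derivative_scaleR_right has_derivative_vpd)
     (auto intro!: derivative_eq_intros smooth_imp_differentiable[OF smooth_G] assms simp: Gvec_def)

lemma grad_y_spray_deriv:
  assumes f: "smooth f" and z: "z \<in> TU0"
  shows "grad_y (spray_deriv f) z = vpd (spray_vec z) (grad_y f) z + grad_x f z - 2 *\<^sub>R (Nmat z *v grad_y f z)"
proof (subst vec_eq_iff, intro allI)
  fix i
  have "DY i (spray_deriv f) z = spray_deriv (DY i f) z + pd (axis i 1, - 2 *\<^sub>R Nmat z $ i) f z"
    using pd_pd_vector_field[OF open_TU0 f z _ spray_vec_has_derivative[OF z], of "(0, axis i 1)"]
    by (simp add: DY_def spray_deriv_def[abs_def] vpd_Gvec_eq)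
  then show "grad_y (spray_deriv f) z $ i
      = (vpd (spray_vec z) (grad_y f) z + grad_x f z - 2 *\<^sub>R (Nmat z *v grad_y f z)) $ i"
    by (simp add: spray_deriv_def pd_pair[OF smooth_imp_differentiable[OF f z]] inner_axis' matrix_vector_mul_component)
qed

lemma grad_x_spray_deriv:
  assumes f: "smooth f" and z: "z \<in> TU0"
  shows "grad_x (spray_deriv f) z = vpd (spray_vec z) (grad_x f) z - 2 *\<^sub>R (\<chi> i. \<Sum>j\<in>UNIV. DX i (G j) z * DY j f z)"
proof (subst vec_eq_iff, intro allI)
  fix i
  have "DX i (spray_deriv f) z = spray_deriv (DX i f) z + pd (0, - 2 *\<^sub>R vpd (axis i 1, 0) Gvec z) f z"
    using pd_pd_vector_field[OF open_TU0 f z _ spray_vec_has_derivative[OF z], of "(axis i 1, 0)"]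
    by (simp add: DX_def spray_deriv_def[abs_def])
  then show "grad_x (spray_deriv f) z $ i
      = (vpd (spray_vec z) (grad_x f) z - 2 *\<^sub>R (\<chi> i. \<Sum>j\<in>UNIV. DX i (G j) z * DY j f z)) $ i"
    by (simp add: spray_deriv_def pd_pair[OF smooth_imp_differentiable[OF f z]] inner_vec_def vpd_Gvec_eq
        sum_negf sum_distrib_left mult.assoc)
qed

lemma grad_y_DY_L: "z \<in> TU0 \<Longrightarrow> v \<bullet> grad_y (DY l L) z = 2 * (gmat z *v v) $ l"
  using DY_DY_commute[OF smooth_L, of z l]
  by (simp add: inner_vec_def matrix_vector_mult_def gmat_def gten_def sum_distrib_left mult_ac)

lemma euler_lagrange:
  assumes z: "z \<in> TU0"
  shows "vpd (spray_vec z) (grad_y L) z = grad_x L z"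
proof -
  define e where "e = (\<chi> l. (\<Sum>k\<in>UNIV. DX k (DY l L) z * snd z $ k) - DX l L z)"
  have "Gvec z = (1/4) *\<^sub>R (ginv F c z *v e)"
    by (simp add: vec_eq_iff Gvec_def spray_def e_def matrix_vector_mult_def)
  then have gG: "gmat z *v Gvec z = (1/4) *\<^sub>R e"
    by (simp add: matrix_vector_mult_scaleR matrix_vector_mul_assoc gmat_ginv z)
  have "spray_deriv (DY l L) z = DX l L z" for l
    unfolding spray_deriv_eq[OF smooth_imp_differentiable[OF smooth_DY[OF smooth_L] z]] grad_y_DY_L[OF z] gG
    by (simp add: e_def inner_vec_def mult.commute diff_divide_distrib)
  then show ?thesis by (simp add: vec_eq_iff spray_deriv_def)
qed

lemma spray_vec_unique:
  assumes z: "z \<in> TU0" and m: "\<And>l. pd (snd z, m) (DY l L) z = DX l L z"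
  shows "(snd z, m) = spray_vec z"
proof -
  note pair = pd_pair[OF smooth_imp_differentiable[OF smooth_DY[OF smooth_L] z]]
  have "(gmat z *v (m - (- 2 *\<^sub>R Gvec z))) $ l = 0" for l
  proof -
    have "pd (snd z, - 2 *\<^sub>R Gvec z) (DY l L) z = DX l L z"
      using arg_cong[OF euler_lagrange[OF z], of "\<lambda>v. v $ l"] by (simp add: spray_vec_def)
    then have "(m - (- 2 *\<^sub>R Gvec z)) \<bullet> grad_y (DY l L) z = 0"
      using m[of l] unfolding pair by (simp add: inner_diff_left inner_add_left)
    then show ?thesis unfolding grad_y_DY_L[OF z] by simp
  qed
  then have "gmat z *v (m - (- 2 *\<^sub>R Gvec z)) = 0" by (simp add: vec_eq_iff)
  then have "m - (- 2 *\<^sub>R Gvec z) = 0" using gmat_posdef[OF z] by force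
  then show ?thesis by (simp add: spray_vec_def eq_neg_iff_add_eq_0)
qed

text \<open>By homogeneity \<open>L\<close> is half the contraction of its fibre differential with the flagpole, so the
  Euler--Lagrange equations give the spray derivative of \<open>L\<close> as half of itself.\<close>

lemma spray_deriv_L:
  assumes z: "z \<in> TU0"
  shows "spray_deriv L z = 0"
proof -
  have y: "(\<lambda>z. snd z $ i) differentiable (at z)" for i by (rule bounded_linear_imp_differentiable[OF bounded_linear_snd_nth])
  have spray_y: "vpd (spray_vec z) snd z = - 2 *\<^sub>R Gvec z" by (simp add: vec_eq_iff pd_snd_nth spray_vec_def)
  have P: "(\<lambda>z. grad_y L z $ i) differentiable (at z)" for i
    using smooth_imp_differentiable[OF smooth_DY[OF smooth_L] z] by simp
  have "2 * spray_deriv L z = spray_deriv (\<lambda>z. 2 * L z) z"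
    unfolding spray_deriv_def by (rule pd_cmult[OF smooth_imp_differentiable[OF smooth_L z], symmetric])
  also have "\<dots> = spray_deriv (\<lambda>z. snd z \<bullet> grad_y L z) z"
    by (rule spray_deriv_cong[OF _ z]) (simp add: grad_y_L_snd)
  also have "\<dots> = (- 2 *\<^sub>R Gvec z) \<bullet> grad_y L z + snd z \<bullet> grad_x L z"
    unfolding spray_deriv_def pd_inner[OF y P] euler_lagrange[OF z] spray_y ..
  also have "\<dots> = spray_deriv L z" unfolding spray_deriv_eq[OF smooth_imp_differentiable[OF smooth_L z]] by simp
  finally show ?thesis by simp
qed

lemma spray_deriv_F:
  assumes z: "z \<in> TU0"
  shows "spray_deriv (Floc F c) z = 0"
  using spray_deriv_L[OF z] spray_deriv_mult[OF smooth_F smooth_F z] F_pos[OF z]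
  unfolding Lsq_def[abs_def] power2_eq_square by simp

lemma mpd_spray_gmat:
  assumes z: "z \<in> TU0"
  shows "mpd (spray_vec z) gmat z = Nmat z ** gmat z + transpose (Nmat z ** gmat z)"
proof -
  have DY_euler_lagrange: "pd (spray_vec z) (DY i (DY l L)) z + DX i (DY l L) z - 4 * (Nmat z ** gmat z) $ i $ l = DY i (DX l L) z" for i l
  proof -
    have "DY i (spray_deriv (DY l L)) z = DY i (DX l L) z"
      using euler_lagrange by (intro DY_cong z) (simp add: spray_deriv_def vec_eq_iff)
    moreover have "(Nmat z *v grad_y (DY l L) z) $ i = 2 * (Nmat z ** gmat z) $ i $ l"
      using DY_DY_commute[OF smooth_L z, of _ l]
      by (simp add: matrix_vector_mult_def matrix_matrix_mult_def gmat_def gten_def sum_distrib_left mult_ac)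
    ultimately show ?thesis
      using arg_cong[OF grad_y_spray_deriv[OF smooth_DY[OF smooth_L] z, of l], of "\<lambda>v. v $ i"] by simp
  qed
  have "pd (spray_vec z) (g i j) z = (Nmat z ** gmat z) $ i $ j + (Nmat z ** gmat z) $ j $ i" for i j
  proof -
    have "pd (spray_vec z) (g i j) z = 1/2 * pd (spray_vec z) (DY i (DY j L)) z"
      unfolding gten_def[abs_def] by (rule pd_cmult) (intro smooth_imp_differentiable[OF _ z] smooth_DY smooth_L)
    moreover have "pd (spray_vec z) (DY i (DY j L)) z = pd (spray_vec z) (DY j (DY i L)) z"
      by (rule pd_cong[OF _ z]) (rule DY_DY_commute[OF smooth_L])
    ultimately show ?thesis
      using DY_euler_lagrange[of i j] DY_euler_lagrange[of j i] DX_DY_commute[OF smooth_L z] by simp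
  qed
  then show ?thesis by (simp add: vec_eq_iff transpose_def)
qed

subsection \<open>Horizontal derivatives\<close>

definition hor_lift :: "real^'n \<Rightarrow> (real^'n) \<times> (real^'n) \<Rightarrow> (real^'n) \<times> (real^'n)" where
  "hor_lift v z = (v, - (v v* Nmat z))"

definition hor_deriv :: "real^'n \<Rightarrow> ((real^'n) \<times> (real^'n) \<Rightarrow> real) \<Rightarrow> (real^'n) \<times> (real^'n) \<Rightarrow> real" where
  "hor_deriv v f z = pd (hor_lift v z) f z"

definition berwald_coeff :: "'n \<Rightarrow> 'n \<Rightarrow> 'n \<Rightarrow> (real^'n) \<times> (real^'n) \<Rightarrow> real" where
  "berwald_coeff l i k = DY i (N l k)"

lemma hor_deriv_eq: "f differentiable (at z) \<Longrightarrow> hor_deriv v f z = v \<bullet> (grad_x f z - Nmat z *v grad_y f z)"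
  unfolding hor_deriv_def hor_lift_def by (simp add: pd_pair inner_diff_right dot_lmul_matrix)

lemma hor_deriv_L:
  assumes z: "z \<in> TU0"
  shows "hor_deriv v L z = 0"
proof -
  have "DY i (spray_deriv L) z = DY i (\<lambda>_. 0) z" for i by (rule DY_cong[OF spray_deriv_L z])
  then have "grad_y (spray_deriv L) z = 0" by (simp add: vec_eq_iff DY_def)
  then have "grad_x L z = Nmat z *v grad_y L z"
    using grad_y_spray_deriv[OF smooth_L z] euler_lagrange[OF z] by (simp flip: scaleR_2)
  then show ?thesis by (simp add: hor_deriv_eq smooth_imp_differentiable smooth_L z)
qed

lemma smooth_berwald_coeff: "smooth (berwald_coeff l i k)"
  unfolding berwald_coeff_def by (intro smooth_DY smooth_G)

lemma berwald_coeff_sym: "z \<in> TU0 \<Longrightarrow> berwald_coeff l i k z = berwald_coeff i l k z"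
  unfolding berwald_coeff_def by (rule DY_DY_commute[OF smooth_G])

lemma homogeneous_berwald_coeff: "homogeneous_deg 0 (berwald_coeff l i k)"
  unfolding berwald_coeff_def using homogeneous_DY[OF smooth_N homogeneous_N] by simp

lemma DY_hor_deriv:
  assumes f: "smooth f" and z: "z \<in> TU0"
  shows "DY i (hor_deriv (axis l 1) f) z = hor_deriv (axis l 1) (DY i f) z - (\<Sum>k\<in>UNIV. berwald_coeff l i k z * DY k f z)"
proof -
  have row: "axis l 1 v* Nmat z = Nmat z $ l" for z
    using matrix_vector_mult_basis[of "transpose (Nmat z)" l] by (simp add: column_transpose row_def)
  have "(hor_lift (axis l 1) has_derivative (\<lambda>v. (0, - vpd v (\<lambda>z. Nmat z $ l) z))) (at z)"
    unfolding hor_lift_def[abs_def] row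
    by (intro has_derivative_Pair has_derivative_minus has_derivative_vpd has_derivative_const)
       (use smooth_imp_differentiable[OF smooth_N z] in \<open>simp add: Nmat_def\<close>)
  from pd_pd_vector_field[OF open_TU0 f z _ this, of "(0, axis i 1)"]
  have "DY i (hor_deriv (axis l 1) f) z = hor_deriv (axis l 1) (DY i f) z + pd (0, - vpd (0, axis i 1) (\<lambda>z. Nmat z $ l) z) f z"
    by (simp add: DY_def hor_deriv_def[abs_def])
  moreover have "vpd (0, axis i 1) (\<lambda>z. Nmat z $ l) z = (\<chi> k. berwald_coeff l i k z)"
    by (simp add: vec_eq_iff Nmat_def berwald_coeff_def DY_def)
  ultimately show ?thesis
    by (simp add: pd_pair[OF smooth_imp_differentiable[OF f z]] inner_vec_def sum_negf)
qed

lemma hor_deriv_DY_if_hor_const: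
  assumes f: "smooth f" and hor: "\<And>z. z \<in> TU0 \<Longrightarrow> hor_deriv (axis l 1) f z = 0" and z: "z \<in> TU0"
  shows "hor_deriv (axis l 1) (DY i f) z = (\<Sum>k\<in>UNIV. berwald_coeff l i k z * DY k f z)"
proof -
  have "DY i (hor_deriv (axis l 1) f) z = DY i (\<lambda>_. 0) z" by (rule DY_cong[OF hor z])
  then show ?thesis using DY_hor_deriv[OF f z, of i l] by (simp add: DY_def)
qed

subsection \<open>The cometric\<close>

definition cometric :: "(real^'n) \<times> (real^'n) \<Rightarrow> real^'n \<Rightarrow> real^'n \<Rightarrow> real" where
  "cometric z a b = a \<bullet> (ginv F c z *v b)"

definition cov_deriv :: "((real^'n) \<times> (real^'n) \<Rightarrow> real^'n) \<Rightarrow> (real^'n) \<times> (real^'n) \<Rightarrow> real^'n" where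
  "cov_deriv A z = vpd (spray_vec z) A z - Nmat z *v A z"

lemma cometric_pos: "z \<in> TU0 \<Longrightarrow> a \<noteq> 0 \<Longrightarrow> cometric z a a > 0"
  unfolding cometric_def by (rule ginv_posdef)

lemma cometric_nonneg: "z \<in> TU0 \<Longrightarrow> cometric z a a \<ge> 0"
  using cometric_pos[of z a] by (cases "a = 0") (auto simp: cometric_def)

lemma cometric_sym: "z \<in> TU0 \<Longrightarrow> cometric z a b = cometric z b a"
  unfolding cometric_def by (metis dot_lmul_matrix inner_commute transpose_ginv transpose_matrix_vector)

lemma smooth_cometric:
  assumes "\<And>i. smooth (\<lambda>z. A z $ i)" "\<And>i. smooth (\<lambda>z. B z $ i)"
  shows "smooth (\<lambda>z. cometric z (A z) (B z))"
  unfolding cometric_def inner_vec_def matrix_vector_mult_def by (simp, intro smooth_arith smooth_ginv assms)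

lemma homogeneous_cometric:
  assumes "\<And>i. homogeneous_deg r (\<lambda>z. A z $ i)" "\<And>i. homogeneous_deg s (\<lambda>z. B z $ i)"
  shows "homogeneous_deg (r + s) (\<lambda>z. cometric z (A z) (B z))"
proof -
  have "homogeneous_deg (r + (0 + s)) (\<lambda>z. A z $ i * (ginv F c z $ i $ j * B z $ j))" for i j
    by (intro homogeneous_mult homogeneous_ginv assms)
  then show ?thesis
    unfolding cometric_def inner_vec_def matrix_vector_mult_def
    by (simp add: sum_distrib_left) (intro homogeneous_sum, simp)
qed

lemma spray_deriv_cometric:
  assumes A: "\<And>i. smooth (\<lambda>z. A z $ i)" and B: "\<And>i. smooth (\<lambda>z. B z $ i)" and z: "z \<in> TU0"
  shows "spray_deriv (\<lambda>z. cometric z (A z) (B z)) z = cometric z (cov_deriv A z) (B z) + cometric z (A z) (cov_deriv B z)"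
proof -
  let ?v = "spray_vec z"
  let ?H = "ginv F c z"
  have "smooth (\<lambda>z. (ginv F c z *v B z) $ i)" for i
    unfolding matrix_vector_mult_def by (simp, intro smooth_arith smooth_ginv B)
  note diff = smooth_imp_differentiable[OF A z] smooth_imp_differentiable[OF B z]
    smooth_imp_differentiable[OF smooth_ginv z] smooth_imp_differentiable[OF this z]
  have "mpd ?v (ginv F c) z = - (?H ** Nmat z ** (gmat z ** ?H)) - (?H ** gmat z) ** transpose (Nmat z) ** ?H"
    unfolding mpd_ginv[OF z] mpd_spray_gmat[OF z] matrix_transpose_mul transpose_gmat[OF z]
    by (simp add: matrix_add_ldistrib matrix_add_rdistrib matrix_mul_assoc)
  also have "\<dots> = - (?H ** Nmat z) - transpose (Nmat z) ** ?H" by (simp add: gmat_ginv ginv_gmat z)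
  finally have "mpd ?v (ginv F c) z + ?H ** Nmat z + transpose (Nmat z) ** ?H = 0" by simp
  then have "(mpd ?v (ginv F c) z + ?H ** Nmat z + transpose (Nmat z) ** ?H) *v B z = 0" by simp
  then have "A z \<bullet> (mpd ?v (ginv F c) z *v B z) + A z \<bullet> (?H *v (Nmat z *v B z)) + A z \<bullet> (transpose (Nmat z) *v (?H *v B z)) = 0"
    unfolding matrix_vector_mult_add_rdistrib matrix_vector_mul_assoc inner_add_right[symmetric] by (simp only: inner_zero_right)
  moreover have "A z \<bullet> (transpose (Nmat z) *v w) = (Nmat z *v A z) \<bullet> w" for w
    by (simp add: dot_lmul_matrix inner_commute[of _ w] inner_commute[of "A z"])
  ultimately have "A z \<bullet> (mpd ?v (ginv F c) z *v B z) = - (A z \<bullet> (?H *v (Nmat z *v B z))) - (Nmat z *v A z) \<bullet> (?H *v B z)"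
    by simp
  then show ?thesis
    unfolding spray_deriv_def cometric_def cov_deriv_def
    by (simp add: pd_inner vpd_matrix_vector_mult diff inner_add_right inner_diff_left inner_diff_right
        matrix_vector_mult_diff_distrib)
qed

end

section \<open>The volume density and the distortion\<close>

definition bump :: "real \<Rightarrow> real" where
  "bump t = (max 0 ((t - 1) * (4 - t)))\<^sup>2"

definition bump' :: "real \<Rightarrow> real" where
  "bump' t = 2 * max 0 ((t - 1) * (4 - t)) * (5 - 2 * t)"

lemma has_real_derivative_max_0_squared: "((\<lambda>s::real. (max 0 s)\<^sup>2) has_real_derivative 2 * max 0 s) (at s)"
proof -
  consider "s > 0" | "s < 0" | "s = 0" by linarith
  then show ?thesis
  proof cases
    case 1
    then have "((\<lambda>s::real. s\<^sup>2) has_real_derivative 2 * max 0 s) (at s)"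
      by (auto intro!: derivative_eq_intros)
    then show ?thesis
      by (rule has_field_derivative_transform_within_open[where S="{0<..}"]) (use 1 in auto)
  next
    case 2
    then have "((\<lambda>s::real. 0) has_real_derivative 2 * max 0 s) (at s)" by simp
    then show ?thesis
      by (rule has_field_derivative_transform_within_open[where S="{..<0}"]) (use 2 in auto)
  next
    case 3
    have "\<bar>((max 0 (0 + h))\<^sup>2 - (max 0 0)\<^sup>2) / h\<bar> \<le> \<bar>h\<bar>" if "h \<noteq> 0" for h :: real
      using that by (auto simp: max_def power2_eq_square)
    then have "\<forall>\<^sub>F h in at (0::real). norm (((max 0 (0 + h))\<^sup>2 - (max 0 0)\<^sup>2) / h) \<le> \<bar>h\<bar>"
      by (simp add: eventually_at_filter)
    then have "((\<lambda>h::real. ((max 0 (0 + h))\<^sup>2 - (max 0 0)\<^sup>2) / h) \<longlongrightarrow> 0) (at 0)"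
      by (rule Lim_null_comparison) (rule tendsto_rabs_zero[OF tendsto_ident_at])
    then show ?thesis using 3 by (simp add: DERIV_def)
  qed
qed

lemma bump_has_real_derivative: "(bump has_real_derivative bump' t) (at t)"
proof -
  have "((\<lambda>t::real. (t - 1) * (4 - t)) has_real_derivative (5 - 2 * t)) (at t)"
    by (auto intro!: derivative_eq_intros)
  from DERIV_chain2[OF has_real_derivative_max_0_squared this]
  show ?thesis unfolding bump_def[abs_def] bump'_def by simp
qed

lemma continuous_on_bump: "continuous_on S bump" "continuous_on S bump'"
  unfolding bump_def bump'_def by (intro continuous_intros)+

lemma bump_nonneg: "bump t \<ge> 0"
  by (simp add: bump_def)

lemma bump_pos: "1 < t \<Longrightarrow> t < 4 \<Longrightarrow> bump t > 0"
  by (simp add: bump_def max_def zero_less_mult_iff)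

lemma bump_eq_0: "t \<le> 1 \<or> t \<ge> 4 \<Longrightarrow> bump t = 0" "t \<le> 1 \<or> t \<ge> 4 \<Longrightarrow> bump' t = 0"
proof -
  assume "t \<le> 1 \<or> t \<ge> 4"
  then have "(t - 1) * (4 - t) \<le> 0" by (auto simp: mult_le_0_iff)
  then show "bump t = 0" "bump' t = 0" by (simp_all add: bump_def bump'_def max_def)
qed

context finsler_chart
begin

subsection \<open>Cut-offs along the fibres\<close>

lemma F_norm_bounds:
  assumes x0: "x0 \<in> U"
  obtains r a b where "r > 0" "cball x0 r \<subseteq> U" "a > 0" "b > 0"
    "\<And>x y. x \<in> cball x0 r \<Longrightarrow> a * norm y \<le> Floc F c (x, y) \<and> Floc F c (x, y) \<le> b * norm y"
proof -
  obtain r where r: "r > 0" "cball x0 r \<subseteq> U" using open_U x0 open_contains_cball by blast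
  let ?K = "cball x0 r \<times> sphere (0::real^'n) 1"
  have K: "compact ?K" "?K \<subseteq> TU0" using r by (auto intro: compact_Times)
  have nonempty: "?K \<noteq> {}" using r(1) vector_choose_size[of 1] by (auto simp: dist_norm)
  have cont: "continuous_on ?K (Floc F c)"
    using smooth_imp_continuous_on[OF smooth_F] K(2) continuous_on_subset by blast
  obtain z1 where z1: "z1 \<in> ?K" "\<And>z. z \<in> ?K \<Longrightarrow> Floc F c z1 \<le> Floc F c z"
    using continuous_attains_inf[OF K(1) nonempty cont] by blast
  obtain z2 where z2: "z2 \<in> ?K" "\<And>z. z \<in> ?K \<Longrightarrow> Floc F c z \<le> Floc F c z2"
    using continuous_attains_sup[OF K(1) nonempty cont] by blast
  have "Floc F c z1 * norm y \<le> Floc F c (x, y) \<and> Floc F c (x, y) \<le> Floc F c z2 * norm y"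
    if x: "x \<in> cball x0 r" for x y
  proof (cases "y = 0")
    case True
    then show ?thesis using F_zero[of x] x r(2) by auto
  next
    case False
    then have "Floc F c (x, y) = norm y * Floc F c (x, y /\<^sub>R norm y)"
      using F_scale[of x "norm y" "y /\<^sub>R norm y"] x r(2) by (simp add: subset_iff)
    moreover have "(x, y /\<^sub>R norm y) \<in> ?K" using x False by simp
    ultimately show ?thesis using z1(2) z2(2) by (simp add: mult.commute mult_left_mono)
  qed
  then show ?thesis using that[OF r] F_pos z1(1) z2(1) K(2) by blast
qed

lemma continuous_on_F: "continuous_on (U \<times> UNIV) (Floc F c)"
proof -
  have "isCont (Floc F c) z" if z: "z \<in> U \<times> UNIV" for z
  proof (cases "snd z = 0")
    case False
    then have "z \<in> TU0" using z by (auto simp: TU0_iff)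
    then show ?thesis
      using smooth_imp_continuous_on[OF smooth_F] open_TU0 continuous_on_eq_continuous_at by blast
  next
    case True
    then obtain x where x: "z = (x, 0)" "x \<in> U" using z by (cases z) auto
    obtain r a b where r: "r > 0" "cball x r \<subseteq> U" "b > 0"
      and b: "\<And>x' y. x' \<in> cball x r \<Longrightarrow> a * norm y \<le> Floc F c (x', y) \<and> Floc F c (x', y) \<le> b * norm y"
      using F_norm_bounds[OF x(2)] by metis
    have "\<forall>\<^sub>F z' in at z. z' \<in> ball x r \<times> UNIV"
      using x r by (intro eventually_at_in_open' open_Times) auto
    then have "\<forall>\<^sub>F z' in at z. norm (Floc F c z') \<le> b * norm (snd z')"
    proof eventually_elim
      case (elim z')
      then have "fst z' \<in> cball x r" by (auto simp: mem_Times_iff)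
      then show ?case using r(2) b[of "fst z'" "snd z'"] F_nonneg[of "fst z'" "snd z'"] by auto
    qed
    moreover have "((\<lambda>z'. b * norm (snd z')) \<longlongrightarrow> 0) (at z)" using x by (auto intro!: tendsto_eq_intros)
    ultimately have "(Floc F c \<longlongrightarrow> 0) (at z)" by (rule Lim_null_comparison)
    then show ?thesis using x F_zero by (simp add: isCont_def)
  qed
  then show ?thesis by (simp add: continuous_at_imp_continuous_on)
qed

lemma continuous_on_L: "continuous_on (U \<times> UNIV) L"
  unfolding Lsq_def by (intro continuous_on_power continuous_on_F)

lemma continuous_on_fibre: "continuous_on (U \<times> UNIV) f \<Longrightarrow> x \<in> U \<Longrightarrow> continuous_on UNIV (\<lambda>y. f (x, y))"
  by (erule continuous_on_compose2) (auto intro!: continuous_intros)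

lemma open_L_less_1: "open {z \<in> U \<times> UNIV. L z < 1}"
proof -
  have "{z \<in> U \<times> UNIV. L z < 1} = U \<times> UNIV \<inter> L -` {..<1}" by auto
  then show ?thesis
    using continuous_open_preimage[OF continuous_on_L open_Times[OF open_U open_UNIV] open_lessThan[of 1]] by metis
qed

lemma continuous_on_cutoff:
  assumes h: "smooth h" and \<rho>: "continuous_on UNIV \<rho>" "\<And>t. t \<le> 1 \<Longrightarrow> \<rho> t = (0::real)"
  shows "continuous_on (U \<times> UNIV) (\<lambda>z. \<rho> (L z) * h z)"
proof -
  have "continuous_on {z \<in> U \<times> UNIV. L z < 1} (\<lambda>z. \<rho> (L z) * h z)"
    by (rule continuous_on_eq[OF continuous_on_const[of _ 0]]) (simp add: \<rho>(2))
  moreover have "continuous_on TU0 (\<lambda>z. \<rho> (L z) * h z)"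
    by (intro continuous_on_mult smooth_imp_continuous_on h continuous_on_compose2[OF \<rho>(1)] smooth_L) auto
  ultimately have "continuous_on ({z \<in> U \<times> UNIV. L z < 1} \<union> TU0) (\<lambda>z. \<rho> (L z) * h z)"
    by (rule continuous_on_open_Un[OF open_L_less_1 open_TU0])
  moreover have "{z \<in> U \<times> UNIV. L z < 1} \<union> TU0 = U \<times> UNIV" using L_zero by auto
  ultimately show ?thesis by simp
qed

lemma cutoff_has_derivative:
  assumes h: "smooth h" and z: "z \<in> U \<times> UNIV"
  shows "((\<lambda>z. bump (L z) * h z) has_derivative
    (\<lambda>v. bump (L z) * pd v h z + bump' (L z) * pd v L z * h z)) (at z)"
proof (cases "snd z = 0")
  case True
  then have "L z = 0" using z L_zero[of "fst z"] by (cases z) auto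
  have "((\<lambda>z. 0) has_derivative (\<lambda>v. 0)) (at z)" by simp
  then have "((\<lambda>z. bump (L z) * h z) has_derivative (\<lambda>v. 0)) (at z)"
    by (rule has_derivative_transform_within_open[OF _ open_L_less_1])
       (use z \<open>L z = 0\<close> in \<open>auto simp: bump_eq_0\<close>)
  then show ?thesis by (simp add: \<open>L z = 0\<close> bump_eq_0)
next
  case False
  then have z: "z \<in> TU0" using z by (auto simp: TU0_iff)
  note derivs = pd_has_derivative[OF smooth_imp_differentiable[OF smooth_L z]]
    pd_has_derivative[OF smooth_imp_differentiable[OF h z]]
  show ?thesis
    by (rule has_derivative_mult[OF has_derivative_compose[OF derivs(1)
            bump_has_real_derivative[unfolded has_field_derivative_def]] derivs(2)])
qed

lemma bump_L_compact_support:
  assumes "x0 \<in> U"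
  obtains r R where "r > 0" "ball x0 r \<subseteq> U" "\<And>x y. x \<in> ball x0 r \<Longrightarrow> norm y > R \<Longrightarrow> bump (L (x, y)) = 0"
proof -
  obtain r a b where r: "r > 0" "cball x0 r \<subseteq> U" "a > 0"
    and a: "\<And>x y. x \<in> cball x0 r \<Longrightarrow> a * norm y \<le> Floc F c (x, y) \<and> Floc F c (x, y) \<le> b * norm y"
    using F_norm_bounds[OF assms] by metis
  show ?thesis
  proof (rule that[of r "2 / a"])
    fix x y :: "real^'n" assume "x \<in> ball x0 r" "norm y > 2 / a"
    then have "Floc F c (x, y) \<ge> 2" using a[of x y] r(3) by (auto simp: field_simps)
    then have "L (x, y) \<ge> 2\<^sup>2" unfolding Lsq_def by (intro power_mono) auto
    then show "bump (L (x, y)) = 0" by (simp add: bump_eq_0)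
  qed (use r in \<open>auto simp: subset_iff\<close>)
qed

text \<open>The degree of homogeneity lets every direction be rescaled into the region where the cut-off is positive.\<close>

lemma cutoff_integral_0_imp_0:
  assumes h: "smooth h" "homogeneous_deg r h" and x: "x \<in> U" and y: "y \<noteq> 0"
    and nonneg: "\<And>y. y \<noteq> 0 \<Longrightarrow> h (x, y) \<ge> 0"
    and integral: "((\<lambda>y. bump (L (x, y)) * h (x, y)) has_integral 0) (cbox p q)"
    and supp: "\<And>y. y \<notin> box p q \<Longrightarrow> bump (L (x, y)) = 0"
  shows "h (x, y) = 0"
proof -
  let ?u = "\<lambda>y. bump (L (x, y)) * h (x, y)"
  have u_nonneg: "0 \<le> ?u y" for y
    using nonneg[of y] bump_nonneg[of "L (x, y)"] L_zero[OF x] by (cases "y = 0") (simp_all add: bump_eq_0)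
  have u_cont: "continuous_on (cbox p q) ?u"
    by (rule continuous_on_subset[OF continuous_on_fibre[OF continuous_on_cutoff[OF h(1)] x]])
       (auto simp: continuous_on_bump bump_eq_0)
  define t where "t = 3/2 / Floc F c (x, y)"
  have "Floc F c (x, y) > 0" using F_pos[of "(x, y)"] x y by auto
  then have t: "t > 0" "Floc F c (x, t *\<^sub>R y) = 3/2"
    using F_scale[OF x, of t y] by (simp_all add: t_def)
  then have "L (x, t *\<^sub>R y) = 9/4" by (simp only: Lsq_def) (simp add: power2_eq_square)
  then have "bump (L (x, t *\<^sub>R y)) > 0" using bump_pos by simp
  moreover from this have "t *\<^sub>R y \<in> box p q" using supp[of "t *\<^sub>R y"] by force
  then have "?u (t *\<^sub>R y) = 0"
    using box_subset_cbox by (intro has_integral_0_cbox_imp_0[OF u_cont u_nonneg integral]) blast+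
  ultimately have "h (x, t *\<^sub>R y) = 0" by simp
  then show ?thesis using homogeneous_degD[OF h(2) x y t(1)] t(1) by simp
qed

subsection \<open>The volume of the unit balls\<close>

definition vol :: "real^'n \<Rightarrow> real" where
  "vol x = measure lebesgue {y. Floc F c (x, y) < 1}"

lemma open_F_ball: "x \<in> U \<Longrightarrow> open {y. Floc F c (x, y) < s}"
  using open_Collect_less[OF continuous_on_fibre[OF continuous_on_F] continuous_on_const] .

lemma F_ball_lmeasurable:
  assumes "x \<in> U"
  shows "{y. Floc F c (x, y) < s} \<in> lmeasurable"
proof -
  obtain r a b where r: "r > 0" "a > 0"
    and a: "\<And>x' y. x' \<in> cball x r \<Longrightarrow> a * norm y \<le> Floc F c (x', y) \<and> Floc F c (x', y) \<le> b * norm y"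
    using F_norm_bounds[OF assms] by metis
  have "norm y \<le> s / a" if "Floc F c (x, y) < s" for y
    using a[of x y] r that by (simp add: pos_le_divide_eq mult.commute)
  then have "bounded {y. Floc F c (x, y) < s}" unfolding bounded_iff by blast
  then show ?thesis by (rule lmeasurable_open[OF _ open_F_ball[OF assms]])
qed

lemma vol_pos:
  assumes "x \<in> U"
  shows "vol x > 0"
proof -
  have "0 \<in> {y. Floc F c (x, y) < 1}" using F_zero[OF assms] by simp
  then have "\<not> negligible {y. Floc F c (x, y) < 1}" using open_not_negligible[OF open_F_ball[OF assms]] by blast
  then show ?thesis unfolding vol_def
    using negligible_iff_measure F_ball_lmeasurable[OF assms] by (metis measure_nonneg less_le)
qed

lemma emeasure_F_ball:
  assumes x: "x \<in> U"
  shows "emeasure lborel {y. Floc F c (x, y) < s} = ennreal (if s \<le> 0 then 0 else s ^ CARD('n) * vol x)"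
proof (cases "s \<le> 0")
  case True
  then have "{y. Floc F c (x, y) < s} = {}" using F_nonneg[OF x] by (auto simp: not_less intro: order_trans)
  then show ?thesis using True by simp
next
  case False
  then have s: "s > 0" by simp
  have "y \<in> (\<lambda>y. s *\<^sub>R y + 0) ` {y. Floc F c (x, y) < 1} \<longleftrightarrow> Floc F c (x, y) < s" for y
  proof
    assume "Floc F c (x, y) < s"
    moreover have "Floc F c (x, inverse s *\<^sub>R y) = inverse s * Floc F c (x, y)" using F_scale[OF x] s by simp
    ultimately have "Floc F c (x, inverse s *\<^sub>R y) < 1" using s by (simp only:) (simp add: field_simps)
    moreover have "y = s *\<^sub>R (inverse s *\<^sub>R y) + 0" using s by simp
    ultimately show "y \<in> (\<lambda>y. s *\<^sub>R y + 0) ` {y. Floc F c (x, y) < 1}" by blast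
  qed (use F_scale[OF x s] s in auto)
  then have dilate: "{y. Floc F c (x, y) < s} = (\<lambda>y. s *\<^sub>R y + 0) ` {y. Floc F c (x, y) < 1}" by auto
  have "{y. Floc F c (x, y) < s} \<in> sets lborel" using borel_open[OF open_F_ball[OF x]] by simp
  then have "emeasure lborel {y. Floc F c (x, y) < s} = emeasure lebesgue {y. Floc F c (x, y) < s}" by simp
  also have "\<dots> = ennreal (\<bar>s\<bar> ^ CARD('n)) * emeasure lebesgue {y. Floc F c (x, y) < 1}"
    unfolding dilate by (subst emeasure_lebesgue_affine) simp
  also have "emeasure lebesgue {y. Floc F c (x, y) < 1} = ennreal (vol x)"
    unfolding vol_def by (rule emeasure_eq_measure2[OF F_ball_lmeasurable[OF x]])
  finally show ?thesis using s by (simp add: ennreal_mult')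
qed

text \<open>The distribution of \<open>F\<close> under Lebesgue measure on a fibre depends on the fibre only through the factor \<open>vol\<close>.\<close>

lemma vol_mult_nn_integral_bump:
  assumes x: "x \<in> U" and x0: "x0 \<in> U"
  shows "ennreal (vol x0) * (\<integral>\<^sup>+y. ennreal (bump (L (x, y))) \<partial>lborel)
    = ennreal (vol x) * (\<integral>\<^sup>+y. ennreal (bump (L (x0, y))) \<partial>lborel)"
proof -
  let ?M = "\<lambda>x. distr lborel borel (\<lambda>y. - Floc F c (x, y))"
  have meas: "(\<lambda>y. - Floc F c (x, y)) \<in> borel_measurable borel" if "x \<in> U" for x
    by (intro borel_measurable_continuous_onI continuous_on_minus continuous_on_fibre[OF continuous_on_F] that)
  have em: "emeasure (?M x) {s<..} = ennreal (if - s \<le> 0 then 0 else (-s) ^ CARD('n) * vol x)" if "x \<in> U" for x s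
  proof -
    have "emeasure (?M x) {s<..} = emeasure lborel {y. Floc F c (x, y) < - s}"
      using meas[OF that] by (subst emeasure_distr) (auto intro!: arg_cong[where f="emeasure lborel"])
    then show ?thesis using emeasure_F_ball[OF that] by simp
  qed
  have "scale_measure (ennreal (vol x0)) (?M x) = scale_measure (ennreal (vol x)) (?M x0)"
  proof (rule measure_eqI_lessThan)
    fix s
    show "emeasure (scale_measure (ennreal (vol x0)) (?M x)) {s<..} < \<infinity>"
      using em[OF x] by (simp add: ennreal_mult_less_top)
    show "emeasure (scale_measure (ennreal (vol x0)) (?M x)) {s<..} = emeasure (scale_measure (ennreal (vol x)) (?M x0)) {s<..}"
      using em[OF x] em[OF x0] vol_pos[OF x] vol_pos[OF x0] by (simp add: mult_ac flip: ennreal_mult')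
  qed auto
  then have "(\<integral>\<^sup>+s. ennreal (bump (s\<^sup>2)) \<partial>scale_measure (ennreal (vol x0)) (?M x))
    = (\<integral>\<^sup>+s. ennreal (bump (s\<^sup>2)) \<partial>scale_measure (ennreal (vol x)) (?M x0))" by simp
  moreover have "(\<lambda>s. ennreal (bump (s\<^sup>2))) \<in> borel_measurable borel"
    by (intro measurable_compose[OF _ measurable_ennreal] borel_measurable_continuous_onI
        continuous_on_compose2[OF continuous_on_bump(1)[of UNIV]] continuous_intros) auto
  ultimately show ?thesis
    using meas[OF x] meas[OF x0] by (simp add: nn_integral_scale_measure nn_integral_distr Lsq_def)
qed

lemma continuous_on_bump_L: "x \<in> U \<Longrightarrow> continuous_on S (\<lambda>y. bump (L (x, y)))"
  by (rule continuous_on_compose2[OF continuous_on_bump(1)[of UNIV] continuous_on_subset[OF continuous_on_fibre[OF continuous_on_L]]]) auto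

lemma bump_L_integrable: "x \<in> U \<Longrightarrow> (\<lambda>y. bump (L (x, y))) integrable_on cbox p q"
  by (rule integrable_continuous[OF continuous_on_bump_L])

lemma
  assumes x: "x \<in> U" and supp: "\<And>y. y \<notin> box p q \<Longrightarrow> bump (L (x, y)) = 0"
  shows integral_bump_L_pos: "integral (cbox p q) (\<lambda>y. bump (L (x, y))) > 0"
    and nn_integral_bump_L: "(\<integral>\<^sup>+y. ennreal (bump (L (x, y))) \<partial>lborel) = ennreal (integral (cbox p q) (\<lambda>y. bump (L (x, y))))"
proof -
  have has_int: "((\<lambda>y. bump (L (x, y))) has_integral integral (cbox p q) (\<lambda>y. bump (L (x, y)))) (cbox p q)"
    by (rule integrable_integral[OF bump_L_integrable[OF x]])
  show "(\<integral>\<^sup>+y. ennreal (bump (L (x, y))) \<partial>lborel) = ennreal (integral (cbox p q) (\<lambda>y. bump (L (x, y))))"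
    using supp[OF contra_subsetD[OF box_subset_cbox]]
    by (intro nn_integral_has_integral_lborel borel_measurable_continuous_onI bump_nonneg continuous_on_bump_L[OF x]
        has_integral_on_superset[OF has_int]) auto
  obtain y :: "real^'n" where y: "y \<noteq> 0" using vector_choose_size[of 1] by (metis norm_zero zero_neq_one zero_le_one)
  have "homogeneous_deg 0 (\<lambda>z. 1)" by (simp add: homogeneous_deg_def)
  from cutoff_integral_0_imp_0[OF smooth_arith(1) this x y _ _ supp]
  have "integral (cbox p q) (\<lambda>y. bump (L (x, y))) \<noteq> 0" using has_int by force
  then show "integral (cbox p q) (\<lambda>y. bump (L (x, y))) > 0"
    using integral_nonneg[OF bump_L_integrable[OF x] bump_nonneg, of p q] by simp
qed

lemma bump_L_has_derivative_x:
  assumes x: "x \<in> U"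
  shows "((\<lambda>x. bump (L (x, y))) has_derivative (\<lambda>v. v \<bullet> bump' (L (x, y)) *\<^sub>R grad_x L (x, y))) (at x)"
proof -
  have "((\<lambda>x. (x, y)) has_derivative (\<lambda>v. (v, 0))) (at x)" by (auto intro!: derivative_eq_intros)
  moreover have "((\<lambda>z. bump (L z) * 1) has_derivative
      (\<lambda>v. bump (L (x, y)) * pd v (\<lambda>_. 1) (x, y) + bump' (L (x, y)) * pd v L (x, y) * 1)) (at (x, y))"
    by (rule cutoff_has_derivative[OF smooth_arith(1)]) (use x in auto)
  ultimately have "((\<lambda>x. bump (L (x, y)) * 1) has_derivative
      (\<lambda>v. bump (L (x, y)) * pd (v, 0) (\<lambda>_. 1) (x, y) + bump' (L (x, y)) * pd (v, 0) L (x, y) * 1)) (at x)"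
    by (rule has_derivative_compose)
  then have "((\<lambda>x. bump (L (x, y))) has_derivative (\<lambda>v. bump' (L (x, y)) * pd (v, 0) L (x, y))) (at x)" by simp
  moreover have "bump' (L (x, y)) * pd (v, 0) L (x, y) = v \<bullet> bump' (L (x, y)) *\<^sub>R grad_x L (x, y)" for v
  proof (cases "y = 0")
    case True
    then show ?thesis using L_zero[OF x] by (simp add: bump_eq_0)
  next
    case False
    then show ?thesis using pd_pair[OF smooth_imp_differentiable[OF smooth_L], of "(x, y)"] x by simp
  qed
  ultimately show ?thesis by simp
qed

lemma integral_bump_L_differentiable:
  assumes x0: "x0 \<in> U"
  shows "(\<lambda>x. integral (cbox p q) (\<lambda>y. bump (L (x, y)))) differentiable (at x0)"
proof -
  obtain r where r: "r > 0" "ball x0 r \<subseteq> U" using open_U x0 openE by blast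
  define W where "W x y = bump' (L (x, y)) *\<^sub>R grad_x L (x, y)" for x y
  have "((\<lambda>x. integral (cbox p q) (\<lambda>y. bump (L (x, y)))) has_derivative (\<lambda>v. v \<bullet> integral (cbox p q) (W x0))) (at x0)"
  proof (rule has_derivative_integral_parameter[OF open_ball convex_ball])
    show "x0 \<in> ball x0 r" using r by simp
    fix x assume x: "x \<in> ball x0 r"
    then have xU: "x \<in> U" using r by blast
    show "(\<lambda>y. bump (L (x, y))) integrable_on cbox p q" by (rule bump_L_integrable[OF xU])
    show "((\<lambda>x. bump (L (x, y))) has_derivative (\<lambda>v. v \<bullet> W x y)) (at x)" for y
      unfolding W_def by (rule bump_L_has_derivative_x[OF xU])
  next
    have cont: "continuous_on (U \<times> UNIV) (\<lambda>z. bump' (L z) * DX k L z)" for k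
      by (rule continuous_on_cutoff) (auto intro: smooth_DX smooth_L simp: continuous_on_bump bump_eq_0)
    have "continuous_on (U \<times> UNIV) (\<lambda>z. \<Sum>k\<in>UNIV. (bump' (L z) * DX k L z) *\<^sub>R (axis k 1 :: real^'n))"
      by (intro continuous_on_sum continuous_on_scaleR continuous_on_const cont)
    moreover have "(\<Sum>k\<in>UNIV. (bump' (L z) * DX k L z) *\<^sub>R axis k 1) = bump' (L z) *\<^sub>R grad_x L z" for z
      by (simp add: vec_eq_iff axis_def if_distrib cong: if_cong)
    ultimately have "continuous_on (U \<times> UNIV) (\<lambda>z. bump' (L z) *\<^sub>R grad_x L z)" by (simp only:)
    then show "continuous_on (ball x0 r \<times> cbox p q) (\<lambda>(x, y). W x y)"
      unfolding W_def case_prod_unfold prod.collapse by (rule continuous_on_subset) (use r in auto)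
  qed
  then show ?thesis unfolding differentiable_def by blast
qed

lemma vol_differentiable:
  assumes x0: "x0 \<in> U"
  shows "vol differentiable (at x0)"
proof -
  obtain r R where r: "r > 0" "ball x0 r \<subseteq> U"
    and supp: "\<And>x y. x \<in> ball x0 r \<Longrightarrow> norm y > R \<Longrightarrow> bump (L (x, y)) = 0"
    using bump_L_compact_support[OF x0] by metis
  obtain p where "cball 0 R \<subseteq> box (- p) (p::real^'n)"
    using bounded_subset_box_symmetric[OF bounded_cball[of 0 R]] by blast
  then have supp_box: "bump (L (x, y)) = 0" if "x \<in> ball x0 r" "y \<notin> box (- p) p" for x y
    using that supp by (force simp: subset_iff)
  define I where "I x = integral (cbox (- p) p) (\<lambda>y. bump (L (x, y)))" for x
  have I: "(\<integral>\<^sup>+y. ennreal (bump (L (x, y))) \<partial>lborel) = ennreal (I x)" "I x > 0" if x: "x \<in> ball x0 r" for x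
    unfolding I_def using supp_box[OF x] r(2) x by (intro nn_integral_bump_L integral_bump_L_pos; blast)+
  have vol_eq: "vol x0 / I x0 * I x = vol x" if x: "x \<in> ball x0 r" for x
  proof -
    have xU: "x \<in> U" and x0_ball: "x0 \<in> ball x0 r" using x r by auto
    have "ennreal (vol x0) * ennreal (I x) = ennreal (vol x) * ennreal (I x0)"
      using vol_mult_nn_integral_bump[OF xU x0] unfolding I(1)[OF x] I(1)[OF x0_ball] .
    then have "ennreal (vol x0 * I x) = ennreal (vol x * I x0)"
      using vol_pos[OF xU] vol_pos[OF x0] by (simp add: ennreal_mult')
    then have "vol x0 * I x = vol x * I x0"
      using I(2)[OF x] I(2)[OF x0_ball] vol_pos[OF xU] vol_pos[OF x0] by simp
    then show ?thesis using I(2)[OF x0_ball] by (simp add: field_simps)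
  qed
  have "(\<lambda>x. vol x0 / I x0 * I x) differentiable (at x0)"
    unfolding I_def using integral_bump_L_differentiable[OF x0] by (intro differentiable_mult) auto
  then show ?thesis
    using differentiable_cong_open[OF open_ball _ vol_eq, of x0 x0 r] r(1) by simp
qed

lemma ln_vol_differentiable: "x \<in> U \<Longrightarrow> (\<lambda>x. ln (vol x)) differentiable (at x)"
  using has_derivative_ln[OF vol_pos pd_has_derivative[OF vol_differentiable]] unfolding differentiable_def by blast

lemma pd_ln_sigmaBH:
  assumes x: "x \<in> U"
  shows "pd v (\<lambda>x. ln (sigmaBH F c x)) x = - pd v (\<lambda>x. ln (vol x)) x"
proof -
  have ball: "measure lebesgue (ball (0::real^'n) 1) > 0" by (simp add: content_ball_pos)
  have "ln (sigmaBH F c x) = ln (measure lebesgue (ball (0::real^'n) 1)) - ln (vol x)" if "x \<in> U" for x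
    using vol_pos[OF that] ball by (simp add: sigmaBH_def ln_div flip: vol_def)
  then have "pd v (\<lambda>x. ln (sigmaBH F c x)) x = pd v (\<lambda>x. ln (measure lebesgue (ball (0::real^'n) 1)) - ln (vol x)) x"
    by (rule pd_cong_open[OF open_U x])
  then show ?thesis using pd_diff[OF _ ln_vol_differentiable[OF x]] by simp
qed

subsection \<open>The distortion\<close>

text \<open>Squaring the determinant spares a proof of its positivity.\<close>

definition ln_sqrt_det :: "(real^'n) \<times> (real^'n) \<Rightarrow> real" where
  "ln_sqrt_det z = 1/4 * ln ((det (gmat z))\<^sup>2)"

text \<open>Up to an additive constant, \<open>ln vol\<close> is minus the logarithm of the Busemann--Hausdorff density.\<close>

definition distortion :: "(real^'n) \<times> (real^'n) \<Rightarrow> real" where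
  "distortion z = ln_sqrt_det z + ln (vol (fst z))"

lemma smooth_ln_sqrt_det: "smooth ln_sqrt_det"
  unfolding ln_sqrt_det_def[abs_def]
  by (intro smooth_arith smooth_on_ln[OF open_TU0] smooth_on_det[OF open_TU0] smooth_gmat) (simp add: det_gmat_nonzero)

lemma homogeneous_ln_sqrt_det: "homogeneous_deg 0 ln_sqrt_det"
  unfolding homogeneous_deg_def ln_sqrt_det_def by (auto simp: gmat_scale)

lemma homogeneous_distortion: "homogeneous_deg 0 distortion"
  using homogeneous_ln_sqrt_det unfolding homogeneous_deg_def distortion_def by auto

lemma pd_ln_sqrt_det:
  assumes z: "z \<in> TU0"
  shows "pd v ln_sqrt_det z = 1/2 * trace (ginv F c z ** mpd v gmat z)"
proof -
  note det = pd_det[OF differentiable_gmat[OF z] gmat_invertible[OF z]]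
  have "pd v ln_sqrt_det z = 1/4 * pd v (\<lambda>z. ln ((det (gmat z))\<^sup>2)) z"
    unfolding ln_sqrt_det_def[abs_def]
    by (intro pd_cmult smooth_imp_differentiable[OF _ z] smooth_arith smooth_on_ln[OF open_TU0]
        smooth_on_det[OF open_TU0] smooth_gmat) (simp add: det_gmat_nonzero)
  also have "\<dots> = 1/4 * (pd v (\<lambda>z. (det (gmat z))\<^sup>2) z * inverse ((det (gmat z))\<^sup>2))"
    using det_gmat_nonzero[OF z] det(1) by (subst pd_ln) auto
  also have "pd v (\<lambda>z. (det (gmat z))\<^sup>2) z = 2 * det (gmat z) * pd v (\<lambda>z. det (gmat z)) z"
    unfolding power2_eq_square using pd_mult[OF det(1) det(1)] by simp
  also have "pd v (\<lambda>z. det (gmat z)) z = det (gmat z) * trace (ginv F c z ** mpd v gmat z)"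
    unfolding det(2) ginv_eq ..
  finally show ?thesis using det_gmat_nonzero[OF z] by (simp add: field_simps power2_eq_square)
qed

lemma trace_ginv_congruence:
  assumes "z \<in> TU0"
  shows "trace (ginv F c z ** (A ** gmat z + transpose (A ** gmat z))) = 2 * trace A"
proof -
  let ?H = "ginv F c z"
  have "trace (?H ** (A ** gmat z)) = trace A"
    by (subst trace_mul_sym) (simp add: gmat_ginv[OF assms] flip: matrix_mul_assoc)
  moreover have "trace (?H ** transpose (A ** gmat z)) = trace A"
    by (simp add: matrix_transpose_mul transpose_gmat[OF assms] matrix_mul_assoc ginv_gmat[OF assms] trace_transpose)
  ultimately show ?thesis by (simp add: matrix_add_ldistrib trace_add)
qed

lemma spray_deriv_ln_sqrt_det: "z \<in> TU0 \<Longrightarrow> spray_deriv ln_sqrt_det z = trace (Nmat z)"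
  unfolding spray_deriv_def by (simp add: pd_ln_sqrt_det mpd_spray_gmat trace_ginv_congruence)

lemma pd_ln_vol_fst:
  assumes z: "z \<in> TU0"
  shows "pd v (\<lambda>z. ln (vol (fst z))) z = pd (fst v) (\<lambda>x. ln (vol x)) (fst z)"
    and "(\<lambda>z. ln (vol (fst z))) differentiable (at z)"
proof -
  have fst: "(fst has_derivative fst) (at z)" by (auto intro!: derivative_eq_intros)
  have "(\<lambda>x. ln (vol x)) differentiable (at (fst z))" using ln_vol_differentiable z by (simp add: TU0_iff)
  then show "pd v (\<lambda>z. ln (vol (fst z))) z = pd (fst v) (\<lambda>x. ln (vol x)) (fst z)"
    and "(\<lambda>z. ln (vol (fst z))) differentiable (at z)"
    by (rule pd_chain[OF fst], rule differentiable_chain[OF fst])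
qed

lemma distortion_differentiable: "z \<in> TU0 \<Longrightarrow> distortion differentiable (at z)"
  unfolding distortion_def[abs_def]
  by (intro differentiable_add smooth_imp_differentiable[OF smooth_ln_sqrt_det] pd_ln_vol_fst(2))

lemma pd_distortion:
  assumes z: "z \<in> TU0"
  shows "pd v distortion z = pd v ln_sqrt_det z + pd (fst v) (\<lambda>x. ln (vol x)) (fst z)"
  unfolding distortion_def[abs_def] pd_ln_vol_fst(1)[OF z, symmetric]
  by (rule pd_add[OF smooth_imp_differentiable[OF smooth_ln_sqrt_det z] pd_ln_vol_fst(2)[OF z]])

lemma DY_distortion: "z \<in> TU0 \<Longrightarrow> DY i distortion z = DY i ln_sqrt_det z"
  unfolding DY_def by (simp add: pd_distortion pd_zero_direction ln_vol_differentiable TU0_iff)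

theorem spray_deriv_distortion:
  assumes z: "z \<in> TU0"
  shows "spray_deriv distortion z = Scurv F c z"
proof -
  have x: "fst z \<in> U" using z by (simp add: TU0_iff)
  have "spray_deriv distortion z = trace (Nmat z) + pd (snd z) (\<lambda>x. ln (vol x)) (fst z)"
    using pd_distortion[OF z, of "spray_vec z"] spray_deriv_ln_sqrt_det[OF z]
    by (simp add: spray_deriv_def spray_vec_def)
  then show ?thesis
    using pd_axis_expansion[OF ln_vol_differentiable[OF x], of "snd z"]
    by (simp add: Scurv_def pd_ln_sigmaBH[OF x] sum_negf trace_def Nmat_def)
qed

end

section \<open>The mean Cartan torsion and Deicke's theorem\<close>

context finsler_chart
begin

definition mean_cartan :: "(real^'n) \<times> (real^'n) \<Rightarrow> real^'n" where
  "mean_cartan z = grad_y ln_sqrt_det z"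

definition torsion_norm :: "(real^'n) \<times> (real^'n) \<Rightarrow> real" where
  "torsion_norm z = L z * cometric z (mean_cartan z) (mean_cartan z)"

lemma smooth_mean_cartan: "smooth (\<lambda>z. mean_cartan z $ i)"
  unfolding mean_cartan_def using smooth_DY[OF smooth_ln_sqrt_det] by simp

lemma homogeneous_mean_cartan: "homogeneous_deg (-1) (\<lambda>z. mean_cartan z $ i)"
  unfolding mean_cartan_def using homogeneous_DY[OF smooth_ln_sqrt_det homogeneous_ln_sqrt_det] by simp

lemma snd_mean_cartan: "z \<in> TU0 \<Longrightarrow> snd z \<bullet> mean_cartan z = 0"
  unfolding mean_cartan_def using euler_homogeneous[OF smooth_ln_sqrt_det homogeneous_ln_sqrt_det] by simp

lemma smooth_torsion_norm: "smooth torsion_norm"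
  unfolding torsion_norm_def[abs_def] by (intro smooth_arith smooth_L smooth_cometric smooth_mean_cartan)

lemma homogeneous_torsion_norm: "homogeneous_deg 0 torsion_norm"
  unfolding torsion_norm_def[abs_def]
  using homogeneous_mult[OF homogeneous_L homogeneous_cometric[OF homogeneous_mean_cartan homogeneous_mean_cartan]]
  by simp

lemma DY_g_sym:
  assumes z: "z \<in> TU0"
  shows "DY k (g i j) z = DY i (g k j) z" and "DY k (g i j) z = DY k (g j i) z"
proof -
  have third: "DY k (g i j) z = 1/2 * DY k (DY i (DY j L)) z" for i j k
    unfolding gten_def[abs_def] DY_def[of k] by (rule pd_cmult) (intro smooth_imp_differentiable[OF _ z] smooth_DY smooth_L)
  show "DY k (g i j) z = DY i (g k j) z"
    unfolding third using DY_DY_commute[OF smooth_DY[OF smooth_L] z, of k i j] by simp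
  show "DY k (g i j) z = DY k (g j i) z" by (rule DY_cong[OF g_sym z])
qed

lemma DY_DY_g_sym:
  assumes z: "z \<in> TU0"
  shows "DY i (DY j (g k k)) z = DY k (DY k (g i j)) z"
proof -
  have "DY i (DY j (g k k)) z = DY i (DY k (g j k)) z" by (rule DY_cong[OF DY_g_sym(1) z])
  also have "\<dots> = DY k (DY i (g j k)) z" by (rule DY_DY_commute[OF smooth_g z])
  also have "\<dots> = DY k (DY k (g i j)) z"
    by (rule DY_cong[OF _ z]) (metis DY_g_sym)
  finally show ?thesis .
qed

definition dg :: "'n \<Rightarrow> (real^'n) \<times> (real^'n) \<Rightarrow> real^'n^'n" where
  "dg k z = mpd (0, axis k 1) gmat z"

lemma dg_nth [simp]: "dg k z $ i $ j = DY k (g i j) z"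
  by (simp add: dg_def DY_def)

lemma transpose_dg: "z \<in> TU0 \<Longrightarrow> transpose (dg k z) = dg k z"
  using DY_g_sym(2) by (simp add: vec_eq_iff transpose_def)

lemma smooth_dg: "smooth (\<lambda>z. dg k z $ i $ j)"
  by (simp add: smooth_DY smooth_g)

lemma mean_cartan_eq_trace: "z \<in> TU0 \<Longrightarrow> mean_cartan z $ k = 1/2 * trace (ginv F c z ** dg k z)"
  by (simp add: mean_cartan_def dg_def DY_def pd_ln_sqrt_det)

lemma divergence_ginv:
  assumes z: "z \<in> TU0"
  shows "(\<Sum>i\<in>UNIV. DY i (\<lambda>z. ginv F c z $ i $ j) z) = - 2 * (ginv F c z *v mean_cartan z) $ j"
proof -
  let ?H = "ginv F c z"
  have "DY i (\<lambda>z. ginv F c z $ i $ j) z = - (\<Sum>l\<in>UNIV. \<Sum>k\<in>UNIV. ?H $ i $ k * dg l z $ k $ i * ?H $ l $ j)" for i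
  proof -
    have "dg i z $ k $ l = dg l z $ k $ i" for k l
      using DY_g_sym[OF z] by simp
    moreover have "DY i (\<lambda>z. ginv F c z $ i $ j) z = - ((?H ** dg i z ** ?H) $ i $ j)"
      using arg_cong[OF mpd_ginv[OF z, of "(0, axis i 1)"], of "\<lambda>M. M $ i $ j"] by (simp add: DY_def dg_def)
    ultimately show ?thesis
      by (simp add: matrix_matrix_mult_def sum_distrib_right)
  qed
  then have "(\<Sum>i\<in>UNIV. DY i (\<lambda>z. ginv F c z $ i $ j) z)
      = - (\<Sum>l\<in>UNIV. (\<Sum>i\<in>UNIV. \<Sum>k\<in>UNIV. ?H $ i $ k * dg l z $ k $ i) * ?H $ l $ j)"
    by (simp add: sum_negf sum_distrib_right) (subst sum.swap, simp)
  also have "\<dots> = - (\<Sum>l\<in>UNIV. (2 * mean_cartan z $ l) * ?H $ l $ j)"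
    by (simp add: mean_cartan_eq_trace[OF z] trace_def matrix_matrix_mult_def)
  also have "\<dots> = - 2 * (?H *v mean_cartan z) $ j"
    using ginv_sym[OF z, of _ j] by (simp add: matrix_vector_mult_def sum_distrib_left sum_negf mult_ac)
  finally show ?thesis .
qed

definition grad_g :: "'n \<Rightarrow> (real^'n) \<times> (real^'n) \<Rightarrow> real^'n" where
  "grad_g k z = ginv F c z *v grad_y (g k k) z"

definition laplace_g :: "'n \<Rightarrow> (real^'n) \<times> (real^'n) \<Rightarrow> real" where
  "laplace_g k z = (\<Sum>i\<in>UNIV. DY i (\<lambda>z. grad_g k z $ i) z)"

lemma smooth_grad_g: "smooth (\<lambda>z. grad_g k z $ i)"
  unfolding grad_g_def matrix_vector_mult_def by (simp, intro smooth_arith smooth_ginv smooth_DY smooth_g)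

lemma smooth_laplace_g: "smooth (laplace_g k)"
  unfolding laplace_g_def[abs_def] by (intro smooth_arith smooth_DY smooth_grad_g)

lemma homogeneous_laplace_g: "homogeneous_deg (-2) (laplace_g k)"
proof -
  have "homogeneous_deg (0 + (0 - 1)) (\<lambda>z. ginv F c z $ i $ j * DY j (g k k) z)" for i j
    by (intro homogeneous_mult homogeneous_ginv homogeneous_DY smooth_g homogeneous_g)
  then have "homogeneous_deg (-1) (\<lambda>z. grad_g k z $ i)" for i
    unfolding grad_g_def matrix_vector_mult_def by (simp add: homogeneous_sum)
  then show ?thesis
    unfolding laplace_g_def[abs_def] using homogeneous_DY[OF smooth_grad_g] by (intro homogeneous_sum) force
qed

lemma grad_y_L_grad_g:
  assumes z: "z \<in> TU0"
  shows "grad_y L z \<bullet> grad_g k z = 0"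
proof -
  have "ginv F c z *v grad_y L z = 2 *\<^sub>R (ginv F c z *v (gmat z *v snd z))"
    unfolding gmat_mult_snd[OF z] by (simp add: matrix_vector_mult_scaleR)
  also have "\<dots> = 2 *\<^sub>R snd z" by (simp add: matrix_vector_mul_assoc ginv_gmat z)
  finally have "grad_y L z \<bullet> grad_g k z = 2 * (snd z \<bullet> grad_y (g k k) z)"
    using cometric_sym[OF z, of "grad_y L z" "grad_y (g k k) z"]
    by (simp add: cometric_def grad_g_def inner_commute)
  then show ?thesis using euler_homogeneous[OF smooth_g homogeneous_g z] by simp
qed

lemma fibre_has_derivative:
  assumes "smooth h" "x \<in> U" "y \<noteq> 0"
  shows "((\<lambda>y. h (x, y)) has_derivative (\<lambda>v. v \<bullet> grad_y h (x, y))) (at y)"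
proof -
  have diff: "h differentiable (at (x, y))" using smooth_imp_differentiable[OF assms(1)] assms(2,3) by simp
  have "((\<lambda>y. (x, y)) has_derivative (\<lambda>v. (0, v))) (at y)" by (auto intro!: derivative_eq_intros)
  from has_derivative_compose[OF this pd_has_derivative[OF diff]] show ?thesis by (simp add: pd_pair[OF diff])
qed

lemma grad_y_fibre_const:
  assumes h: "smooth h" and x: "x \<in> U" and const: "\<And>y. y \<noteq> 0 \<Longrightarrow> h (x, y) = k" and y: "y \<noteq> 0"
  shows "grad_y h (x, y) = 0"
proof -
  have "((\<lambda>y. k) has_derivative (\<lambda>v. v \<bullet> grad_y h (x, y))) (at y)"
    by (rule has_derivative_transform_within_open[OF fibre_has_derivative[OF h x y], of "UNIV - {0}"])
       (use const y in auto)
  then have "(\<lambda>v. v \<bullet> grad_y h (x, y)) = (\<lambda>_. 0)" using has_derivative_unique has_derivative_const by blast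
  then show ?thesis by (metis inner_eq_zero_iff)
qed

lemma smooth_trace_ginv_dg: "smooth (\<lambda>z. trace (ginv F c z ** dg k z))"
  unfolding trace_def matrix_matrix_mult_def
  by (simp, intro smooth_arith smooth_ginv smooth_DY smooth_g)

lemma laplace_g_eq:
  assumes z: "z \<in> TU0"
  shows "laplace_g k z = trace (ginv F c z ** mpd (0, axis k 1) (dg k) z)
      - 2 * cometric z (mean_cartan z) (grad_y (g k k) z)"
proof -
  let ?H = "ginv F c z"
  note diff = smooth_imp_differentiable[OF _ z]
  have "DY i (\<lambda>z. grad_g k z $ i) z = (\<Sum>j\<in>UNIV. DY i (\<lambda>z. ginv F c z $ i $ j) z * DY j (g k k) z + ?H $ i $ j * DY k (DY k (g i j)) z)" for i
    unfolding grad_g_def matrix_vector_mult_def DY_DY_g_sym[OF z, symmetric] DY_def[of i]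
    by (simp add: pd_sum pd_mult diff smooth_ginv smooth_DY smooth_g)
  then have "laplace_g k z = (\<Sum>j\<in>UNIV. (\<Sum>i\<in>UNIV. DY i (\<lambda>z. ginv F c z $ i $ j) z) * DY j (g k k) z)
      + (\<Sum>i\<in>UNIV. \<Sum>j\<in>UNIV. ?H $ i $ j * DY k (DY k (g i j)) z)"
    unfolding laplace_g_def by (simp add: sum.distrib sum_distrib_right) (rule sum.swap)
  moreover have "(\<Sum>j\<in>UNIV. (\<Sum>i\<in>UNIV. DY i (\<lambda>z. ginv F c z $ i $ j) z) * DY j (g k k) z)
      = - 2 * cometric z (mean_cartan z) (grad_y (g k k) z)"
    unfolding divergence_ginv[OF z] cometric_sym[OF z, of "mean_cartan z"]
    by (simp add: cometric_def inner_vec_def sum_distrib_left sum_negf mult_ac)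
  moreover have "DY k (DY k (g i j)) z = DY k (DY k (g j i)) z" for i j by (rule DY_cong[OF DY_g_sym(2) z])
  then have "mpd (0, axis k 1) (dg k) z $ j $ i = DY k (DY k (g i j)) z" for i j by (simp add: DY_def)
  then have "(\<Sum>i\<in>UNIV. \<Sum>j\<in>UNIV. ?H $ i $ j * DY k (DY k (g i j)) z) = trace (?H ** mpd (0, axis k 1) (dg k) z)"
    by (simp add: trace_def matrix_matrix_mult_def del: mpd_nth)
  ultimately show ?thesis by simp
qed

lemma DY_trace_ginv_dg:
  assumes z: "z \<in> TU0"
  shows "DY k (\<lambda>z. trace (ginv F c z ** dg k z)) z
    = trace (ginv F c z ** mpd (0, axis k 1) (dg k) z) - trace (ginv F c z ** dg k z ** (ginv F c z ** dg k z))"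
proof -
  let ?H = "ginv F c z"
  note diff = smooth_imp_differentiable[OF _ z]
  have "smooth (\<lambda>z. (ginv F c z ** dg k z) $ i $ j)" for i j
    unfolding matrix_matrix_mult_def by (simp, intro smooth_arith smooth_ginv smooth_DY smooth_g)
  then have "DY k (\<lambda>z. trace (ginv F c z ** dg k z)) z = trace (mpd (0, axis k 1) (\<lambda>z. ginv F c z ** dg k z) z)"
    unfolding DY_def by (intro pd_trace diff)
  also have "\<dots> = trace (?H ** mpd (0, axis k 1) (dg k) z) + trace (mpd (0, axis k 1) (ginv F c) z ** dg k z)"
    unfolding mpd_matrix_mult[OF diff[OF smooth_ginv] diff[OF smooth_dg]] by (simp add: trace_add)
  also have "mpd (0, axis k 1) (ginv F c) z ** dg k z + ?H ** dg k z ** (?H ** dg k z) = 0"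
    unfolding mpd_ginv[OF z] dg_def[symmetric] by (simp add: matrix_mul_assoc flip: matrix_add_rdistrib)
  from arg_cong[OF this, of trace]
  have "trace (mpd (0, axis k 1) (ginv F c) z ** dg k z) = - trace (?H ** dg k z ** (?H ** dg k z))"
    unfolding trace_add by (simp add: trace_def)
  finally show ?thesis by simp
qed

lemma laplace_g_eq_trace:
  assumes x: "x \<in> U" and torsion: "\<And>y. y \<noteq> 0 \<Longrightarrow> mean_cartan (x, y) = 0" and y: "y \<noteq> 0"
  shows "laplace_g k (x, y) = trace (ginv F c (x, y) ** dg k (x, y) ** (ginv F c (x, y) ** dg k (x, y)))"
proof -
  have z: "(x, y) \<in> TU0" using x y by auto
  have "trace (ginv F c (x, y) ** dg k (x, y)) = 0" if "y \<noteq> 0" for y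
    using mean_cartan_eq_trace[of "(x, y)" k] torsion[OF that] x that by simp
  then have "grad_y (\<lambda>z. trace (ginv F c z ** dg k z)) (x, y) = 0"
    by (rule grad_y_fibre_const[OF smooth_trace_ginv_dg x _ y])
  from arg_cong[OF this, of "\<lambda>v. v $ k"] have "DY k (\<lambda>z. trace (ginv F c z ** dg k z)) (x, y) = 0" by simp
  then show ?thesis
    using DY_trace_ginv_dg[OF z] laplace_g_eq[OF z] torsion[OF y] by (simp add: cometric_def)
qed

lemma cutoff_divergence_integral_0:
  assumes V: "\<And>i. smooth (\<lambda>z. V z $ i)" and x: "x \<in> U"
    and tangent: "\<And>y. y \<noteq> 0 \<Longrightarrow> grad_y L (x, y) \<bullet> V (x, y) = 0"
    and supp: "\<And>y. norm y > R \<Longrightarrow> bump (L (x, y)) = 0" and box: "cball 0 (R + 1) \<subseteq> cbox p q"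
  shows "((\<lambda>y. bump (L (x, y)) * (\<Sum>i\<in>UNIV. DY i (\<lambda>z. V z $ i) (x, y))) has_integral 0) (cbox p q)"
proof -
  let ?d = "\<lambda>i z. bump (L z) * DY i (\<lambda>z. V z $ i) z + bump' (L z) * (DY i L z * V z $ i)"
  have cutoff: "continuous_on (U \<times> UNIV) (\<lambda>z. bump (L z) * h z)" "continuous_on (U \<times> UNIV) (\<lambda>z. bump' (L z) * h z)"
    if "smooth h" for h
    using that by (auto intro!: continuous_on_cutoff continuous_on_bump simp: bump_eq_0)
  have "((\<lambda>y. ?d i (x, y)) has_integral 0) (cbox p q)" for i
  proof (rule has_integral_directional_derivative_zero)
    fix y :: "real^'n"
    have "((\<lambda>y. (x, y)) has_derivative (\<lambda>v. (0, v))) (at y)" by (auto intro!: derivative_eq_intros)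
    moreover have "((\<lambda>z. bump (L z) * V z $ i) has_derivative
      (\<lambda>v. bump (L (x, y)) * pd v (\<lambda>z. V z $ i) (x, y) + bump' (L (x, y)) * pd v L (x, y) * V (x, y) $ i)) (at (x, y))"
      by (rule cutoff_has_derivative[OF V]) (use x in auto)
    ultimately show "((\<lambda>y. bump (L (x, y)) * V (x, y) $ i) has_derivative
      (\<lambda>v. bump (L (x, y)) * pd (0, v) (\<lambda>z. V z $ i) (x, y) + bump' (L (x, y)) * pd (0, v) L (x, y) * V (x, y) $ i)) (at y)"
      by (rule has_derivative_compose)
    show "bump (L (x, y)) * pd (0, axis i 1) (\<lambda>z. V z $ i) (x, y) + bump' (L (x, y)) * pd (0, axis i 1) L (x, y) * V (x, y) $ i
      = ?d i (x, y)" by (simp add: DY_def)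
  next
    have "continuous_on (U \<times> UNIV) (?d i)"
      by (intro continuous_on_add cutoff smooth_arith smooth_DY smooth_L V)
    then show "continuous_on UNIV (\<lambda>y. ?d i (x, y))" by (rule continuous_on_fibre[OF _ x])
  qed (use supp box in auto)
  then have "((\<lambda>y. \<Sum>i\<in>UNIV. ?d i (x, y)) has_integral (\<Sum>i::'n\<in>UNIV. 0)) (cbox p q)"
    by (intro has_integral_sum) auto
  moreover have "(\<Sum>i\<in>UNIV. ?d i (x, y)) = bump (L (x, y)) * (\<Sum>i\<in>UNIV. DY i (\<lambda>z. V z $ i) (x, y))" for y
  proof (cases "y = 0")
    case True
    then show ?thesis using L_zero[OF x] by (simp add: bump_eq_0)
  next
    case False
    then show ?thesis
      using tangent[OF False] by (simp add: inner_vec_def sum.distrib flip: sum_distrib_left)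
  qed
  ultimately show ?thesis by simp
qed

lemma DY_g_0_if_torsion_free:
  assumes x: "x \<in> U" and torsion: "\<And>y. y \<noteq> 0 \<Longrightarrow> mean_cartan (x, y) = 0" and y: "y \<noteq> 0"
  shows "DY k (g i j) (x, y) = 0"
proof -
  obtain r R where "r > 0" and "\<And>x' y. x' \<in> ball x r \<Longrightarrow> norm y > R \<Longrightarrow> bump (L (x', y)) = 0"
    using bump_L_compact_support[OF x] by metis
  then have supp: "bump (L (x, y)) = 0" if "norm y > R" for y using that by simp
  obtain p where p: "cball 0 (R + 1) \<subseteq> box (- p) (p::real^'n)"
    using bounded_subset_box_symmetric[OF bounded_cball[of 0 "R + 1"]] by blast
  have trace: "laplace_g k (x, y) = trace (ginv F c (x, y) ** dg k (x, y) ** (ginv F c (x, y) ** dg k (x, y)))"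
    if "y \<noteq> 0" for y by (rule laplace_g_eq_trace[OF x torsion that])
  have z: "(x, y) \<in> TU0" if "y \<noteq> 0" for y using x that by simp
  have "laplace_g k (x, y) = 0"
  proof (rule cutoff_integral_0_imp_0[OF smooth_laplace_g homogeneous_laplace_g x y])
    show "laplace_g k (x, y) \<ge> 0" if "y \<noteq> 0" for y
      unfolding trace[OF that]
      by (rule trace_posdef_mult_symmetric_nonneg[OF transpose_ginv ginv_posdef transpose_dg]) (use z[OF that] in auto)
    show "((\<lambda>y. bump (L (x, y)) * laplace_g k (x, y)) has_integral 0) (cbox (- p) p)"
      unfolding laplace_g_def
      by (rule cutoff_divergence_integral_0[OF smooth_grad_g x grad_y_L_grad_g supp])
         (use x p box_subset_cbox in blast)+
    show "bump (L (x, y)) = 0" if "y \<notin> box (- p) p" for y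
      using supp[of y] p that by (force simp: subset_iff)
  qed
  then have "dg k (x, y) = 0"
    using trace_posdef_mult_symmetric_eq_0[OF transpose_ginv[OF z[OF y]] ginv_posdef[OF z[OF y]] transpose_dg[OF z[OF y]]]
    unfolding trace[OF y] by blast
  then show ?thesis by (metis dg_nth zero_index)
qed

lemma constant_on_fibre_if_grad_y_0:
  assumes h: "smooth h" and x: "x \<in> U" and n: "CARD('n) \<ge> 2"
    and grad: "\<And>y. y \<noteq> 0 \<Longrightarrow> grad_y h (x, y) = 0" and y: "y \<noteq> 0" "y' \<noteq> 0"
  shows "h (x, y) = h (x, y')"
proof -
  have "(\<lambda>y. h (x, y)) constant_on (UNIV - {0})"
  proof (rule has_derivative_zero_connected_constant_on[where K="{}"])
    show "connected (UNIV - {0::real^'n})"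
      using connected_punctured_universe[of "0::real^'n"] n by (simp add: Compl_eq_Diff_UNIV)
    have D: "((\<lambda>y. h (x, y)) has_derivative (\<lambda>v. 0)) (at y)" if "y \<noteq> 0" for y
      using fibre_has_derivative[OF h x that] grad[OF that] by simp
    then show "\<forall>y\<in>UNIV - {0} - {}. ((\<lambda>y. h (x, y)) has_derivative (\<lambda>h. 0)) (at y within UNIV - {0})"
      by (auto intro: has_derivative_at_withinI)
    show "continuous_on (UNIV - {0}) (\<lambda>y. h (x, y))"
      using D by (intro continuous_at_imp_continuous_on ballI) (auto intro: has_derivative_continuous)
  qed auto
  then show ?thesis using y unfolding constant_on_def by auto
qed

theorem deicke:
  assumes "x \<in> U" "\<And>y. y \<noteq> 0 \<Longrightarrow> mean_cartan (x, y) = 0" "CARD('n) \<ge> 2" "y \<noteq> 0" "y' \<noteq> 0"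
  shows "g i j (x, y) = g i j (x, y')"
proof (rule constant_on_fibre_if_grad_y_0[OF smooth_g assms(1,3) _ assms(4,5)])
  show "grad_y (g i j) (x, y) = 0" if "y \<noteq> 0" for y
    using DY_g_0_if_torsion_free[OF assms(1,2) that] by (simp add: vec_eq_iff)
qed

end

section \<open>Invariance under isometries\<close>

definition jac :: "(real^'n \<Rightarrow> real^'n) \<Rightarrow> real^'n \<Rightarrow> real^'n^'n" where
  "jac \<Phi> x = (\<chi> k i. pd (axis i 1) (\<lambda>x. \<Phi> x $ k) x)"

definition tangent_map :: "(real^'n \<Rightarrow> real^'n) \<Rightarrow> (real^'n) \<times> (real^'n) \<Rightarrow> (real^'n) \<times> (real^'n)" where
  "tangent_map \<Phi> z = (\<Phi> (fst z), jac \<Phi> (fst z) *v snd z)"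

locale finsler_isometry = finsler_chart F c + D: finsler_chart F d
  for F :: "('m, 'n::finite) tbfun" and c d :: "('m, 'n) chart" +
  fixes \<Phi> :: "real^'n \<Rightarrow> real^'n" and W :: "(real^'n) set"
  assumes W: "open W" "W \<subseteq> snd c ` fst c" and smooth_\<Phi>: "smooth_map_on W \<Phi>"
    and \<Phi>_U: "x \<in> W \<Longrightarrow> \<Phi> x \<in> snd d ` fst d"
    and F_frechet: "x \<in> W \<Longrightarrow> Floc F d (\<Phi> x, frechet_derivative \<Phi> (at x) y) = Floc F c (x, y)"
begin

abbreviation "TW0 \<equiv> W \<times> (UNIV - {0::real^'n})"
abbreviation "T \<equiv> tangent_map \<Phi>"
abbreviation "B \<equiv> jac \<Phi>"

lemma open_TW0: "open TW0"
  by (intro open_Times W open_Diff) auto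

lemma TW0_iff: "z \<in> TW0 \<longleftrightarrow> fst z \<in> W \<and> snd z \<noteq> 0"
  by (cases z) auto

lemma TW0_subset: "z \<in> TW0 \<Longrightarrow> z \<in> TU0"
  using W by auto

lemma smooth_\<Phi>_nth: "smooth_on W (\<lambda>x. \<Phi> x $ k)"
  using smooth_\<Phi> unfolding smooth_map_on_vec_iff by blast

lemma smooth_jac: "smooth_on W (\<lambda>x. B x $ k $ i)"
  unfolding jac_def using smooth_on_pd[OF smooth_\<Phi>_nth, of "axis i 1" k] by (simp add: axis_in_Basis_iff)

lemma jac_differentiable: "x \<in> W \<Longrightarrow> (\<lambda>x. B x $ k $ i) differentiable (at x)"
  by (rule smooth_on_imp_differentiable[OF smooth_jac W(1)])

lemma \<Phi>_has_derivative:
  assumes "x \<in> W"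
  shows "(\<Phi> has_derivative (\<lambda>v. B x *v v)) (at x)"
proof -
  note diff = smooth_on_imp_differentiable[OF smooth_\<Phi>_nth W(1) assms]
  have "vpd v \<Phi> x = B x *v v" for v
    by (simp add: vec_eq_iff pd_axis_expansion[OF diff, of v] jac_def matrix_vector_mult_def mult.commute)
  then show ?thesis using has_derivative_vpd[OF diff] by simp
qed

lemma mpd_jac_symmetric:
  assumes "x \<in> W"
  shows "mpd a B x *v b = mpd b B x *v a"
proof (subst vec_eq_iff, intro allI)
  fix k
  have expand: "(mpd a B x *v b) $ k = (\<Sum>i\<in>UNIV. \<Sum>j\<in>UNIV. b $ i * a $ j * pd (axis j 1) (pd (axis i 1) (\<lambda>x. \<Phi> x $ k)) x)" for a b
    using pd_axis_expansion[OF jac_differentiable[OF assms, of k], of a]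
    by (simp add: matrix_vector_mult_def sum_distrib_left mult_ac jac_def)
  show "(mpd a B x *v b) $ k = (mpd b B x *v a) $ k"
    unfolding expand
    by (subst sum.swap) (intro sum.cong refl, simp add: pd_commute[OF W(1) smooth_\<Phi>_nth assms] axis_in_Basis_iff)
qed

lemma F_tangent: "x \<in> W \<Longrightarrow> Floc F d (\<Phi> x, B x *v y) = Floc F c (x, y)"
  using F_frechet[of x y] frechet_derivative_at[OF \<Phi>_has_derivative] by metis

lemma jac_mult_nonzero: "x \<in> W \<Longrightarrow> y \<noteq> 0 \<Longrightarrow> B x *v y \<noteq> 0"
  using F_tangent[of x y] D.F_zero[OF \<Phi>_U] F_pos[of "(x, y)"] W by auto

lemma jac_invertible: "x \<in> W \<Longrightarrow> invertible (B x)"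
  using jac_mult_nonzero by (intro invertible_if_kernel_trivial) blast

lemma tangent_TU0: "z \<in> TW0 \<Longrightarrow> T z \<in> D.TU0"
  using \<Phi>_U jac_mult_nonzero by (auto simp: tangent_map_def)

lemma F_pullback: "z \<in> TW0 \<Longrightarrow> Floc F c z = Floc F d (T z)"
  using F_tangent[of "fst z" "snd z"] by (auto simp: tangent_map_def)

lemma L_pullback: "z \<in> TW0 \<Longrightarrow> L z = D.L (T z)"
  by (simp add: Lsq_def F_pullback)

lemma tangent_has_derivative:
  assumes z: "z \<in> TW0"
  shows "(T has_derivative (\<lambda>v. (B (fst z) *v fst v, mpd (fst v) B (fst z) *v snd z + B (fst z) *v snd v))) (at z)"
proof -
  have x: "fst z \<in> W" using z by (simp add: TW0_iff)
  have fst: "(fst has_derivative fst) (at z)" by (auto intro!: derivative_eq_intros)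
  have snd: "(\<lambda>z. snd z $ i) differentiable (at z)" for i
    by (rule bounded_linear_imp_differentiable[OF bounded_linear_snd_nth])
  note jac_fst = differentiable_chain[OF fst jac_differentiable[OF x]]
  have "(\<lambda>z. (B (fst z) *v snd z) $ i) differentiable (at z)" for i
    unfolding matrix_vector_mult_def using jac_fst snd by (simp add: differentiable_sum differentiable_mult)
  from has_derivative_vpd[OF this]
  have "((\<lambda>z. B (fst z) *v snd z) has_derivative (\<lambda>v. mpd v (\<lambda>z. B (fst z)) z *v snd z + B (fst z) *v vpd v snd z)) (at z)"
    unfolding vpd_matrix_vector_mult[OF jac_fst snd] .
  moreover have "mpd v (\<lambda>z. B (fst z)) z = mpd (fst v) B (fst z)" "vpd v snd z = snd v" for v
    using pd_chain[OF fst jac_differentiable[OF x]] by (simp_all add: vec_eq_iff pd_snd_nth)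
  ultimately show ?thesis
    unfolding tangent_map_def[abs_def] by (intro has_derivative_Pair has_derivative_compose[OF fst \<Phi>_has_derivative[OF x]]) simp
qed

lemma
  assumes z: "z \<in> TW0" and h: "D.smooth h"
  shows pd_pullback: "pd v (\<lambda>z. h (T z)) z
      = pd (B (fst z) *v fst v, mpd (fst v) B (fst z) *v snd z + B (fst z) *v snd v) h (T z)"
    and pullback_differentiable: "(\<lambda>z. h (T z)) differentiable (at z)"
  using pd_chain[OF tangent_has_derivative[OF z] D.smooth_imp_differentiable[OF h tangent_TU0[OF z]]]
    differentiable_chain[OF tangent_has_derivative[OF z] D.smooth_imp_differentiable[OF h tangent_TU0[OF z]]]
  by blast+

lemma grad_y_pullback:
  assumes h: "smooth h" and h': "D.smooth h'" and xy: "x \<in> W" "y \<noteq> 0"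
    and eq: "\<And>y. y \<noteq> 0 \<Longrightarrow> h (x, y) = h' (T (x, y)) + k"
  shows "grad_y h (x, y) = transpose (B x) *v grad_y h' (T (x, y))"
proof -
  have T: "T (x, y) = (\<Phi> x, B x *v y)" for y by (simp add: tangent_map_def)
  have "((\<lambda>y. h' (\<Phi> x, B x *v y)) has_derivative (\<lambda>v. (B x *v v) \<bullet> grad_y h' (\<Phi> x, B x *v y))) (at y)"
    by (rule has_derivative_compose[OF linear_imp_has_derivative[OF matrix_vector_mul_linear]
          D.fibre_has_derivative[OF h' \<Phi>_U[OF xy(1)] jac_mult_nonzero[OF xy]]])
  from has_derivative_add_const[OF this, of k]
  have "((\<lambda>y. h (x, y)) has_derivative (\<lambda>v. (B x *v v) \<bullet> grad_y h' (\<Phi> x, B x *v y))) (at y)"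
    by (rule has_derivative_transform_within_open[of _ _ _ _ "UNIV - {0}"]) (use xy eq in \<open>auto simp: T\<close>)
  then have "(\<lambda>v. v \<bullet> grad_y h (x, y)) = (\<lambda>v. (B x *v v) \<bullet> grad_y h' (T (x, y)))"
    unfolding T using fibre_has_derivative[OF h _ xy(2)] xy(1) W(2) by (intro has_derivative_unique[of "\<lambda>y. h (x, y)"]) auto
  then have "v \<bullet> grad_y h (x, y) = v \<bullet> (transpose (B x) *v grad_y h' (T (x, y)))" for v
    by (simp add: fun_eq_iff inner_commute[of v] inner_commute[of "B x *v v"] dot_lmul_matrix)
  then show ?thesis using vector_eq_ldot by blast
qed

lemma grad_y_L_pullback:
  assumes "z \<in> TW0"
  shows "grad_y L z = transpose (B (fst z)) *v grad_y D.L (T z)"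
  using grad_y_pullback[OF smooth_L D.smooth_L, of "fst z" "snd z" 0] L_pullback assms by (simp add: TW0_iff)

lemma gmat_pullback:
  assumes z: "z \<in> TW0"
  shows "gmat z = transpose (B (fst z)) ** D.gmat (T z) ** B (fst z)"
proof -
  let ?x = "fst z"
  have x: "?x \<in> W" and y: "snd z \<noteq> 0" using z by (simp_all add: TW0_iff)
  have "gmat z $ i $ j = (transpose (B ?x) ** D.gmat (T z) ** B ?x) $ i $ j" for i j
  proof -
    define h where "h w = (\<Sum>k\<in>UNIV. B ?x $ k $ j * DY k D.L w)" for w
    have smooth_h: "D.smooth h" unfolding h_def[abs_def] by (intro D.smooth_arith D.smooth_DY D.smooth_L)
    have "DY j L (?x, y) = h (T (?x, y)) + 0" if "y \<noteq> 0" for y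
      using arg_cong[OF grad_y_L_pullback[of "(?x, y)"], of "\<lambda>v. v $ j"] x that
      by (simp add: h_def vector_matrix_mult_def mult.commute)
    then have "grad_y (DY j L) (?x, snd z) = transpose (B ?x) *v grad_y h (T (?x, snd z))"
      by (rule grad_y_pullback[OF smooth_DY[OF smooth_L] smooth_h x y])
    moreover have "DY l h (T z) = (\<Sum>k\<in>UNIV. B ?x $ k $ j * DY l (DY k D.L) (T z))" for l
      unfolding h_def[abs_def] DY_def[of l]
      by (simp add: pd_sum pd_cmult D.smooth_imp_differentiable[OF D.smooth_DY[OF D.smooth_L] tangent_TU0[OF z]])
    ultimately have "DY i (DY j L) z = (\<Sum>l\<in>UNIV. B ?x $ l $ i * (\<Sum>k\<in>UNIV. B ?x $ k $ j * DY l (DY k D.L) (T z)))"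
      by (simp add: vec_eq_iff vector_matrix_mult_def mult.commute)
    then show ?thesis
      by (simp add: gten_def matrix_matrix_mult_def transpose_def sum_distrib_left sum_distrib_right mult_ac)
         (subst sum.swap, simp add: mult.left_commute)
  qed
  then show ?thesis by (simp add: vec_eq_iff)
qed

lemma grad_x_L_pullback:
  assumes z: "z \<in> TW0"
  shows "grad_x L z = transpose (B (fst z)) *v grad_x D.L (T z) + transpose (mpd (snd z) B (fst z)) *v grad_y D.L (T z)"
proof (subst vec_eq_iff, intro allI)
  fix l
  have x: "fst z \<in> W" using z by (simp add: TW0_iff)
  have "DX l L z = pd (axis l 1, 0) (\<lambda>z. D.L (T z)) z"
    unfolding DX_def by (rule pd_cong_open[OF open_TW0 z L_pullback])
  also have "\<dots> = (B (fst z) *v axis l 1) \<bullet> grad_x D.L (T z) + (mpd (snd z) B (fst z) *v axis l 1) \<bullet> grad_y D.L (T z)"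
    unfolding pd_pullback[OF z D.smooth_L] using mpd_jac_symmetric[OF x, of "axis l 1" "snd z"]
    by (simp add: pd_pair[OF D.smooth_imp_differentiable[OF D.smooth_L tangent_TU0[OF z]]])
  finally show "grad_x L z $ l = (transpose (B (fst z)) *v grad_x D.L (T z) + transpose (mpd (snd z) B (fst z)) *v grad_y D.L (T z)) $ l"
    by (simp add: matrix_vector_mult_basis column_def inner_vec_def vector_matrix_mult_def mult.commute del: mpd_nth)
qed

text \<open>The tangent map transports the Euler--Lagrange equations, which determine the spray.\<close>

lemma spray_vec_pullback:
  assumes z: "z \<in> TW0"
  shows "(B (fst z) *v snd z, mpd (snd z) B (fst z) *v snd z + B (fst z) *v (- 2 *\<^sub>R Gvec z)) = D.spray_vec (T z)"
    (is "(_, ?m) = _")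
proof -
  have x: "fst z \<in> W" using z by (simp add: TW0_iff)
  let ?S = "spray_vec z" and ?P = "\<lambda>z. grad_y D.L (T z)" and ?B = "B (fst z)"
  have smooth_P: "D.smooth (\<lambda>z. grad_y D.L z $ k)" for k by (simp add: D.smooth_DY D.smooth_L)
  have fst: "(fst has_derivative fst) (at z)" by (auto intro!: derivative_eq_intros)
  have "grad_x L z = vpd ?S (grad_y L) z" by (rule euler_lagrange[OF TW0_subset[OF z], symmetric])
  also have "pd ?S (\<lambda>z. grad_y L z $ i) z = pd ?S (\<lambda>z. (transpose (B (fst z)) *v ?P z) $ i) z" for i
    by (rule pd_cong_open[OF open_TW0 z]) (simp only: grad_y_L_pullback)
  then have "vpd ?S (grad_y L) z = vpd ?S (\<lambda>z. transpose (B (fst z)) *v ?P z) z" by (simp only: vpd_def)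
  also have "\<dots> = mpd ?S (\<lambda>z. transpose (B (fst z))) z *v ?P z + transpose ?B *v vpd ?S ?P z"
    using differentiable_chain[OF fst jac_differentiable[OF x]] pullback_differentiable[OF z smooth_P]
    by (intro vpd_matrix_vector_mult) (auto simp: transpose_def)
  also have "mpd ?S (\<lambda>z. transpose (B (fst z))) z = transpose (mpd (snd z) B (fst z))"
    using pd_chain[OF fst jac_differentiable[OF x]] by (simp add: vec_eq_iff transpose_def spray_vec_def)
  finally have "transpose ?B *v grad_x D.L (T z) = transpose ?B *v vpd ?S ?P z"
    unfolding grad_x_L_pullback[OF z] by simp
  then have P: "grad_x D.L (T z) = vpd ?S ?P z"
    using matrix_inv_vector_mult(1)[OF transpose_invertible[OF jac_invertible[OF x]]] by metis
  have "(snd (T z), ?m) = D.spray_vec (T z)"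
  proof (rule D.spray_vec_unique[OF tangent_TU0[OF z]])
    fix l
    have "DX l D.L (T z) = pd ?S (\<lambda>z. DY l D.L (T z)) z" using arg_cong[OF P, of "\<lambda>v. v $ l"] by simp
    then show "pd (snd (T z), ?m) (DY l D.L) (T z) = DX l D.L (T z)"
      unfolding pd_pullback[OF z D.smooth_DY[OF D.smooth_L]] by (simp add: tangent_map_def spray_vec_def)
  qed
  then show ?thesis by (simp add: tangent_map_def)
qed

lemma spray_deriv_pullback:
  assumes eq: "\<And>z. z \<in> TW0 \<Longrightarrow> h z = h' (T z)" and h': "D.smooth h'" and z: "z \<in> TW0"
  shows "spray_deriv h z = D.spray_deriv h' (T z)"
proof -
  have "spray_deriv h z = pd (spray_vec z) (\<lambda>z. h' (T z)) z"
    unfolding spray_deriv_def by (rule pd_cong_open[OF open_TW0 z eq])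
  also have "\<dots> = D.spray_deriv h' (T z)"
    unfolding pd_pullback[OF z h'] D.spray_deriv_def spray_vec_pullback[OF z, symmetric] by (simp add: spray_vec_def)
  finally show ?thesis .
qed

lemma det_jac_nonzero: "x \<in> W \<Longrightarrow> det (B x) \<noteq> 0"
  using jac_invertible invertible_det_nz by blast

lemma ln_sqrt_det_pullback:
  assumes z: "z \<in> TW0"
  shows "ln_sqrt_det z = D.ln_sqrt_det (T z) + ln \<bar>det (B (fst z))\<bar>"
proof -
  define a where "a = det (B (fst z))"
  define b where "b = det (D.gmat (T z))"
  have nonzero: "a \<noteq> 0" "b \<noteq> 0"
    using det_jac_nonzero D.det_gmat_nonzero[OF tangent_TU0[OF z]] z by (auto simp: a_def b_def TW0_iff)
  have "(det (gmat z))\<^sup>2 = b\<^sup>2 * \<bar>a\<bar> ^ 4"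
    unfolding gmat_pullback[OF z] a_def b_def by (simp add: det_mul det_transpose power2_eq_square power4_eq_xxxx)
  then have "ln ((det (gmat z))\<^sup>2) = ln (b\<^sup>2) + ln (\<bar>a\<bar> ^ 4)" using nonzero by (simp only: ln_mult) (simp add: ln_mult)
  also have "ln (\<bar>a\<bar> ^ 4) = 4 * ln \<bar>a\<bar>" using nonzero by (subst ln_realpow) auto
  finally show ?thesis unfolding ln_sqrt_det_def D.ln_sqrt_det_def a_def b_def by simp
qed

lemma vol_pullback:
  assumes x: "x \<in> W"
  shows "D.vol (\<Phi> x) = \<bar>det (B x)\<bar> * vol x"
proof -
  have "{y. Floc F d (\<Phi> x, y) < 1} = (\<lambda>y. B x *v y) ` {y. Floc F c (x, y) < 1}"
  proof (intro set_eqI iffI)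
    fix y assume "y \<in> {y. Floc F d (\<Phi> x, y) < 1}"
    then show "y \<in> (\<lambda>y. B x *v y) ` {y. Floc F c (x, y) < 1}"
      using F_tangent[OF x, of "matrix_inv (B x) *v y"] matrix_inv_vector_mult(2)[OF jac_invertible[OF x], of y]
      by (intro image_eqI[of _ _ "matrix_inv (B x) *v y"]) auto
  qed (use F_tangent[OF x] in auto)
  moreover have "x \<in> U" using x W by auto
  ultimately show ?thesis unfolding vol_def D.vol_def
    using measure_linear_image_cart[OF matrix_vector_mul_linear[of "B x"] F_ball_lmeasurable] by simp
qed

lemma distortion_pullback:
  assumes z: "z \<in> TW0"
  shows "distortion z = D.distortion (T z)"
proof -
  have x: "fst z \<in> W" "fst z \<in> U" using z W by (auto simp: TW0_iff)
  show ?thesis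
    unfolding distortion_def D.distortion_def ln_sqrt_det_pullback[OF z]
    using vol_pullback[OF x(1)] vol_pos[OF x(2)] det_jac_nonzero[OF x(1)] by (simp add: tangent_map_def ln_mult)
qed

lemma mean_cartan_pullback:
  assumes "z \<in> TW0"
  shows "mean_cartan z = transpose (B (fst z)) *v D.mean_cartan (T z)"
  unfolding mean_cartan_def D.mean_cartan_def
  using grad_y_pullback[OF smooth_ln_sqrt_det D.smooth_ln_sqrt_det, of "fst z" "snd z"] ln_sqrt_det_pullback assms
  by (simp add: TW0_iff)

lemma torsion_norm_pullback:
  assumes z: "z \<in> TW0"
  shows "torsion_norm z = D.torsion_norm (T z)"
proof -
  have "invertible (B (fst z))" using jac_invertible z by (simp add: TW0_iff)
  from inner_matrix_inv_congruence[OF this D.gmat_invertible[OF tangent_TU0[OF z]]]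
  show ?thesis
    unfolding torsion_norm_def D.torsion_norm_def cometric_def D.cometric_def ginv_eq D.ginv_eq
      mean_cartan_pullback[OF z] gmat_pullback[OF z] L_pullback[OF z] by simp
qed

end

section \<open>Vanishing S-curvature and the Jacobi equation\<close>

context finsler_chart
begin

definition riem_mat :: "(real^'n) \<times> (real^'n) \<Rightarrow> real^'n^'n" where
  "riem_mat z = (\<chi> i k. riem F c i k z)"

definition mean_landsberg :: "(real^'n) \<times> (real^'n) \<Rightarrow> real^'n" where
  "mean_landsberg z = cov_deriv mean_cartan z"

lemma riem_op_eq: "riem_op F c z u = riem_mat z *v u"
  by (simp add: riem_op_def riem_mat_def matrix_vector_mult_def)

lemma transpose_riem_mat:
  assumes z: "z \<in> TU0"
  shows "transpose (riem_mat z) = 2 *\<^sub>R (\<chi> i j. DX i (G j) z) - mpd (spray_vec z) Nmat z - Nmat z ** Nmat z"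
proof -
  have "riem F c j i z = 2 * DX i (G j) z - pd (spray_vec z) (N i j) z - (\<Sum>k\<in>UNIV. N i k z * N k j z)" for i j
    using spray_deriv_eq[OF smooth_imp_differentiable[OF smooth_N z], of i j]
    by (simp add: riem_def spray_deriv_def inner_vec_def Gvec_def sum_distrib_left mult.commute)
  then show ?thesis
    by (simp add: vec_eq_iff transpose_def riem_mat_def Nmat_def matrix_matrix_mult_def)
qed

lemma smooth_cov_deriv:
  assumes A: "\<And>i. smooth (\<lambda>z. A z $ i)"
  shows "smooth (\<lambda>z. cov_deriv A z $ i)"
  unfolding cov_deriv_def Nmat_def matrix_vector_mult_def vpd_def
  using smooth_spray_deriv[OF A] unfolding spray_deriv_def[abs_def]
  by (simp, intro smooth_arith smooth_N A)

lemmas smooth_mean_landsberg = smooth_cov_deriv[OF smooth_mean_cartan, folded mean_landsberg_def]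

lemma spray_deriv_torsion_norm:
  assumes z: "z \<in> TU0"
  shows "spray_deriv torsion_norm z = 2 * L z * cometric z (mean_cartan z) (mean_landsberg z)"
  unfolding torsion_norm_def[abs_def] mean_landsberg_def
  using spray_deriv_mult[OF smooth_L smooth_cometric[OF smooth_mean_cartan smooth_mean_cartan] z]
    spray_deriv_cometric[OF smooth_mean_cartan smooth_mean_cartan z] cometric_sym[OF z] spray_deriv_L[OF z]
  by simp

lemma flag_curv_covector:
  assumes x: "x \<in> U" "y \<noteq> 0" and a: "a \<noteq> 0" "y \<bullet> a = 0"
  obtains u k where "u \<notin> span {y}" "k > 0" "cometric (x, y) a (transpose (riem_mat (x, y)) *v a) = k * flag_curv F c x y u"
proof -
  let ?z = "(x, y)"
  define u where "u = ginv F c ?z *v a"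
  have z: "?z \<in> TU0" using x by auto
  have gu: "gmat ?z *v u = a" unfolding u_def by (simp add: matrix_vector_mul_assoc gmat_ginv[OF z])
  then have u: "u \<noteq> 0" using a by auto
  have yu: "gform F c ?z y u = 0" unfolding gform_eq gu by (rule a)
  have pos: "gform F c ?z v v > 0" if "v \<noteq> 0" for v unfolding gform_eq by (rule gmat_posdef[OF z that])
  define k where "k = gform F c ?z y y * gform F c ?z u u"
  have k: "k > 0" unfolding k_def using pos x u by simp
  have span: "u \<notin> span {y}"
  proof
    assume "u \<in> span {y}"
    then obtain t where t: "u = t *\<^sub>R y" unfolding span_singleton by auto
    then have "t * gform F c ?z y y = 0" using yu by (simp add: gform_eq matrix_vector_mult_scaleR)
    then show False using pos[OF x(2)] u t by simp
  qed
  have "cometric ?z a (transpose (riem_mat ?z) *v a) = cometric ?z (transpose (riem_mat ?z) *v a) a"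
    by (rule cometric_sym[OF z])
  also have "\<dots> = (gmat ?z *v u) \<bullet> (riem_mat ?z *v u)"
    unfolding gu cometric_def u_def[symmetric] by (simp add: dot_lmul_matrix)
  also have "\<dots> = gform F c ?z u (riem_op F c ?z u)"
    unfolding gform_eq riem_op_eq using transpose_gmat[OF z]
    by (metis dot_lmul_matrix transpose_matrix_vector)
  also have "\<dots> = k * flag_curv F c x y u"
    using k by (simp add: flag_curv_def yu flip: k_def)
  finally show ?thesis by (rule that[OF span k])
qed

end

locale zero_S_chart = finsler_chart F c
  for F :: "('m, 'n::finite) tbfun" and c :: "('m, 'n) chart" +
  assumes Scurv_0: "x \<in> snd c ` fst c \<Longrightarrow> y \<noteq> 0 \<Longrightarrow> Scurv F c (x, y) = 0"
begin

lemma spray_deriv_distortion_0: "z \<in> TU0 \<Longrightarrow> spray_deriv distortion z = 0"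
  using spray_deriv_distortion[of z] Scurv_0[of "fst z" "snd z"] by (simp add: TU0_iff)

lemma pd_ln_vol:
  assumes x: "x \<in> U" and y: "y \<noteq> 0"
  shows "pd y (\<lambda>x. ln (vol x)) x = - trace (Nmat (x, y))"
proof -
  have z: "(x, y) \<in> TU0" using x y by auto
  have "spray_deriv distortion (x, y) = trace (Nmat (x, y)) + pd y (\<lambda>x. ln (vol x)) x"
    using pd_distortion[OF z, of "spray_vec (x, y)"] spray_deriv_ln_sqrt_det[OF z]
    by (simp add: spray_deriv_def spray_vec_def)
  then show ?thesis using spray_deriv_distortion_0[OF z] by simp
qed

lemma smooth_restrict_fibre:
  assumes "smooth f" "(y::real^'n) \<noteq> 0"
  shows "smooth_on U (\<lambda>x. f (x, y))"
proof (rule smooth_on_compose[OF open_U open_TU0 _ _ assms(1)])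
  show "smooth_map_on U (\<lambda>x. (x, y))"
    unfolding smooth_map_on_def
  proof
    fix b :: "(real^'n) \<times> (real^'n)" assume "b \<in> Basis"
    have "(\<lambda>x. (x, y) \<bullet> b) = (\<lambda>x. x \<bullet> fst b + y \<bullet> snd b)" by (simp add: inner_prod_def)
    then show "smooth_on U (\<lambda>x. (x, y) \<bullet> b)"
      by (simp add: smooth_on_add smooth_on_const smooth_on_bounded_linear open_U bounded_linear_inner_left)
  qed
qed (use assms(2) in auto)

lemma smooth_ln_vol: "smooth_on U (\<lambda>x. ln (vol x))"
proof (rule smooth_onI_pd[OF open_U ln_vol_differentiable])
  fix b :: "real^'n" assume "b \<in> Basis"
  then have b: "b \<noteq> 0" using nonzero_Basis by blast
  have "smooth (\<lambda>z. - trace (Nmat z))"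
    using smooth_on_cmult[OF open_TU0 smooth_on_sum[OF open_TU0 smooth_N], of "-1"] by (simp add: trace_def Nmat_def)
  from smooth_on_cong[OF open_U smooth_restrict_fibre[OF this b]]
  show "smooth_on U (pd b (\<lambda>x. ln (vol x)))" using pd_ln_vol[OF _ b] by simp
qed

lemma smooth_distortion: "smooth distortion"
proof -
  have "smooth_map_on TU0 fst"
    unfolding smooth_map_on_def
    by (auto intro!: smooth_on_bounded_linear[OF open_TU0] bounded_linear_compose[OF bounded_linear_inner_left bounded_linear_fst])
  then have "smooth (\<lambda>z. ln (vol (fst z)))"
    by (rule smooth_on_compose[OF open_TU0 open_U _ _ smooth_ln_vol]) auto
  then show ?thesis unfolding distortion_def[abs_def] by (intro smooth_arith smooth_ln_sqrt_det)
qed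

lemma mean_cartan_eq: "z \<in> TU0 \<Longrightarrow> mean_cartan z = grad_y distortion z"
  by (simp add: mean_cartan_def vec_eq_iff DY_distortion)

lemma vpd_mean_cartan: "z \<in> TU0 \<Longrightarrow> vpd v mean_cartan z = vpd v (grad_y distortion) z"
  unfolding vpd_def by (simp only: vec_eq_iff vec_lambda_beta) (intro allI pd_cong, simp_all only: mean_cartan_eq)

lemma grad_spray_deriv_distortion:
  assumes z: "z \<in> TU0"
  shows "grad_x (spray_deriv distortion) z = 0" "grad_y (spray_deriv distortion) z = 0"
  using DX_cong[OF spray_deriv_distortion_0 z] DY_cong[OF spray_deriv_distortion_0 z]
  by (simp_all add: vec_eq_iff DX_def DY_def)

lemma mean_landsberg_eq:
  assumes z: "z \<in> TU0"
  shows "mean_landsberg z = Nmat z *v mean_cartan z - grad_x distortion z"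
  using grad_y_spray_deriv[OF smooth_distortion z] grad_spray_deriv_distortion[OF z]
  by (simp add: mean_landsberg_def cov_deriv_def vpd_mean_cartan[OF z] mean_cartan_eq[OF z] scaleR_2 algebra_simps)

lemma hor_deriv_distortion: "z \<in> TU0 \<Longrightarrow> hor_deriv v distortion z = - (v \<bullet> mean_landsberg z)"
  by (simp add: hor_deriv_eq[OF smooth_imp_differentiable[OF smooth_distortion]] mean_landsberg_eq mean_cartan_eq
      inner_diff_right)

text \<open>The mean Cartan torsion is a Jacobi field along the geodesics.\<close>

theorem cov_deriv_mean_landsberg:
  assumes z: "z \<in> TU0"
  shows "cov_deriv mean_landsberg z = - (transpose (riem_mat z) *v mean_cartan z)"
proof -
  let ?v = "spray_vec z" and ?I = "mean_cartan z" and ?J = "mean_landsberg z"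
  let ?D = "\<chi> i j. DX i (G j) z"
  note diff = smooth_imp_differentiable[OF _ z]
  have "vpd ?v (grad_x distortion) z = 2 *\<^sub>R (?D *v ?I)"
    using grad_x_spray_deriv[OF smooth_distortion z] grad_spray_deriv_distortion[OF z]
    by (simp add: mean_cartan_eq[OF z] vec_eq_iff matrix_vector_mult_def)
  moreover have "vpd ?v mean_cartan z = ?J + Nmat z *v ?I"
    by (simp add: mean_landsberg_def cov_deriv_def)
  then have "vpd ?v (\<lambda>z. Nmat z *v mean_cartan z) z = mpd ?v Nmat z *v ?I + Nmat z *v (?J + Nmat z *v ?I)"
    by (subst vpd_matrix_vector_mult) (simp_all add: Nmat_def diff smooth_N smooth_mean_cartan)
  moreover have "vpd ?v mean_landsberg z = vpd ?v (\<lambda>z. Nmat z *v mean_cartan z) z - vpd ?v (grad_x distortion) z"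
  proof -
    have "smooth (\<lambda>z. (Nmat z *v mean_cartan z) $ i)" for i
      unfolding matrix_vector_mult_def Nmat_def by (simp, intro smooth_arith smooth_N smooth_mean_cartan)
    then have "pd ?v (\<lambda>z. (Nmat z *v mean_cartan z) $ i - DX i distortion z) z
        = pd ?v (\<lambda>z. (Nmat z *v mean_cartan z) $ i) z - pd ?v (DX i distortion) z" for i
      by (intro pd_diff diff smooth_DX smooth_distortion)
    moreover have "pd ?v (\<lambda>z. mean_landsberg z $ i) z = pd ?v (\<lambda>z. (Nmat z *v mean_cartan z) $ i - DX i distortion z) z" for i
      by (rule pd_cong[OF _ z]) (simp add: mean_landsberg_eq)
    ultimately show ?thesis by (simp add: vec_eq_iff)
  qed
  ultimately have "cov_deriv mean_landsberg z
      = mpd ?v Nmat z *v ?I + Nmat z *v (Nmat z *v ?I) - 2 *\<^sub>R (?D *v ?I)"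
    by (simp add: cov_deriv_def matrix_vector_right_distrib)
  then show ?thesis
    unfolding transpose_riem_mat[OF z]
    by (simp add: matrix_vector_mult_diff_rdistrib matrix_vector_mul_assoc scaleR_matrix_vector_assoc)
qed

lemma spray_deriv_spray_deriv_torsion_norm:
  assumes z: "z \<in> TU0"
  shows "spray_deriv (spray_deriv torsion_norm) z = 2 * L z * (cometric z (mean_landsberg z) (mean_landsberg z)
      - cometric z (mean_cartan z) (transpose (riem_mat z) *v mean_cartan z))"
proof -
  have smooth: "smooth (\<lambda>z. cometric z (mean_cartan z) (mean_landsberg z))"
    by (rule smooth_cometric[OF smooth_mean_cartan smooth_mean_landsberg])
  have "spray_deriv (spray_deriv torsion_norm) z
      = spray_deriv (\<lambda>z. L z * (2 * cometric z (mean_cartan z) (mean_landsberg z))) z"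
    by (rule spray_deriv_cong[OF _ z]) (simp add: spray_deriv_torsion_norm)
  also have "\<dots> = L z * spray_deriv (\<lambda>z. 2 * cometric z (mean_cartan z) (mean_landsberg z)) z"
    using spray_deriv_L[OF z] by (subst spray_deriv_mult[OF smooth_L smooth_on_cmult[OF open_TU0 smooth] z]) simp
  also have "spray_deriv (\<lambda>z. 2 * cometric z (mean_cartan z) (mean_landsberg z)) z
      = 2 * spray_deriv (\<lambda>z. cometric z (mean_cartan z) (mean_landsberg z)) z"
    unfolding spray_deriv_def by (rule pd_cmult[OF smooth_imp_differentiable[OF smooth z]])
  finally show ?thesis
    unfolding spray_deriv_cometric[OF smooth_mean_cartan smooth_mean_landsberg z] cov_deriv_mean_landsberg[OF z]
    by (simp add: mean_landsberg_def[symmetric] cometric_def linear_neg[OF matrix_vector_mul_linear])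
qed

end

section \<open>The maximum principle on a homogeneous space\<close>

context finsler_chart
begin

definition isometry_invariant :: "((real^'n) \<times> (real^'n) \<Rightarrow> real) \<Rightarrow> bool" where
  "isometry_invariant h \<longleftrightarrow>
     (\<forall>\<Phi> W. finsler_isometry F c c \<Phi> W \<longrightarrow> (\<forall>z \<in> W \<times> (UNIV - {0}). h z = h (tangent_map \<Phi> z)))"

lemma isometry_invariant_distortion: "isometry_invariant distortion"
  unfolding isometry_invariant_def using finsler_isometry.distortion_pullback by blast

lemma isometry_invariant_torsion_norm: "isometry_invariant torsion_norm"
  unfolding isometry_invariant_def using finsler_isometry.torsion_norm_pullback by blast

lemma isometry_invariant_F: "isometry_invariant (Floc F c)"
  unfolding isometry_invariant_def using finsler_isometry.F_pullback by blast

lemma isometry_invariant_spray_deriv: "smooth h \<Longrightarrow> isometry_invariant h \<Longrightarrow> isometry_invariant (spray_deriv h)"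
  unfolding isometry_invariant_def using finsler_isometry.spray_deriv_pullback[of F c c _ _ h h] by blast

lemma isometry_invariant_combine:
  "isometry_invariant h \<Longrightarrow> isometry_invariant k \<Longrightarrow> isometry_invariant (\<lambda>z. op (h z) (k z))"
  unfolding isometry_invariant_def by metis

lemma smooth_inverse_F: "smooth (\<lambda>z. inverse (Floc F c z))"
  using F_pos by (intro smooth_on_inverse open_TU0 smooth_F) force

lemma spray_deriv_divide_F:
  assumes f: "smooth f" and z: "z \<in> TU0"
  shows "spray_deriv (\<lambda>z. f z * inverse (Floc F c z)) z = spray_deriv f z * inverse (Floc F c z)"
proof -
  have "spray_deriv (\<lambda>z. inverse (Floc F c z)) z = 0"
    using spray_deriv_F[OF z] F_pos[OF z] smooth_imp_differentiable[OF smooth_F z]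
    by (simp add: spray_deriv_def pd_inverse)
  then show ?thesis by (simp add: spray_deriv_mult f smooth_inverse_F z)
qed

end

locale homogeneous_chart = finsler_chart F c
  for F :: "('m, 'n::finite) tbfun" and c :: "('m, 'n) chart" +
  assumes transitive: "x1 \<in> snd c ` fst c \<Longrightarrow> x0 \<in> snd c ` fst c \<Longrightarrow>
    \<exists>\<Phi> W. finsler_isometry F c c \<Phi> W \<and> x1 \<in> W \<and> \<Phi> x1 = x0"
begin

lemma invariant_max:
  assumes diff: "\<forall>z\<in>TU0. h differentiable (at z)" and hom: "homogeneous_deg 0 h"
    and inv: "isometry_invariant h" and x0: "x0 \<in> U"
  shows "\<exists>y0. y0 \<noteq> 0 \<and> (\<forall>z\<in>TU0. h z \<le> h (x0, y0)) \<and> spray_deriv h (x0, y0) = 0"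
proof -
  have cont: "continuous_on (sphere (0::real^'n) 1) (\<lambda>y. h (x0, y))"
  proof (rule continuous_on_compose2[of TU0 h])
    show "continuous_on TU0 h"
      by (intro continuous_at_imp_continuous_on ballI differentiable_imp_continuous_within diff[rule_format])
  qed (use x0 in \<open>auto intro!: continuous_intros\<close>)
  obtain y0 :: "real^'n" where y0: "y0 \<in> sphere 0 1" "\<forall>y\<in>sphere 0 1. h (x0, y) \<le> h (x0, y0)"
    using continuous_attains_sup[OF compact_sphere _ cont] by auto
  have fibre: "h (x0, y) \<le> h (x0, y0)" if "y \<noteq> 0" for y
    using homogeneous_degD[OF hom x0 that, of "1 / norm y"] y0(2)[rule_format, of "(1 / norm y) *\<^sub>R y"] that by simp
  have max: "h z \<le> h (x0, y0)" if z: "z \<in> TU0" for z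
  proof -
    have "fst z \<in> U" "snd z \<noteq> 0" using z by (simp_all add: TU0_iff)
    from transitive[OF this(1) x0] obtain \<Phi> W
      where iso: "finsler_isometry F c c \<Phi> W" and \<Phi>: "fst z \<in> W" "\<Phi> (fst z) = x0" by blast
    interpret finsler_isometry F c c \<Phi> W by (rule iso)
    have "z \<in> TW0" using \<Phi>(1) \<open>snd z \<noteq> 0\<close> by (simp add: TW0_iff)
    then have "h z = h (T z)" using inv iso unfolding isometry_invariant_def by blast
    also have "\<dots> \<le> h (x0, y0)"
      unfolding tangent_map_def \<Phi>(2) by (rule fibre[OF jac_mult_nonzero[OF \<Phi>(1) \<open>snd z \<noteq> 0\<close>]])
    finally show ?thesis .
  qed
  have z0: "(x0, y0) \<in> TU0" using x0 y0(1) by auto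
  have "(\<lambda>v. pd v h (x0, y0)) = (\<lambda>v. 0)"
    by (rule differential_zero_maxmin[OF z0 open_TU0 pd_has_derivative[OF diff[rule_format, OF z0]]]) (use max in blast)
  then have "spray_deriv h (x0, y0) = 0" unfolding spray_deriv_def by (rule fun_cong)
  moreover have "y0 \<noteq> 0" using y0(1) by auto
  ultimately show ?thesis using max by blast
qed

lemma Scurv_0_if_isotropic:
  assumes iso: "\<And>y. y \<noteq> 0 \<Longrightarrow> Scurv F c (x, y) = k * Floc F c (x, y)" and x: "x \<in> U" and y: "y \<noteq> 0"
  shows "Scurv F c (x, y) = 0"
proof -
  obtain y0 where y0: "y0 \<noteq> 0" "spray_deriv distortion (x, y0) = 0"
    using invariant_max[OF _ homogeneous_distortion isometry_invariant_distortion x] distortion_differentiable by metis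
  have z0: "(x, y0) \<in> TU0" using x y0 by auto
  have "k * Floc F c (x, y0) = 0" using spray_deriv_distortion[OF z0] iso[OF y0(1)] y0(2) by simp
  then show ?thesis using F_pos[OF z0] iso[OF y] by simp
qed

text \<open>At a maximum of \<open>s * u + e * f\<close>, where \<open>u\<close> is the normalised derivative of \<open>f\<close> along the spray and \<open>s\<close> a sign,
  the derivative of \<open>u\<close> along the spray is \<open>- s * e * F * u\<close>, so convexity forces \<open>s * u \<le> 0\<close> there.\<close>

lemma spray_deriv_bound_if_convex:
  assumes f: "smooth f" "homogeneous_deg 0 f" "isometry_invariant f"
    and convex: "\<And>z. z \<in> TU0 \<Longrightarrow> spray_deriv (spray_deriv f) z \<ge> 0"
    and s: "s * s = 1" and e: "e > 0" and M: "\<And>z. z \<in> TU0 \<Longrightarrow> f z \<le> M" and z: "z \<in> TU0"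
  shows "s * (spray_deriv f z * inverse (Floc F c z)) \<le> e * (M - f z)"
proof -
  define u where "u z = spray_deriv f z * inverse (Floc F c z)" for z
  define h where "h z = s * u z + e * f z" for z
  have u: "smooth u" unfolding u_def[abs_def] by (intro smooth_arith smooth_spray_deriv smooth_inverse_F f)
  have h: "smooth h" unfolding h_def[abs_def] by (intro smooth_arith u f)
  have "homogeneous_deg (1 + -1) u"
    unfolding u_def[abs_def] using homogeneous_spray_deriv[OF f(1,2)] homogeneous_F
    by (intro homogeneous_mult) (auto simp: homogeneous_deg_def powr_minus)
  then have hom: "homogeneous_deg 0 h" unfolding h_def[abs_def] by (intro homogeneous_add homogeneous_cmult f) simp
  have "isometry_invariant u" unfolding u_def[abs_def]
    by (rule isometry_invariant_combine[OF isometry_invariant_spray_deriv[OF f(1,3)] isometry_invariant_F, of "\<lambda>a b. a * inverse b"])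
  then have inv: "isometry_invariant h" unfolding h_def[abs_def]
    by (rule isometry_invariant_combine[OF _ f(3), of _ "\<lambda>a b. s * a + e * b"])
  have "fst z \<in> U" using z by (simp add: TU0_iff)
  then obtain y0 where y0: "y0 \<noteq> 0" "\<forall>w\<in>TU0. h w \<le> h (fst z, y0)" "spray_deriv h (fst z, y0) = 0"
    using invariant_max[OF _ hom inv] smooth_imp_differentiable[OF h] by metis
  let ?z = "(fst z, y0)"
  have z0: "?z \<in> TU0" using z y0(1) by (simp add: TU0_iff)
  have "spray_deriv h ?z = s * spray_deriv u ?z + e * spray_deriv f ?z"
    unfolding spray_deriv_def h_def[abs_def]
    by (simp add: pd_add pd_cmult smooth_imp_differentiable[OF u z0] smooth_imp_differentiable[OF f(1) z0])
  moreover have u': "spray_deriv u ?z \<ge> 0"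
    unfolding u_def[abs_def] spray_deriv_divide_F[OF smooth_spray_deriv[OF f(1)] z0]
    using convex[OF z0] F_pos[OF z0] by simp
  moreover have "spray_deriv f ?z = Floc F c ?z * u ?z" unfolding u_def using F_pos[OF z0] by simp
  ultimately have critical: "s * spray_deriv u ?z + e * (Floc F c ?z * u ?z) = 0" using y0(3) by simp
  have "(e * Floc F c ?z) * (s * u ?z) = s * (s * spray_deriv u ?z + e * (Floc F c ?z * u ?z)) - s * s * spray_deriv u ?z"
    by (simp add: algebra_simps)
  then have "(e * Floc F c ?z) * (s * u ?z) \<le> 0" unfolding critical s using u' by simp
  then have "s * u ?z \<le> 0" using e F_pos[OF z0] by (simp add: mult_le_0_iff)
  moreover have "h z \<le> h ?z" using y0(2) z by blast
  moreover have "e * f ?z \<le> e * M" using M[OF z0] e by simp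
  ultimately have "h z \<le> e * M" unfolding h_def by linarith
  then show ?thesis unfolding h_def u_def by (simp add: right_diff_distrib)
qed

theorem spray_deriv_0_if_convex:
  assumes f: "smooth f" "homogeneous_deg 0 f" "isometry_invariant f"
    and convex: "\<And>z. z \<in> TU0 \<Longrightarrow> spray_deriv (spray_deriv f) z \<ge> 0" and z: "z \<in> TU0"
  shows "spray_deriv f z = 0"
proof -
  have "fst z \<in> U" using z by (simp add: TU0_iff)
  then obtain y0 where "\<forall>w\<in>TU0. f w \<le> f (fst z, y0)"
    using invariant_max[OF _ f(2,3)] smooth_imp_differentiable[OF f(1)] by metis
  then have M: "\<And>w. w \<in> TU0 \<Longrightarrow> f w \<le> f (fst z, y0)" by blast
  define K where "K = f (fst z, y0) - f z"
  have K: "K \<ge> 0" unfolding K_def using M[OF z] by simp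
  have "s * (spray_deriv f z * inverse (Floc F c z)) \<le> 0" if s: "s * s = 1" for s
  proof (rule field_le_epsilon)
    fix e :: real assume e: "e > 0"
    have "s * (spray_deriv f z * inverse (Floc F c z)) \<le> e / (K + 1) * K"
      unfolding K_def using K by (intro spray_deriv_bound_if_convex f convex s M z) (auto simp: K_def e)
    also have "\<dots> \<le> e" using K e by (simp add: field_simps)
    finally show "s * (spray_deriv f z * inverse (Floc F c z)) \<le> 0 + e" by simp
  qed
  from this[of 1] this[of "-1"] have "spray_deriv f z * inverse (Floc F c z) = 0" by simp
  then show ?thesis using F_pos[OF z] by simp
qed

end

locale nonpositively_curved_homogeneous_chart = homogeneous_chart F c + zero_S_chart F c
  for F :: "('m, 'n::finite) tbfun" and c :: "('m, 'n) chart" +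
  assumes flag_curv_nonpos: "x \<in> snd c ` fst c \<Longrightarrow> y \<noteq> 0 \<Longrightarrow> u \<notin> span {y} \<Longrightarrow> flag_curv F c x y u \<le> 0"
begin

lemma curvature_mean_cartan_nonpos:
  assumes z: "z \<in> TU0"
  shows "cometric z (mean_cartan z) (transpose (riem_mat z) *v mean_cartan z) \<le> 0"
proof (cases "mean_cartan z = 0")
  case False
  obtain x y where xy: "z = (x, y)" "x \<in> U" "y \<noteq> 0" using z by auto
  then show ?thesis
    using flag_curv_covector[of x y "mean_cartan z"] flag_curv_nonpos snd_mean_cartan[OF z] False
    by (metis mult_nonneg_nonpos less_imp_le snd_conv)
qed (simp add: cometric_def)

lemma
  assumes z: "z \<in> TU0"
  shows mean_landsberg_eq_0: "mean_landsberg z = 0"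
    and curvature_mean_cartan_0: "cometric z (mean_cartan z) (transpose (riem_mat z) *v mean_cartan z) = 0"
proof -
  have convex: "spray_deriv (spray_deriv torsion_norm) z \<ge> 0" if "z \<in> TU0" for z
    unfolding spray_deriv_spray_deriv_torsion_norm[OF that]
    using L_pos[OF that] cometric_nonneg[OF that] curvature_mean_cartan_nonpos[OF that]
    by (smt (verit) mult_nonneg_nonneg)
  have "spray_deriv torsion_norm z = 0" if "z \<in> TU0" for z
    by (rule spray_deriv_0_if_convex[OF smooth_torsion_norm homogeneous_torsion_norm isometry_invariant_torsion_norm convex that])
  then have "spray_deriv (spray_deriv torsion_norm) z = spray_deriv (\<lambda>_. 0) z" by (rule spray_deriv_cong[OF _ z])
  then have "spray_deriv (spray_deriv torsion_norm) z = 0" by (simp add: spray_deriv_def[of "\<lambda>_. 0"])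
  then have "cometric z (mean_landsberg z) (mean_landsberg z)
      = cometric z (mean_cartan z) (transpose (riem_mat z) *v mean_cartan z)"
    unfolding spray_deriv_spray_deriv_torsion_norm[OF z] using L_pos[OF z] by simp
  then show "mean_landsberg z = 0" "cometric z (mean_cartan z) (transpose (riem_mat z) *v mean_cartan z) = 0"
    using cometric_pos[OF z, of "mean_landsberg z"] cometric_nonneg[OF z, of "mean_landsberg z"]
      curvature_mean_cartan_nonpos[OF z] by force+
qed

lemma mean_cartan_0_if_negatively_curved:
  assumes neg: "\<And>u. u \<notin> span {y} \<Longrightarrow> flag_curv F c x y u < 0" and x: "x \<in> U" "y \<noteq> 0"
  shows "mean_cartan (x, y) = 0"
proof (rule ccontr)
  assume I: "mean_cartan (x, y) \<noteq> 0"
  have z: "(x, y) \<in> TU0" using x by auto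
  obtain u k where "u \<notin> span {y}" "k > 0" "k * flag_curv F c x y u = 0"
    using flag_curv_covector[OF x I] snd_mean_cartan[OF z] curvature_mean_cartan_0[OF z] by (metis snd_conv)
  then show False using neg[of u] by simp
qed

end

section \<open>Weakly Landsberg surfaces\<close>

lemma orthogonal_complement_of_line_in_plane:
  fixes t w y :: "real^'n"
  assumes n: "CARD('n) = 2" and y: "y \<noteq> 0" and t: "t \<noteq> 0" "t \<bullet> y = 0" and w: "w \<bullet> y = 0"
  obtains s where "w = s *\<^sub>R t"
proof -
  define v where "v = w - ((w \<bullet> t) / (t \<bullet> t)) *\<^sub>R t"
  have vt: "v \<bullet> t = 0" "v \<bullet> y = 0" unfolding v_def using t w by (simp_all add: inner_diff_left)
  have "v = 0"
  proof (rule ccontr)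
    assume v: "v \<noteq> 0"
    have distinct: "v \<noteq> t" "v \<noteq> y" "t \<noteq> y" using vt t y v by auto
    have "pairwise orthogonal {v, t, y}"
      using vt t by (auto simp: pairwise_def orthogonal_def inner_commute)
    then have "independent {v, t, y}" by (rule pairwise_orthogonal_independent) (use v t y in auto)
    then have "card {v, t, y} \<le> DIM(real^'n)" by (rule independent_bound[THEN conjunct2])
    then show False using n distinct by simp
  qed
  then show ?thesis using that unfolding v_def by simp
qed

lemma zero_if_orthogonal_in_plane:
  fixes b l t y :: "real^'n"
  assumes n: "CARD('n) = 2" and y: "y \<noteq> 0" and t: "t \<noteq> 0" "t \<bullet> y = 0"
    and b: "b \<bullet> t = 0" "b \<bullet> l = 0" and l: "l \<bullet> y \<noteq> 0"
  shows "b = 0"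
proof -
  obtain s where "b = s *\<^sub>R y"
    using orthogonal_complement_of_line_in_plane[OF n t(1) y, of b] t(2) b(1) by (metis inner_commute)
  then show ?thesis using b(2) l by (simp add: inner_commute)
qed

lemma symmetric_trilinear_form_in_plane:
  fixes B :: "'n::finite \<Rightarrow> 'n \<Rightarrow> 'n \<Rightarrow> real" and t y :: "real^'n"
  assumes n: "CARD('n) = 2" and y: "y \<noteq> 0" and t: "t \<noteq> 0" "t \<bullet> y = 0"
    and sym: "\<And>l i j. B l i j = B i l j" "\<And>l i j. B l i j = B l j i"
    and annihilated: "\<And>l i. (\<Sum>j\<in>UNIV. B l i j * y $ j) = 0"
  obtains b where "\<And>l i j. B l i j = b * t $ l * t $ i * t $ j"
proof -
  obtain a where a: "t $ a \<noteq> 0" using t(1) by (auto simp: vec_eq_iff)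
  have last: "B l i j = B l i a * t $ j / t $ a" for l i j
  proof -
    have "(\<chi> j. B l i j) \<bullet> y = 0" using annihilated by (simp add: inner_vec_def)
    then obtain s where s: "(\<chi> j. B l i j) = s *\<^sub>R t"
      using orthogonal_complement_of_line_in_plane[OF n y t] by blast
    have "B l i j = s * t $ j" for j using arg_cong[OF s, of "\<lambda>v. v $ j"] by simp
    then show ?thesis using a by simp
  qed
  have "B l i j = B a a a / (t $ a) ^ 3 * t $ l * t $ i * t $ j" for l i j
  proof -
    have "B l i j = B l a i * t $ j / t $ a" using last[of l i j] sym(2)[of l i a] by simp
    also have "\<dots> = B a a l * t $ i / t $ a * t $ j / t $ a"
      using last[of l a i] sym(1)[of l a a] sym(2)[of a l a] by simp
    also have "\<dots> = B a a a * t $ l / t $ a * t $ i / t $ a * t $ j / t $ a" using last[of a a l] by simp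
    finally show ?thesis by (simp add: power3_eq_cube)
  qed
  then show ?thesis by (rule that)
qed

locale weakly_landsberg_chart = zero_S_chart F c
  for F :: "('m, 'n::finite) tbfun" and c :: "('m, 'n) chart" +
  assumes mean_landsberg_0: "z \<in> snd c ` fst c \<times> (UNIV - {0}) \<Longrightarrow> mean_landsberg z = 0"

sublocale nonpositively_curved_homogeneous_chart \<subseteq> weakly_landsberg_chart
  by unfold_locales (rule mean_landsberg_eq_0)

context finsler_chart
begin

definition landsberg_mat :: "'n \<Rightarrow> (real^'n) \<times> (real^'n) \<Rightarrow> real^'n^'n" where
  "landsberg_mat l z = (\<chi> j i. \<Sum>k\<in>UNIV. DY j (berwald_coeff l i k) z * DY k L z)"

lemma DY_berwald_coeff_sym:
  assumes z: "z \<in> TU0"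
  shows "DY j (berwald_coeff l i k) z = DY j (berwald_coeff i l k) z"
    and "DY j (berwald_coeff l i k) z = DY i (berwald_coeff l j k) z"
proof -
  show "DY j (berwald_coeff l i k) z = DY j (berwald_coeff i l k) z" by (rule DY_cong[OF berwald_coeff_sym z])
  show "DY j (berwald_coeff l i k) z = DY i (berwald_coeff l j k) z"
    unfolding berwald_coeff_def by (rule DY_DY_commute[OF smooth_N z])
qed

lemma mpd_hor_gmat:
  fixes l :: 'n
  assumes z: "z \<in> TU0"
  defines "B \<equiv> \<chi> i k. berwald_coeff l i k z"
  shows "mpd (hor_lift (axis l 1) z) gmat z = (1/2) *\<^sub>R landsberg_mat l z + (B ** gmat z + transpose (B ** gmat z))"
proof -
  let ?e = "axis l (1::real)"
  note diff = smooth_imp_differentiable[OF _ z]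
  have "hor_deriv ?e (DY j (DY i L)) z = landsberg_mat l z $ j $ i + 2 * (B ** gmat z) $ i $ j + 2 * (B ** gmat z) $ j $ i" for i j
  proof -
    have L_const: "hor_deriv ?e (DY i L) w = (\<Sum>k\<in>UNIV. berwald_coeff l i k w * DY k L w)" if "w \<in> TU0" for w
      by (rule hor_deriv_DY_if_hor_const[OF smooth_L hor_deriv_L that])
    have "DY j (hor_deriv ?e (DY i L)) z = DY j (\<lambda>z. \<Sum>k\<in>UNIV. berwald_coeff l i k z * DY k L z) z"
      by (rule DY_cong[OF L_const z])
    also have "\<dots> = landsberg_mat l z $ j $ i + (\<Sum>k\<in>UNIV. berwald_coeff l i k z * DY j (DY k L) z)"
      unfolding landsberg_mat_def DY_def[of j]
      by (simp add: pd_sum pd_mult diff smooth_berwald_coeff smooth_DY smooth_L sum.distrib DY_def[of j])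
    finally have "hor_deriv ?e (DY j (DY i L)) z = landsberg_mat l z $ j $ i
        + (\<Sum>k\<in>UNIV. berwald_coeff l i k z * DY j (DY k L) z) + (\<Sum>k\<in>UNIV. berwald_coeff l j k z * DY k (DY i L) z)"
      using DY_hor_deriv[OF smooth_DY[OF smooth_L] z, of j l i] by simp
    then show ?thesis
      using DY_DY_commute[OF smooth_L z, of j]
      by (simp add: B_def matrix_matrix_mult_def gten_def sum_distrib_left mult_ac)
  qed
  moreover have "pd v (g j i) z = 1/2 * pd v (DY j (DY i L)) z" for v j i
    unfolding gten_def[abs_def] by (rule pd_cmult) (intro diff smooth_DY smooth_L)
  ultimately have "pd (hor_lift ?e z) (g j i) z = landsberg_mat l z $ j $ i / 2 + ((B ** gmat z) $ j $ i + (B ** gmat z) $ i $ j)" for i j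
    unfolding hor_deriv_def by (simp only:) simp
  then show ?thesis by (simp add: vec_eq_iff transpose_def)
qed

end

context zero_S_chart
begin

lemma trace_berwald_coeff:
  assumes z: "z \<in> TU0"
  shows "(\<Sum>k\<in>UNIV. berwald_coeff l k k z) = - pd (axis l 1) (\<lambda>x. ln (vol x)) (fst z)"
proof -
  obtain x y where xy: "z = (x, y)" "x \<in> U" "y \<noteq> 0" using z by auto
  have smooth: "smooth (\<lambda>z. \<Sum>k\<in>UNIV. N k k z)" by (intro smooth_arith smooth_N)
  have "((\<lambda>y. - pd y (\<lambda>x. ln (vol x)) x) has_derivative (\<lambda>v. - pd v (\<lambda>x. ln (vol x)) x)) (at y)"
    by (intro has_derivative_minus linear_imp_has_derivative linear_pd ln_vol_differentiable xy)
  then have "((\<lambda>y. \<Sum>k\<in>UNIV. N k k (x, y)) has_derivative (\<lambda>v. - pd v (\<lambda>x. ln (vol x)) x)) (at y)"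
    by (rule has_derivative_transform_within_open[of _ _ _ _ "UNIV - {0}"])
       (use xy pd_ln_vol in \<open>auto simp: trace_def Nmat_def\<close>)
  from fun_cong[OF has_derivative_unique[OF fibre_has_derivative[OF smooth xy(2,3)] this], of "axis l 1"]
  have "DY l (\<lambda>z. \<Sum>k\<in>UNIV. N k k z) z = - pd (axis l 1) (\<lambda>x. ln (vol x)) x"
    by (simp add: xy(1) inner_axis')
  moreover have "DY l (\<lambda>z. \<Sum>k\<in>UNIV. N k k z) z = (\<Sum>k\<in>UNIV. DY l (N k k) z)"
    unfolding DY_def[of l] by (rule pd_sum) (rule smooth_imp_differentiable[OF smooth_N z])
  moreover have "DY l (N k k) z = berwald_coeff l k k z" for k
    using berwald_coeff_sym[OF z, of l k k] by (simp add: berwald_coeff_def)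
  ultimately show ?thesis by (simp add: xy(1))
qed

lemma trace_DY_berwald_coeff:
  assumes z: "z \<in> TU0"
  shows "(\<Sum>k\<in>UNIV. DY j (berwald_coeff l k k) z) = 0"
proof -
  obtain x y where xy: "z = (x, y)" "x \<in> U" "y \<noteq> 0" using z by auto
  have "grad_y (\<lambda>z. \<Sum>k\<in>UNIV. berwald_coeff l k k z) (x, y) = 0"
    by (rule grad_y_fibre_const[OF _ xy(2) _ xy(3)])
       (use xy(2) in \<open>auto intro!: smooth_arith smooth_berwald_coeff simp: trace_berwald_coeff\<close>)
  from arg_cong[OF this, of "\<lambda>v. v $ j"] have "DY j (\<lambda>z. \<Sum>k\<in>UNIV. berwald_coeff l k k z) z = 0" by (simp add: xy(1))
  moreover have "DY j (\<lambda>z. \<Sum>k\<in>UNIV. berwald_coeff l k k z) z = (\<Sum>k\<in>UNIV. DY j (berwald_coeff l k k) z)"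
    unfolding DY_def[of j] by (rule pd_sum) (rule smooth_imp_differentiable[OF smooth_berwald_coeff z])
  ultimately show ?thesis by simp
qed

end

context weakly_landsberg_chart
begin

lemma hor_deriv_distortion_0: "z \<in> TU0 \<Longrightarrow> hor_deriv v distortion z = 0"
  by (simp add: hor_deriv_distortion mean_landsberg_0)

lemma trace_landsberg_mat:
  assumes z: "z \<in> TU0"
  shows "trace (ginv F c z ** landsberg_mat l z) = 0"
proof -
  let ?B = "\<chi> i k. berwald_coeff l i k z"
  have "hor_deriv (axis l 1) ln_sqrt_det z = 1/2 * trace (ginv F c z ** ((1/2) *\<^sub>R landsberg_mat l z)) + trace ?B"
    unfolding hor_deriv_def pd_ln_sqrt_det[OF z] mpd_hor_gmat[OF z]
    using trace_ginv_congruence[OF z, of ?B] by (simp add: matrix_add_ldistrib trace_add)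
  moreover have "trace (ginv F c z ** ((1/2) *\<^sub>R landsberg_mat l z)) = 1/2 * trace (ginv F c z ** landsberg_mat l z)"
    by (simp add: trace_def matrix_matrix_mult_def sum_divide_distrib)
  moreover have "hor_deriv (axis l 1) ln_sqrt_det z = - pd (axis l 1) (\<lambda>x. ln (vol x)) (fst z)"
    using hor_deriv_distortion_0[OF z, of "axis l 1"] by (simp add: hor_deriv_def hor_lift_def pd_distortion[OF z])
  moreover have "trace ?B = - pd (axis l 1) (\<lambda>x. ln (vol x)) (fst z)"
    using trace_berwald_coeff[OF z] by (simp add: trace_def)
  ultimately show ?thesis by simp
qed

text \<open>On a surface the Berwald tensor is \<open>b \<otimes> t \<otimes> t \<otimes> t\<close>, where \<open>t\<close> spans the annihilator of the flagpole;
  its two traces show that the vector \<open>b\<close> vanishes.\<close>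

lemma DY_berwald_coeff_0_if_surface:
  assumes n: "CARD('n) = 2" and z: "z \<in> TU0"
  shows "DY j (berwald_coeff l i k) z = 0"
proof -
  have y: "snd z \<noteq> 0" using z by (simp add: TU0_iff)
  obtain t where t: "t \<noteq> 0" "t \<bullet> snd z = 0"
    using orthogonal_to_vector_exists[of "snd z"] n by (auto simp: orthogonal_def inner_commute)
  have "\<exists>b. \<forall>l i j. DY j (berwald_coeff l i k) z = b * t $ l * t $ i * t $ j" for k
  proof (rule symmetric_trilinear_form_in_plane[OF n y t, of "\<lambda>l i j. DY j (berwald_coeff l i k) z"])
    show "(\<Sum>j\<in>UNIV. DY j (berwald_coeff l i k) z * snd z $ j) = 0" for l i
      using euler_homogeneous[OF smooth_berwald_coeff homogeneous_berwald_coeff z, of l i k]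
      by (simp add: inner_vec_def mult.commute)
  qed (use DY_berwald_coeff_sym[OF z] in blast)+
  then obtain b where B: "\<And>k l i j. DY j (berwald_coeff l i k) z = b k * t $ l * t $ i * t $ j" by metis
  define b' where "b' = (\<chi> k. b k)"
  obtain a where a: "t $ a \<noteq> 0" using t(1) by (auto simp: vec_eq_iff)
  have "b' = 0"
  proof (rule zero_if_orthogonal_in_plane[OF n y t, where l="grad_y L z"])
    have "(b' \<bullet> t) * (t $ a * t $ a) = 0"
      using trace_DY_berwald_coeff[OF z, of a a] unfolding B
      by (simp add: b'_def inner_vec_def sum_distrib_left sum_distrib_right mult_ac)
    then show "b' \<bullet> t = 0" using a by simp
    have "trace (ginv F c z ** landsberg_mat a z) = (b' \<bullet> grad_y L z) * (t $ a * cometric z t t)"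
      unfolding landsberg_mat_def B
      by (simp add: b'_def trace_def matrix_matrix_mult_def cometric_def inner_vec_def matrix_vector_mult_def
          sum_distrib_left sum_distrib_right mult_ac)
    then show "b' \<bullet> grad_y L z = 0"
      using trace_landsberg_mat[OF z] a cometric_pos[OF z t(1)] by simp
    show "grad_y L z \<bullet> snd z \<noteq> 0" using grad_y_L_snd[OF z] L_pos[OF z] by (simp add: inner_commute)
  qed
  then show ?thesis unfolding B b'_def by (simp add: vec_eq_iff)
qed

end

section \<open>Flat coordinates\<close>

context finsler_chart
begin

definition parallel_on :: "(real^'n) set \<Rightarrow> (real^'n \<Rightarrow> real^'n) \<Rightarrow> bool" where
  "parallel_on X e \<longleftrightarrow> (\<forall>x\<in>X. (e has_derivative (\<lambda>v. - (v v* Nmat (x, e x)))) (at x))"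

definition horizontally_constant :: "((real^'n) \<times> (real^'n) \<Rightarrow> real) \<Rightarrow> bool" where
  "horizontally_constant h \<longleftrightarrow> smooth h \<and> (\<forall>z\<in>TU0. \<forall>v. hor_deriv v h z = 0)"

definition fibre_jac :: "('n \<Rightarrow> (real^'n) \<times> (real^'n) \<Rightarrow> real) \<Rightarrow> (real^'n) \<times> (real^'n) \<Rightarrow> real^'n^'n" where
  "fibre_jac q z = (\<chi> a. grad_y (q a) z)"

lemma parallel_has_derivative:
  assumes "parallel_on X e" "x \<in> X" "h differentiable (at (x, e x))"
  shows "((\<lambda>x. h (x, e x)) has_derivative (\<lambda>v. hor_deriv v h (x, e x))) (at x)"
proof -
  have "((\<lambda>x. (x, e x)) has_derivative (\<lambda>v. hor_lift v (x, e x))) (at x)"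
    using assms(1,2) unfolding parallel_on_def hor_lift_def
    by (intro has_derivative_Pair has_derivative_ident) blast
  from has_derivative_compose[OF this pd_has_derivative[OF assms(3)]] show ?thesis by (simp add: hor_deriv_def)
qed

lemma smooth_along_parallel:
  assumes X: "open X" "X \<subseteq> U" and e: "parallel_on X e" "\<forall>x\<in>X. e x \<noteq> 0" and h: "smooth h"
  shows "smooth_on X (\<lambda>x. h (x, e x))"
proof (rule smooth_on_compose_if_derivative_of_value[OF X(1) open_TU0 _ _ _ h])
  show "(x, e x) \<in> TU0" if "x \<in> X" for x using X(2) e(2) that by auto
  show "((\<lambda>x. (x, e x)) has_derivative (\<lambda>v. hor_lift v (x, e x))) (at x)" if "x \<in> X" for x
    using e(1) that unfolding parallel_on_def hor_lift_def
    by (intro has_derivative_Pair has_derivative_ident) blast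
  show "smooth (\<lambda>z. hor_lift b z \<bullet> k)" for b k
    unfolding hor_lift_def Nmat_def inner_prod_def inner_vec_def vector_matrix_mult_def
    using smooth_on_cmult[OF open_TU0 smooth_on_sum[OF open_TU0 smooth_on_cmult[OF open_TU0 smooth_N]]]
    by (simp add: sum_negf) (intro smooth_arith smooth_N)
qed

lemma vpd_fibre_direction:
  assumes "\<And>a. q a differentiable (at z)"
  shows "vpd (0, m) (\<lambda>z. \<chi> a. q a z) z = fibre_jac q z *v m"
  by (simp add: vec_eq_iff pd_pair[OF assms] fibre_jac_def matrix_vector_mul_component inner_commute)

lemma parallel_if_level:
  assumes q: "\<forall>a. horizontally_constant (q a)" and X: "open X" "x \<in> X" and z: "(x, e x) \<in> TU0"
    and e: "e differentiable (at x)" and level: "\<And>x a. x \<in> X \<Longrightarrow> q a (x, e x) = k a"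
    and inj: "\<And>m. vpd (0, m) (\<lambda>z. \<chi> a. q a z) (x, e x) = 0 \<Longrightarrow> m = 0"
  shows "(e has_derivative (\<lambda>v. - (v v* Nmat (x, e x)))) (at x)"
proof -
  let ?z = "(x, e x)"
  obtain e' where e': "(e has_derivative e') (at x)" using e unfolding differentiable_def by blast
  have "e' v = - (v v* Nmat ?z)" for v
  proof -
    have "pd (0, e' v + v v* Nmat ?z) (q a) ?z = 0" for a
    proof -
      have diff: "q a differentiable (at ?z)" and hor: "pd (hor_lift v ?z) (q a) ?z = 0"
        using q z smooth_imp_differentiable unfolding horizontally_constant_def hor_deriv_def by blast+
      have "((\<lambda>x. (x, e x)) has_derivative (\<lambda>v. (v, e' v))) (at x)"
        by (intro has_derivative_Pair has_derivative_ident e')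
      from pd_chain[OF this diff] have "pd (v, e' v) (q a) ?z = pd v (\<lambda>x. q a (x, e x)) x" ..
      also have "\<dots> = pd v (\<lambda>_. k a) x" by (rule pd_cong_open[OF X level])
      finally have "pd (v, e' v) (q a) ?z - pd (hor_lift v ?z) (q a) ?z = 0" using hor by simp
      then show ?thesis using linear_diff[OF linear_pd[OF diff], of "(v, e' v)" "hor_lift v ?z"] by (simp add: hor_lift_def)
    qed
    then have "vpd (0, e' v + v v* Nmat ?z) (\<lambda>z. \<chi> a. q a z) ?z = 0" by (simp add: vec_eq_iff)
    from inj[OF this] show ?thesis by (simp add: eq_neg_iff_add_eq_0)
  qed
  then show ?thesis using e' by presburger
qed

text \<open>Horizontally constant functions that are coordinates on the fibres have parallel joint level sets.\<close>

lemma parallel_field: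
  assumes q: "\<forall>a. horizontally_constant (q a)" and z0: "(x0, y0) \<in> TU0" and inv: "invertible (fibre_jac q (x0, y0))"
  obtains X e where "open X" "x0 \<in> X" "X \<subseteq> U" "parallel_on X e" "\<forall>x\<in>X. e x \<noteq> 0" "\<forall>x\<in>X. invertible (fibre_jac q (x, e x))"
proof -
  let ?Q = "\<lambda>z. \<chi> a. q a z"
  have smooth: "smooth (q a)" for a using q unfolding horizontally_constant_def by blast
  note fibre = vpd_fibre_direction[OF smooth_imp_differentiable[OF smooth]]
  have "m = 0" if "vpd (0, m) ?Q (x0, y0) = 0" for m
    using that matrix_inv_vector_mult(1)[OF inv, of m] unfolding fibre[OF z0] by simp
  moreover have "smooth (\<lambda>z. ?Q z $ a)" for a using smooth by simp
  ultimately obtain X e where X: "open X" "x0 \<in> X" and eX: "\<And>x. x \<in> X \<Longrightarrow> (x, e x) \<in> TU0"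
    and level: "\<And>x. x \<in> X \<Longrightarrow> ?Q (x, e x) = ?Q (x0, y0)" and e: "\<And>x. x \<in> X \<Longrightarrow> e differentiable (at x)"
    and inj: "\<And>x m. x \<in> X \<Longrightarrow> vpd (0, m) ?Q (x, e x) = 0 \<Longrightarrow> m = 0"
    using implicit_function[OF open_TU0 z0, of ?Q] by blast
  have level_nth: "q a (x, e x) = q a (x0, y0)" if "x \<in> X" for x a using level[OF that] by (simp add: vec_eq_iff)
  have "parallel_on X e" unfolding parallel_on_def
  proof
    fix x assume x: "x \<in> X"
    show "(e has_derivative (\<lambda>v. - (v v* Nmat (x, e x)))) (at x)"
      by (rule parallel_if_level[OF q X(1) x eX[OF x] e[OF x] level_nth inj[OF x]])
  qed
  moreover have "invertible (fibre_jac q (x, e x))" if "x \<in> X" for x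
    using inj[OF that] unfolding fibre[OF eX[OF that]] by (rule invertible_if_kernel_trivial)
  moreover have "X \<subseteq> U" "\<forall>x\<in>X. e x \<noteq> 0" using eX by auto
  ultimately show ?thesis using that X by blast
qed

definition berwald_mat :: "real^'n \<Rightarrow> (real^'n) \<times> (real^'n) \<Rightarrow> real^'n^'n" where
  "berwald_mat v z = (\<chi> i k. \<Sum>l\<in>UNIV. v $ l * berwald_coeff l i k z)"

lemma hor_deriv_grad_y:
  assumes h: "horizontally_constant h" and z: "z \<in> TU0"
  shows "hor_deriv v (DY i h) z = (berwald_mat v z *v grad_y h z) $ i"
proof -
  have smooth: "smooth h" and hor: "hor_deriv v h z = 0" if "z \<in> TU0" for v z
    using h that unfolding horizontally_constant_def by blast+
  have "hor_deriv v (DY i h) z = (\<Sum>l\<in>UNIV. v $ l * hor_deriv (axis l 1) (DY i h) z)"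
    using hor_deriv_eq[OF smooth_imp_differentiable[OF smooth_DY[OF smooth] z]] z by (simp add: inner_axis' inner_vec_def[of v])
  also have "\<dots> = (\<Sum>l\<in>UNIV. v $ l * (\<Sum>k\<in>UNIV. berwald_coeff l i k z * DY k h z))"
    using hor_deriv_DY_if_hor_const[OF smooth hor z] z by simp
  also have "\<dots> = (berwald_mat v z *v grad_y h z) $ i"
    unfolding berwald_mat_def matrix_vector_mult_def
    by (simp add: sum_distrib_left sum_distrib_right mult_ac) (rule sum.swap)
  finally show ?thesis .
qed

lemma mpd_fibre_jac_along_parallel:
  assumes q: "\<forall>a. horizontally_constant (q a)" and e: "parallel_on X e" and x: "x \<in> X" "(x, e x) \<in> TU0"
  shows "mpd v (\<lambda>x. fibre_jac q (x, e x)) x = fibre_jac q (x, e x) ** transpose (berwald_mat v (x, e x))"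
proof -
  have "smooth (q a)" for a using q unfolding horizontally_constant_def by blast
  from pd_eqI[OF parallel_has_derivative[OF e x(1) smooth_imp_differentiable[OF smooth_DY[OF this] x(2)]]]
  have "pd v (\<lambda>x. DY i (q a) (x, e x)) x = (berwald_mat v (x, e x) *v grad_y (q a) (x, e x)) $ i" for a i
    by (simp add: hor_deriv_grad_y[OF spec[OF q] x(2)])
  then show ?thesis
    by (simp add: vec_eq_iff fibre_jac_def matrix_matrix_mult_def transpose_def matrix_vector_mult_def mult.commute)
qed

end

locale berwald_chart = finsler_chart F c
  for F :: "('m, 'n::finite) tbfun" and c :: "('m, 'n) chart" +
  assumes berwald_coeff_fibre:
    "x \<in> snd c ` fst c \<Longrightarrow> y \<noteq> 0 \<Longrightarrow> y' \<noteq> 0 \<Longrightarrow> berwald_coeff l i k (x, y) = berwald_coeff l i k (x, y')"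
begin

lemma Nmat_berwald:
  assumes x: "x \<in> U" "y \<noteq> 0" "y' \<noteq> 0"
  shows "v v* Nmat (x, y) = transpose (berwald_mat v (x, y')) *v y"
proof -
  have "N l k (x, y) = (\<Sum>i\<in>UNIV. y $ i * berwald_coeff l i k (x, y))" for l k
    using euler_homogeneous[OF smooth_N homogeneous_N, of "(x, y)" l k] x by (simp add: inner_vec_def berwald_coeff_def)
  then have "N l k (x, y) = (\<Sum>i\<in>UNIV. y $ i * berwald_coeff l i k (x, y'))" for l k
    by (simp add: berwald_coeff_fibre[OF x])
  then have "(v v* Nmat (x, y)) $ k = (transpose (berwald_mat v (x, y')) *v y) $ k" for k
    unfolding berwald_mat_def Nmat_def matrix_vector_mult_def vector_matrix_mult_def transpose_def
    by (simp add: sum_distrib_left sum_distrib_right mult_ac) (rule sum.swap)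
  then show ?thesis by (simp add: vec_eq_iff)
qed

lemma parallel_dual_frame:
  assumes q: "\<forall>a. horizontally_constant (q a)" and X: "open X" "X \<subseteq> U"
    and e: "parallel_on X e" "\<forall>x\<in>X. e x \<noteq> 0" and inv: "\<forall>x\<in>X. invertible (fibre_jac q (x, e x))" and s: "s \<noteq> 0"
  defines "\<xi> \<equiv> \<lambda>x. matrix_inv (fibre_jac q (x, e x)) *v s"
  shows "parallel_on X \<xi>" and "\<forall>x\<in>X. \<xi> x \<noteq> 0"
proof -
  define E where "E x = fibre_jac q (x, e x)" for x
  have \<xi>_eq: "\<xi> = (\<lambda>x. matrix_inv (E x) *v s)" unfolding \<xi>_def E_def ..
  have smooth_E: "smooth_on X (\<lambda>x. E x $ a $ i)" for a i
    using smooth_along_parallel[OF X e smooth_DY[of "q a"]] q unfolding E_def fibre_jac_def horizontally_constant_def by simp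
  have inv_E: "x \<in> X \<Longrightarrow> invertible (E x)" for x unfolding E_def using inv by blast
  show \<xi>: "\<forall>x\<in>X. \<xi> x \<noteq> 0"
    using matrix_inv_vector_mult(2)[OF inv_E, of _ s] s unfolding \<xi>_eq by force
  show "parallel_on X \<xi>"
    unfolding parallel_on_def
  proof
    fix x assume x: "x \<in> X"
    note diff = smooth_on_imp_differentiable[OF smooth_on_matrix_inv[OF X(1) smooth_E inv_E] X(1) x]
    have "(\<lambda>x. \<xi> x $ i) differentiable (at x)" for i
      unfolding \<xi>_eq matrix_vector_mult_def using diff by (simp add: differentiable_sum)
    from has_derivative_vpd[OF this] have "(\<xi> has_derivative (\<lambda>v. vpd v \<xi> x)) (at x)" .
    moreover have "vpd v \<xi> x = - (v v* Nmat (x, \<xi> x))" for v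
    proof -
      let ?B = "transpose (berwald_mat v (x, e x))"
      have minus: "(- M) *v s = - (M *v s)" for M :: "real^'n^'n"
        by (simp add: matrix_vector_mult_def vec_eq_iff sum_negf)
      have "vpd v \<xi> x = mpd v (\<lambda>x. matrix_inv (E x)) x *v s"
        unfolding \<xi>_eq using vpd_matrix_vector_mult[OF diff, of "\<lambda>_. s" v] by (simp add: vpd_def flip: zero_vec_def)
      also have "mpd v (\<lambda>x. matrix_inv (E x)) x = - (matrix_inv (E x) ** (E x ** ?B) ** matrix_inv (E x))"
        using mpd_matrix_inv[OF X(1) smooth_E inv_E x] mpd_fibre_jac_along_parallel[OF q e(1) x, of v] X(2) e(2) x
        unfolding E_def[abs_def] by auto
      also have "\<dots> = - (?B ** matrix_inv (E x))"
        by (simp add: matrix_mul_assoc matrix_inv_left[OF inv_E[OF x]])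
      finally have "vpd v \<xi> x = - (?B *v \<xi> x)" unfolding minus by (simp only: \<xi>_eq matrix_vector_mul_assoc)
      then show ?thesis
        using Nmat_berwald[of x "\<xi> x" "e x" v] \<xi> e(2) X(2) x by (simp add: subset_iff)
    qed
    ultimately show "(\<xi> has_derivative (\<lambda>v. - (v v* Nmat (x, \<xi> x)))) (at x)" by simp
  qed
qed

lemma F_dual_frame_constant:
  assumes q: "\<forall>a. horizontally_constant (q a)" and X: "open X" "X \<subseteq> U"
    and e: "parallel_on X e" "\<forall>x\<in>X. e x \<noteq> 0" and inv: "\<forall>x\<in>X. invertible (fibre_jac q (x, e x))"
    and S: "convex S" "S \<subseteq> X" and x: "x \<in> S" "x' \<in> S"
  shows "Floc F c (x, matrix_inv (fibre_jac q (x, e x)) *v s) = Floc F c (x', matrix_inv (fibre_jac q (x', e x')) *v s)"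
proof (cases "s = 0")
  case True
  then show ?thesis using F_zero x S X by (simp add: subset_iff)
next
  case False
  define \<xi> where "\<xi> x = matrix_inv (fibre_jac q (x, e x)) *v s" for x
  note \<xi> = parallel_dual_frame[OF q X e inv False, folded \<xi>_def]
  have "((\<lambda>x. L (x, \<xi> x)) has_derivative (\<lambda>v. 0)) (at x within S)" if "x \<in> S" for x
  proof -
    have "x \<in> X" "(x, \<xi> x) \<in> TU0" using that S X(2) \<xi>(2) by auto
    from parallel_has_derivative[OF \<xi>(1) this(1) smooth_imp_differentiable[OF smooth_L this(2)]]
    show ?thesis by (simp add: hor_deriv_L[OF \<open>(x, \<xi> x) \<in> TU0\<close>] has_derivative_at_withinI)
  qed
  then obtain k where "\<forall>x\<in>S. L (x, \<xi> x) = k" using has_derivative_zero_constant[OF S(1)] by blast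
  then have "L (x, \<xi> x) = L (x', \<xi> x')" using x by simp
  then show ?thesis
    using F_nonneg x S X unfolding Lsq_def \<xi>_def by (simp add: power2_eq_iff_nonneg subset_iff)
qed

lemma fibre_jac_along_parallel_has_potential:
  assumes q: "\<forall>a. horizontally_constant (q a)" and X: "open X" "X \<subseteq> U" and ball: "ball x0 r \<subseteq> X"
    and e: "parallel_on X e" "\<forall>x\<in>X. e x \<noteq> 0"
  shows "\<exists>f. \<forall>x \<in> ball x0 r. (f has_derivative (\<lambda>v. fibre_jac q (x, e x) *v v)) (at x)"
proof -
  have smooth: "smooth (q a)" for a using q unfolding horizontally_constant_def by blast
  have z: "(x, e x) \<in> TU0" if "x \<in> X" for x using that X(2) e(2) by auto
  have "\<exists>f. \<forall>x \<in> ball x0 r. (f has_derivative (\<lambda>v. v \<bullet> grad_y (q a) (x, e x))) (at x)" for a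
  proof (rule poincare_lemma)
    have "smooth_on (ball x0 r) (\<lambda>x. DY k (q a) (x, e x))" for k
      by (rule smooth_on_subset[OF smooth_along_parallel[OF X e smooth_DY[OF smooth]] ball])
    then show "smooth_map_on (ball x0 r) (\<lambda>x. grad_y (q a) (x, e x))" by (simp add: smooth_map_on_vec_iff)
  next
    fix x b c :: "real^'n" assume x: "x \<in> ball x0 r" and "b \<in> Basis" "c \<in> Basis"
    then obtain i j where bc: "b = axis i 1" "c = axis j 1" by (auto simp: Basis_vec_def)
    have "x \<in> X" using x ball by blast
    note jac = mpd_fibre_jac_along_parallel[OF q e(1) this z[OF this]]
    have "pd (axis i 1) (\<lambda>x. DY j (q a) (x, e x)) x = (\<Sum>k\<in>UNIV. DY k (q a) (x, e x) * berwald_coeff i j k (x, e x))" for i j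
      using arg_cong[OF jac[of "axis i 1"], of "\<lambda>M. M $ a $ j"]
      by (simp add: fibre_jac_def matrix_matrix_mult_def transpose_def berwald_mat_def axis_def if_distrib[of "\<lambda>t. t * _"] cong: if_cong)
    then show "pd b (\<lambda>x. grad_y (q a) (x, e x) \<bullet> c) x = pd c (\<lambda>x. grad_y (q a) (x, e x) \<bullet> b) x"
      unfolding bc by (simp add: inner_axis berwald_coeff_sym[OF z[OF \<open>x \<in> X\<close>], of i j])
  qed blast
  then obtain f where f: "\<And>a. \<forall>x \<in> ball x0 r. (f a has_derivative (\<lambda>v. v \<bullet> grad_y (q a) (x, e x))) (at x)" by metis
  have "((\<lambda>x. \<chi> a. f a x) has_derivative (\<lambda>v. fibre_jac q (x, e x) *v v)) (at x)" if "x \<in> ball x0 r" for x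
    using f that by (intro has_derivative_vecI) (simp add: fibre_jac_def matrix_vector_mul_component inner_commute)
  then show ?thesis by blast
qed

theorem flat_coordinates:
  assumes q: "\<forall>a. horizontally_constant (q a)" and z0: "(x0, y0) \<in> TU0" and inv: "invertible (fibre_jac q (x0, y0))"
  obtains W V and f g :: "real^'n \<Rightarrow> real^'n" and F0 where "open W" "x0 \<in> W" "W \<subseteq> U" "open V" "homeomorphism W V f g"
    "smooth_map_on W f" "smooth_map_on V g"
    "\<forall>x\<in>W. \<forall>v. Floc F c (x, v) = F0 (frechet_derivative f (at x) v)"
proof -
  obtain X e where X: "open X" "x0 \<in> X" "X \<subseteq> U" and e: "parallel_on X e" "\<forall>x\<in>X. e x \<noteq> 0"
    and invX: "\<forall>x\<in>X. invertible (fibre_jac q (x, e x))"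
    using parallel_field[OF q z0 inv] by blast
  obtain r where r: "r > 0" "ball x0 r \<subseteq> X" using X(1,2) openE by blast
  define E where "E x = fibre_jac q (x, e x)" for x
  obtain f where f: "\<forall>x \<in> ball x0 r. (f has_derivative (\<lambda>v. E x *v v)) (at x)"
    using fibre_jac_along_parallel_has_potential[OF q X(1,3) r(2) e] unfolding E_def by blast
  have "smooth_on X (\<lambda>x. E x $ a $ i)" for a i
    using smooth_along_parallel[OF X(1,3) e smooth_DY[of "q a"]] q
    unfolding E_def fibre_jac_def horizontally_constant_def by simp
  then have smooth_E: "smooth_on (ball x0 r) (\<lambda>x. E x $ a $ i)" for a i using r(2) by (rule smooth_on_subset)
  have inv_E: "invertible (E x)" if "x \<in> ball x0 r" for x using invX r(2) that unfolding E_def by blast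
  obtain W V g where W: "open W" "x0 \<in> W" "W \<subseteq> ball x0 r" and V: "open V" "homeomorphism W V f g"
    and smooth: "smooth_map_on (ball x0 r) f" "smooth_map_on V g"
    using smooth_local_inverse_function[OF open_ball _ bspec[OF f] smooth_E inv_E] r(1) by (metis centre_in_ball)
  define F0 where "F0 s = Floc F c (x0, matrix_inv (E x0) *v s)" for s
  have "\<forall>x\<in>W. \<forall>v. Floc F c (x, v) = F0 (frechet_derivative f (at x) v)"
  proof (intro ballI allI)
    fix x v assume "x \<in> W"
    then have x: "x \<in> ball x0 r" using W(3) by blast
    have "Floc F c (x, matrix_inv (E x) *v (E x *v v)) = F0 (E x *v v)"
      unfolding F0_def E_def
      by (rule F_dual_frame_constant[OF q X(1,3) e invX convex_ball r(2) x]) (use r(1) in simp)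
    then show "Floc F c (x, v) = F0 (frechet_derivative f (at x) v)"
      unfolding frechet_derivative_at[OF bspec[OF f x], symmetric] by (simp add: inv_E[OF x])
  qed
  then show ?thesis
    using that[OF W(1,2) _ V smooth_map_on_subset[OF smooth(1) W(3)] smooth(2)] W(3) r(2) X(3) by blast
qed

end

theorem (in weakly_landsberg_chart) berwald_chart_if_surface:
  assumes n: "CARD('n) = 2"
  shows "berwald_chart F c"
proof
  fix x and y y' :: "real^'n" and l i k assume x: "x \<in> U" and y: "y \<noteq> 0" "y' \<noteq> 0"
  show "berwald_coeff l i k (x, y) = berwald_coeff l i k (x, y')"
    by (rule constant_on_fibre_if_grad_y_0[OF smooth_berwald_coeff x _ _ y])
       (use x n DY_berwald_coeff_0_if_surface[OF n] in \<open>auto simp: vec_eq_iff\<close>)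
qed

lemma (in weakly_landsberg_chart) fibre_coordinates_if_surface:
  assumes n: "CARD('n) = 2" and z: "z \<in> TU0" and I: "mean_cartan z \<noteq> 0"
  obtains q where "\<forall>a. horizontally_constant (q a)" "invertible (fibre_jac q z)"
proof -
  obtain a b :: 'n where ab: "UNIV = {a, b}" "a \<noteq> b" using n by (auto simp: card_2_iff)
  define q where "q = (\<lambda>i. if i = a then L else distortion)"
  have "\<forall>a. horizontally_constant (q a)"
    unfolding horizontally_constant_def q_def
    using smooth_L smooth_distortion hor_deriv_L hor_deriv_distortion_0 by simp
  moreover have "invertible (fibre_jac q z)"
  proof (rule invertible_if_kernel_trivial)
    fix m assume "fibre_jac q z *v m = 0"
    then have "grad_y (q i) z \<bullet> m = 0" for i
      by (metis fibre_jac_def matrix_vector_mul_component vec_lambda_beta zero_index)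
    from this[of a] this[of b] have "m \<bullet> grad_y L z = 0" "m \<bullet> mean_cartan z = 0"
      using ab(2) by (simp_all add: q_def mean_cartan_eq[OF z] inner_commute)
    moreover have "grad_y L z \<bullet> snd z \<noteq> 0" "snd z \<noteq> 0" using grad_y_L_snd[OF z] L_pos[OF z] z by (auto simp: inner_commute)
    ultimately show "m = 0"
      using zero_if_orthogonal_in_plane[OF n _ I] snd_mean_cartan[OF z] by (metis inner_commute)
  qed
  ultimately show ?thesis by (rule that)
qed

section \<open>Charts of a homogeneous Finsler space\<close>

lemma chart_cinv:
  assumes "is_chart c" "x \<in> snd c ` fst c"
  shows "cinv c x \<in> fst c" "snd c (cinv c x) = x"
  using assms unfolding cinv_def by (auto intro: inv_into_into f_inv_into_f)

lemma chart_homeomorphism: "is_chart c \<Longrightarrow> homeomorphism (fst c) (snd c ` fst c) (snd c) (cinv c)"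
  unfolding is_chart_def cinv_def by blast

lemma cinv_chart: "is_chart c \<Longrightarrow> p \<in> fst c \<Longrightarrow> cinv c (snd c p) = p"
  using chart_homeomorphism[of c] unfolding homeomorphism_def by blast

lemma chart_open_image:
  assumes "is_chart c" "open V" "V \<subseteq> fst c"
  shows "open (snd c ` V)"
proof -
  have "openin (top_of_set (snd c ` fst c)) (snd c ` V)"
    by (rule homeomorphism_imp_open_map[OF chart_homeomorphism[OF assms(1)]]) (use assms(2,3) open_subset in blast)
  then show ?thesis using assms(1) openin_open_trans unfolding is_chart_def by blast
qed

lemma chart_open_overlap:
  assumes "is_chart c" "is_chart d"
  shows "open (snd c ` (fst c \<inter> fst d))"
  using assms by (intro chart_open_image) (auto simp: is_chart_def)

locale finsler_space =
  fixes A :: "('m::topological_space, 'n::finite) chart set" and F :: "('m, 'n) tbfun"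
  assumes finsler: "finsler A F"
begin

lemma chart: "c \<in> A \<Longrightarrow> is_chart c"
  and compat: "c \<in> A \<Longrightarrow> d \<in> A \<Longrightarrow> smooth_compat c d"
  using finsler unfolding finsler_def smooth_atlas_def by simp_all

lemma atlas_covers: "\<exists>c\<in>A. p \<in> fst c"
proof -
  have "p \<in> \<Union>(fst ` A)" using finsler unfolding finsler_def smooth_atlas_def by simp
  then show ?thesis by blast
qed

lemma F_dtrans: "c \<in> A \<Longrightarrow> d \<in> A \<Longrightarrow> p \<in> fst c \<Longrightarrow> p \<in> fst d \<Longrightarrow> F d p (dtrans c d p y) = F c p y"
  using finsler unfolding finsler_def by blast

lemma atlas_finsler_chart:
  assumes c: "c \<in> A"
  shows "finsler_chart F c"
proof
  show "open (snd c ` fst c)" using chart[OF c] unfolding is_chart_def by blast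
  show "Floc F c (x, y) \<ge> 0" if "x \<in> snd c ` fst c" for x y
    using finsler c chart_cinv(1)[OF chart[OF c] that] unfolding finsler_def Floc_def by simp
  show "Floc F c (x, t *\<^sub>R y) = t * Floc F c (x, y)" if "x \<in> snd c ` fst c" "t > 0" for x t y
    using finsler c chart_cinv(1)[OF chart[OF c] that(1)] that(2) unfolding finsler_def Floc_def by simp
  show "smooth_on (snd c ` fst c \<times> (UNIV - {0})) (Floc F c)" using finsler c unfolding finsler_def by blast
  show "gform F c (x, y) v v > 0" if "x \<in> snd c ` fst c" "y \<noteq> 0" "v \<noteq> 0" for x y v
    using finsler c that unfolding finsler_def by blast
qed

definition torsion_free :: bool where
  "torsion_free \<longleftrightarrow> (\<forall>c\<in>A. \<forall>x\<in>snd c ` fst c. \<forall>y. y \<noteq> 0 \<longrightarrow> finsler_chart.mean_cartan F c (x, y) = 0)"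

lemma riemannian_if_torsion_free:
  assumes "torsion_free" and n: "CARD('n) \<ge> 2"
  shows "riemannian A F"
  unfolding riemannian_def
proof (intro ballI allI impI)
  fix c x and y y' :: "real^'n" and i j
  assume c: "c \<in> A" and x: "x \<in> snd c ` fst c" and y: "y \<noteq> 0" "y' \<noteq> 0"
  interpret finsler_chart F c by (rule atlas_finsler_chart[OF c])
  show "gten F c i j (x, y) = gten F c i j (x, y')"
    by (rule deicke[OF x _ n y]) (use assms(1) c x in \<open>unfold torsion_free_def, blast\<close>)
qed

end

locale homogeneous_finsler_space = finsler_space A F
  for A :: "('m::topological_space, 'n::finite) chart set" and F :: "('m, 'n) tbfun" +
  assumes homogeneous: "homogeneous A F"
begin

lemma homogeneous_isometry:
  assumes cd: "c \<in> A" "d \<in> A" and x1: "x1 \<in> snd c ` fst c" and x0: "x0 \<in> snd d ` fst d"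
  shows "\<exists>\<Phi> W. finsler_isometry F c d \<Phi> W \<and> x1 \<in> W \<and> \<Phi> x1 = x0"
proof -
  note charts = chart[OF cd(1)] chart[OF cd(2)]
  obtain \<psi> where \<psi>: "isometry A F \<psi>" "\<psi> (cinv c x1) = cinv d x0" using homogeneous unfolding homogeneous_def by blast
  define \<Phi> where "\<Phi> = snd d \<circ> \<psi> \<circ> cinv c"
  define V where "V = fst c \<inter> \<psi> -` fst d"
  have diffeo: "diffeo A \<psi>" and iso: "\<And>p y. p \<in> fst c \<Longrightarrow> \<psi> p \<in> fst d \<Longrightarrow>
      F d (\<psi> p) (frechet_derivative \<Phi> (at (snd c p)) y) = F c p y"
    using \<psi>(1) cd unfolding isometry_def \<Phi>_def by auto
  have "open V" unfolding V_def
    using diffeo charts unfolding diffeo_def is_chart_def by (intro open_Int open_vimage) auto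
  then have open_W: "open (snd c ` V)" by (intro chart_open_image charts) (auto simp: V_def)
  have W: "cinv c x \<in> fst c" "\<psi> (cinv c x) \<in> fst d" "snd c (cinv c x) = x" if "x \<in> snd c ` V" for x
    using that cinv_chart[OF charts(1)] by (auto simp: V_def)
  interpret C: finsler_chart F c by (rule atlas_finsler_chart[OF cd(1)])
  interpret D: finsler_chart F d by (rule atlas_finsler_chart[OF cd(2)])
  have "finsler_isometry F c d \<Phi> (snd c ` V)"
  proof
    show "snd c ` V \<subseteq> snd c ` fst c" by (auto simp: V_def)
    show "smooth_map_on (snd c ` V) \<Phi>" using diffeo cd unfolding diffeo_def V_def \<Phi>_def by blast
    show "\<Phi> x \<in> snd d ` fst d" if "x \<in> snd c ` V" for x using W[OF that] by (auto simp: \<Phi>_def)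
    show "Floc F d (\<Phi> x, frechet_derivative \<Phi> (at x) y) = Floc F c (x, y)" if "x \<in> snd c ` V" for x y
      using iso[of "cinv c x" y] W[OF that] cinv_chart[OF charts(2)] by (simp add: Floc_def \<Phi>_def)
  qed (rule open_W)
  moreover have "x1 \<in> snd c ` V"
    using chart_cinv[OF charts(1) x1] chart_cinv[OF charts(2) x0] \<psi>(2) unfolding V_def by force
  moreover have "\<Phi> x1 = x0" using \<psi>(2) chart_cinv[OF charts(2) x0] by (simp add: \<Phi>_def)
  ultimately show ?thesis by blast
qed

lemma atlas_homogeneous_chart:
  assumes c: "c \<in> A"
  shows "homogeneous_chart F c"
proof -
  interpret finsler_chart F c by (rule atlas_finsler_chart[OF c])
  show ?thesis by unfold_locales (rule homogeneous_isometry[OF c c])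
qed

lemma torsion_free_if_one_point:
  assumes d: "d \<in> A" "x0 \<in> snd d ` fst d" "\<And>y. y \<noteq> 0 \<Longrightarrow> finsler_chart.mean_cartan F d (x0, y) = 0"
  shows torsion_free
  unfolding torsion_free_def
proof (intro ballI allI impI)
  fix c x and y :: "real^'n" assume c: "c \<in> A" "x \<in> snd c ` fst c" and y: "y \<noteq> 0"
  obtain \<Phi> W where iso: "finsler_isometry F c d \<Phi> W" and x: "x \<in> W" "\<Phi> x = x0"
    using homogeneous_isometry[OF c(1) d(1) c(2) d(2)] by blast
  interpret finsler_isometry F c d \<Phi> W by (rule iso)
  show "mean_cartan (x, y) = 0"
    using mean_cartan_pullback[of "(x, y)"] d(3)[OF jac_mult_nonzero[OF x(1) y]] x y by (simp add: tangent_map_def)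
qed

end

locale nonpositively_curved_homogeneous_space = homogeneous_finsler_space A F
  for A :: "('m::topological_space, 'n::finite) chart set" and F :: "('m, 'n) tbfun" +
  assumes isotropic_S: "isotropic_S A F" and flag_curv_le0: "flag_curv_le0 A F"
begin

lemma atlas_nonpositively_curved_chart:
  assumes c: "c \<in> A"
  shows "nonpositively_curved_homogeneous_chart F c"
proof -
  interpret homogeneous_chart F c by (rule atlas_homogeneous_chart[OF c])
  obtain cf where "\<And>x y. x \<in> U \<Longrightarrow> y \<noteq> 0 \<Longrightarrow>
      Scurv F c (x, y) = (real CARD('n) + 1) * cf (cinv c x) * Floc F c (x, y)"
    using isotropic_S c unfolding isotropic_S_def by blast
  then have "Scurv F c (x, y) = 0" if "x \<in> U" "y \<noteq> 0" for x y
    using Scurv_0_if_isotropic[of x "(real CARD('n) + 1) * cf (cinv c x)" y] that by blast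
  then show ?thesis
    using flag_curv_le0 c unfolding flag_curv_le0_def by unfold_locales blast+
qed

lemma torsion_free_if_negatively_curved:
  assumes "flag_curv_lt0 A F"
  shows torsion_free
  unfolding torsion_free_def
proof (intro ballI allI impI)
  fix c x and y :: "real^'n" assume c: "c \<in> A" "x \<in> snd c ` fst c" "y \<noteq> 0"
  interpret nonpositively_curved_homogeneous_chart F c by (rule atlas_nonpositively_curved_chart[OF c(1)])
  show "mean_cartan (x, y) = 0"
    by (rule mean_cartan_0_if_negatively_curved) (use assms c in \<open>auto simp: flag_curv_lt0_def\<close>)
qed

end

subsection \<open>Change of coordinates in a chart\<close>

locale coordinate_change =
  fixes c :: "('m::topological_space, 'n::finite) chart" and W V :: "(real^'n) set" and f g :: "real^'n \<Rightarrow> real^'n"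
  assumes chart_c: "is_chart c" and W: "open W" "W \<subseteq> snd c ` fst c" and V: "open V"
    and fg: "homeomorphism W V f g" and smooth_f: "smooth_map_on W f" and smooth_g: "smooth_map_on V g"
begin

definition rechart :: "('m, 'n) chart" where
  "rechart = (fst c \<inter> snd c -` W, f \<circ> snd c)"

lemma fst_rechart: "fst rechart = fst c \<inter> snd c -` W" and snd_rechart: "snd rechart q = f (snd c q)"
  by (simp_all add: rechart_def)

lemma g_f: "x \<in> W \<Longrightarrow> g (f x) = x" and f_g: "y \<in> V \<Longrightarrow> f (g y) = y" and f_V: "x \<in> W \<Longrightarrow> f x \<in> V"
  using fg unfolding homeomorphism_def by auto

lemma homeomorphism_rechart: "homeomorphism (fst rechart) V (snd rechart) (cinv c \<circ> g)"
proof -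
  have "snd c ` fst rechart = W"
    using W(2) chart_cinv[OF chart_c] by (force simp: fst_rechart)
  then have "homeomorphism (fst rechart) W (snd c) (cinv c)"
    using homeomorphism_of_subsets[OF chart_homeomorphism[OF chart_c] _ W(2)] by (simp add: fst_rechart)
  from homeomorphism_compose[OF this fg] show ?thesis by (simp add: rechart_def)
qed

lemma cinv_rechart:
  assumes "y \<in> V"
  shows "cinv rechart y = cinv c (g y)"
proof -
  have "cinv c (g y) \<in> fst rechart" "snd rechart (cinv c (g y)) = y" "inj_on (snd rechart) (fst rechart)"
    using homeomorphism_rechart assms unfolding homeomorphism_def by (auto intro: inj_on_inverseI)
  then show ?thesis unfolding cinv_def[of rechart] using inv_into_f_eq by metis
qed

lemma image_rechart: "snd rechart ` fst rechart = V"
  using homeomorphism_rechart unfolding homeomorphism_def by blast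

lemma is_chart_rechart: "is_chart rechart"
  unfolding is_chart_def image_rechart
proof (intro conjI V)
  have "continuous_on (fst c) (snd c)" using chart_homeomorphism[OF chart_c] unfolding homeomorphism_def by blast
  then show "open (fst rechart)"
    unfolding fst_rechart using continuous_open_preimage[OF _ _ W(1)] chart_c unfolding is_chart_def by blast
  show "homeomorphism (fst rechart) V (snd rechart) (inv_into (fst rechart) (snd rechart))"
    by (rule homeomorphism_cong[OF homeomorphism_rechart]) (use cinv_rechart in \<open>auto simp: cinv_def[of rechart]\<close>)
qed

lemma smooth_compat_rechart_left:
  assumes d: "is_chart d" and cd: "smooth_compat c d"
  shows "smooth_compat rechart d"
proof -
  let ?S = "snd rechart ` (fst rechart \<inter> fst d)"
  note open_S = chart_open_overlap[OF is_chart_rechart d]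
  have S: "?S \<subseteq> V" using image_rechart by blast
  have "smooth_map_on ?S (\<lambda>y. (snd d \<circ> cinv c) (g y))"
  proof (rule smooth_map_on_compose[OF open_S chart_open_overlap[OF chart_c d] smooth_map_on_subset[OF smooth_g S] _
        cd[unfolded smooth_compat_def]])
    show "g y \<in> snd c ` (fst c \<inter> fst d)" if "y \<in> ?S" for y
      using that g_f by (auto simp: fst_rechart snd_rechart)
  qed
  then show ?thesis
    unfolding smooth_compat_def by (rule smooth_map_on_cong[OF open_S]) (use S cinv_rechart in auto)
qed

lemma smooth_compat_rechart_right:
  assumes d: "is_chart d" and dc: "smooth_compat d c"
  shows "smooth_compat d rechart"
proof -
  let ?S = "snd d ` (fst d \<inter> fst rechart)"
  have "smooth_map_on ?S (\<lambda>x. f ((snd c \<circ> cinv d) x))"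
  proof (rule smooth_map_on_compose[OF chart_open_overlap[OF d is_chart_rechart] W(1) _ _ smooth_f])
    show "smooth_map_on ?S (snd c \<circ> cinv d)"
      by (rule smooth_map_on_subset[OF dc[unfolded smooth_compat_def]]) (auto simp: fst_rechart)
    show "(snd c \<circ> cinv d) x \<in> W" if "x \<in> ?S" for x using that cinv_chart[OF d] by (auto simp: fst_rechart)
  qed
  then show ?thesis unfolding smooth_compat_def by (simp add: rechart_def comp_def)
qed

lemma g_has_derivative:
  assumes "x \<in> W"
  shows "(g has_derivative frechet_derivative g (at (f x))) (at (f x))"
  using smooth_map_on_imp_differentiable[OF smooth_g V f_V[OF assms]] by (simp add: frechet_derivative_works)

lemma derivative_f_g:
  assumes x: "x \<in> W"
  shows "frechet_derivative f (at x) (frechet_derivative g (at (f x)) y) = y"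
proof -
  have "(f has_derivative frechet_derivative f (at x)) (at (g (f x)))"
    using smooth_map_on_imp_differentiable[OF smooth_f W(1) x] by (simp add: g_f x frechet_derivative_works)
  from has_derivative_compose[OF g_has_derivative[OF x] this]
  have "((\<lambda>y. f (g y)) has_derivative (\<lambda>y. frechet_derivative f (at x) (frechet_derivative g (at (f x)) y))) (at (f x))" .
  moreover have "((\<lambda>y. f (g y)) has_derivative (\<lambda>y. y)) (at (f x))"
    by (rule has_derivative_transform_within_open[OF has_derivative_ident V f_V[OF x]]) (simp add: f_g)
  ultimately show ?thesis by (rule has_derivative_unique[THEN fun_cong])
qed

lemma dtrans_rechart:
  assumes d: "is_chart d" and cd: "smooth_compat c d" and q: "q \<in> fst rechart" "q \<in> fst d"
  shows "dtrans rechart d q y = dtrans c d q (frechet_derivative g (at (snd rechart q)) y)"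
proof -
  let ?x = "snd c q"
  have x: "?x \<in> W" "?x \<in> snd c ` (fst c \<inter> fst d)" using q by (auto simp: fst_rechart)
  have "trans_map c d differentiable (at (g (f ?x)))"
    using smooth_map_on_imp_differentiable[OF _ chart_open_overlap[OF chart_c d] x(2)] cd
    by (simp add: smooth_compat_def trans_map_def g_f x(1))
  then have "(trans_map c d has_derivative dtrans c d q) (at (g (f ?x)))"
    by (simp add: frechet_derivative_works dtrans_def[abs_def] g_f x(1))
  from has_derivative_compose[OF g_has_derivative[OF x(1)] this]
  have "(trans_map rechart d has_derivative (\<lambda>y. dtrans c d q (frechet_derivative g (at (f ?x)) y))) (at (f ?x))"
    by (rule has_derivative_transform_within_open[OF _ V f_V[OF x(1)]]) (simp add: trans_map_def cinv_rechart)
  from frechet_derivative_at[OF this] show ?thesis by (simp add: dtrans_def snd_rechart fun_eq_iff)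
qed

end

lemma (in finsler_space) F_flat_chart:
  assumes "coordinate_change c W V f g" and c: "c \<in> A"
    and F0: "\<forall>x\<in>W. \<forall>v. Floc F c (x, v) = F0 (frechet_derivative f (at x) v)"
    and d: "d \<in> A" and q: "q \<in> fst (coordinate_change.rechart c W f)" "q \<in> fst d"
  shows "F d q (dtrans (coordinate_change.rechart c W f) d q y) = F0 y"
proof -
  interpret coordinate_change c W V f g by (rule assms(1))
  let ?w = "frechet_derivative g (at (snd rechart q)) y"
  have qW: "q \<in> fst c" "snd c q \<in> W" using q(1) by (auto simp: fst_rechart)
  have "F d q (dtrans rechart d q y) = F c q ?w"
    unfolding dtrans_rechart[OF chart[OF d] compat[OF c d] q] by (rule F_dtrans[OF c d qW(1) q(2)])
  also have "\<dots> = Floc F c (snd c q, ?w)" by (simp add: Floc_def cinv_chart[OF chart_c qW(1)])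
  also have "\<dots> = F0 y" using F0 qW(2) derivative_f_g[OF qW(2)] by (simp add: snd_rechart)
  finally show ?thesis .
qed

lemma (in nonpositively_curved_homogeneous_space) locally_minkowskian_if_surface:
  assumes n: "CARD('n) = 2" and torsion: "\<not> torsion_free"
  shows "locally_minkowskian A F"
  unfolding locally_minkowskian_def
proof
  fix p :: 'm
  obtain c where c: "c \<in> A" "p \<in> fst c" using atlas_covers by blast
  interpret nonpositively_curved_homogeneous_chart F c by (rule atlas_nonpositively_curved_chart[OF c(1)])
  interpret berwald_chart F c by (rule berwald_chart_if_surface[OF n])
  have x: "snd c p \<in> U" using c(2) by blast
  obtain y where y: "y \<noteq> 0" "mean_cartan (snd c p, y) \<noteq> 0"
    using torsion_free_if_one_point[OF c(1) x] torsion by blast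
  then have z: "(snd c p, y) \<in> TU0" using x by blast
  obtain q where q: "\<forall>a. horizontally_constant (q a)" "invertible (fibre_jac q (snd c p, y))"
    using fibre_coordinates_if_surface[OF n z y(2)] by blast
  obtain W V and f g :: "real^'n \<Rightarrow> real^'n" and F0 where W: "open W" "snd c p \<in> W" "W \<subseteq> U"
    and V: "open V" "homeomorphism W V f g" "smooth_map_on W f" "smooth_map_on V g"
    and F0: "\<forall>x\<in>W. \<forall>v. Floc F c (x, v) = F0 (frechet_derivative f (at x) v)"
    using flat_coordinates[OF q(1) z q(2)] by blast
  have change: "coordinate_change c W V f g" by unfold_locales (use W V chart[OF c(1)] in auto)
  interpret E: coordinate_change c W V f g by (rule change)
  note flat = F_flat_chart[OF change c(1) F0]
  show "\<exists>e :: ('m, 'n) chart. p \<in> fst e \<and> is_chart e \<and> (\<forall>c\<in>A. smooth_compat e c \<and> smooth_compat c e) \<and>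
      (\<forall>q1\<in>fst e. \<forall>q2\<in>fst e. \<forall>c1\<in>A. \<forall>c2\<in>A. \<forall>y. q1 \<in> fst c1 \<longrightarrow> q2 \<in> fst c2 \<longrightarrow>
         F c1 q1 (dtrans e c1 q1 y) = F c2 q2 (dtrans e c2 q2 y))"
  proof (intro exI[of _ E.rechart] conjI ballI allI impI)
    show "p \<in> fst E.rechart" using c(2) W(2) by (simp add: E.fst_rechart)
    show "is_chart E.rechart" by (rule E.is_chart_rechart)
    show "smooth_compat E.rechart d" "smooth_compat d E.rechart" if "d \<in> A" for d
      using that c(1) by (simp_all add: E.smooth_compat_rechart_left E.smooth_compat_rechart_right chart compat)
  qed (simp add: flat)
qed

lemma flag_curv_le0_if_lt0: "flag_curv_lt0 A F \<Longrightarrow> flag_curv_le0 A F"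
  unfolding flag_curv_lt0_def flag_curv_le0_def by (meson less_imp_le)

theorem theorem1p1:
  fixes A :: "('m::{t2_space, second_countable_topology}, 'n::finite) chart set"
    and F :: "('m, 'n) tbfun"
  assumes "smooth_atlas A"
    and "connected (UNIV :: 'm set)"
    and "finsler A F"
    and "homogeneous A F"
    and "isotropic_S A F"
    and "CARD('n) \<ge> 2"
    and "CARD('n) = 2 \<Longrightarrow> flag_curv_le0 A F"
    and "CARD('n) > 2 \<Longrightarrow> flag_curv_lt0 A F"
  shows "riemannian A F \<or> locally_minkowskian A F"
proof -
  have "flag_curv_le0 A F" using assms(6-8) flag_curv_le0_if_lt0 by (cases "CARD('n) = 2") auto
  then interpret nonpositively_curved_homogeneous_space A F by unfold_locales (use assms in auto)
  show ?thesis
  proof (cases torsion_free)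
    case True
    then show ?thesis using riemannian_if_torsion_free assms(6) by blast
  next
    case False
    then have "CARD('n) = 2" using torsion_free_if_negatively_curved assms(6,8) by fastforce
    then show ?thesis using locally_minkowskian_if_surface False by blast
  qed
qed

end
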